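(* Let $D\subset \mathbb{C}^n$ be a bounded domain endowed with its Bergman metric $g_B$, and let $V$ be a projective Kähler manifold (a projective manifold endowed with the restriction of the Fubini–Study metric). Then $(D,g_B)$ and $V$ are not relatives.
   Context: A Kähler immersion between Kähler manifolds is a holomorphic and isometric immersion. Let $r$ be a positive integer. Two Kähler manifolds $M_1$ and $M_2$ are $r$-relatives if they have in common a complex $r$-dimensional Kähler submanifold, i.e. there exist a (non-empty) Kähler manifold $S$ of complex dimension $r$ and two Kähler immersions $h_1:S\to M_1$ and $h_2:S\to M_2$. They are relatives if they are $r$-relatives for some positive integer $r$; otherwise they are said to be not relatives. The Bergman metric $g_B$ on a bounded domain $D\subset\mathbb{C}^n$ is the Kähler metric with Kähler form $\frac{i}{2}\partial\bar\partial \log K_B(z,z)$, where $K_B(z,z)=\sum_{j\ge 0}|F_j(z)|^2$ is the Bergman kernel, $\{F_j\}$ being any orthonormal basis of the Hilbert space of square-integrable (with respect to Lebesgue measure) holomorphic functions on $D$. The Fubini–Study metric $g_{FS}$ on $\mathbb{C}P^m$ is the Kähler metric whose Kähler form on the affine chart $Z_0\ne 0$, with $w_j=Z_j/Z_0$, is $\frac{i}{2}\partial\bar\partial\log\left(1+\sum_{j=1}^m|w_j|^2\right)$ (and similarly on the other charts). A projective Kähler manifold is a complex submanifold of some $\mathbb{C}P^m$, with $m$ finite, endowed with the restriction of $g_{FS}$; no compactness or completeness is assumed. *)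

theory Defs
  imports "HOL-Analysis.Analysis"
begin

section \<open>Calculus on \<open>\<complex>\<^sup>n\<close>\<close>

definition holomorphic_function_on :: "(complex^'n::finite) set \<Rightarrow> (complex^'n \<Rightarrow> complex) \<Rightarrow> bool" where
  "holomorphic_function_on S f \<longleftrightarrow>
     (\<forall>z\<in>S. \<exists>f'. (f has_derivative f') (at z) \<and> (\<forall>c v. f' (c *s v) = c * f' v))"

definition holomorphic_map_on ::
  "(complex^'n::finite) set \<Rightarrow> (complex^'n \<Rightarrow> complex^'m::finite) \<Rightarrow> bool" where
  "holomorphic_map_on S f \<longleftrightarrow>
     (\<forall>z\<in>S. \<exists>f'. (f has_derivative f') (at z) \<and> (\<forall>c v. f' (c *s v) = c *s f' v))"

text \<open>\<open>C\<^sup>k\<close> functions on an open subset of a finite-dimensional space.\<close>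

fun Ck_on :: "nat \<Rightarrow> 'a::euclidean_space set \<Rightarrow> ('a \<Rightarrow> 'b::real_normed_vector) \<Rightarrow> bool" where
  "Ck_on 0 S f \<longleftrightarrow> continuous_on S f"
| "Ck_on (Suc k) S f \<longleftrightarrow>
     f differentiable_on S \<and> (\<forall>v. Ck_on k S (\<lambda>x. frechet_derivative f (at x) v))"

definition smooth_on :: "'a::euclidean_space set \<Rightarrow> ('a \<Rightarrow> 'b::real_normed_vector) \<Rightarrow> bool" where
  "smooth_on S f \<longleftrightarrow> (\<forall>k. Ck_on k S f)"

text \<open>\<open>del f z u\<close> and \<open>delbar f z u\<close> are the values of the one-forms
  \<open>\<partial>f = \<Sum>\<^sub>j (\<partial>f/\<partial>z\<^sub>j) dz\<^sub>j\<close> and its conjugate analogue at the point \<open>z\<close> on the tangent vector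
  \<open>u\<close>. The two-form \<open>deldelbar f = \<Sum>\<^sub>j\<^sub>k (\<partial>\<^sup>2f/\<partial>z\<^sub>j\<partial>zbar\<^sub>k) dz\<^sub>j \<and> dzbar\<^sub>k\<close> uses the convention
  \<open>(\<alpha> \<and> \<beta>)(u,v) = \<alpha>(u)\<beta>(v) - \<alpha>(v)\<beta>(u)\<close>.\<close>

definition del :: "(complex^'n::finite \<Rightarrow> complex) \<Rightarrow> complex^'n \<Rightarrow> complex^'n \<Rightarrow> complex" where
  "del f z u = (frechet_derivative f (at z) u - \<i> * frechet_derivative f (at z) (\<i> *s u)) / 2"

definition delbar :: "(complex^'n::finite \<Rightarrow> complex) \<Rightarrow> complex^'n \<Rightarrow> complex^'n \<Rightarrow> complex" where
  "delbar f z u = (frechet_derivative f (at z) u + \<i> * frechet_derivative f (at z) (\<i> *s u)) / 2"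

definition deldelbar ::
  "(complex^'n::finite \<Rightarrow> complex) \<Rightarrow> complex^'n \<Rightarrow> complex^'n \<Rightarrow> complex^'n \<Rightarrow> complex" where
  "deldelbar f z u v = del (\<lambda>w. delbar f w v) z u - del (\<lambda>w. delbar f w u) z v"

text \<open>The form \<open>(i/2) \<partial>\<partial>bar \<Phi>\<close> of a real potential \<open>\<Phi>\<close> is real, so \<open>Re\<close> only changes its type. A
  metric \<open>g\<close> and its Kaehler form \<open>\<omega>\<close> are related by \<open>\<omega>(u,v) = g(iu,v)\<close>, that is,
  \<open>g(u,v) = \<omega>(u,iv)\<close>.\<close>

definition potential_form ::
  "(complex^'n::finite \<Rightarrow> real) \<Rightarrow> complex^'n \<Rightarrow> complex^'n \<Rightarrow> complex^'n \<Rightarrow> real" where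
  "potential_form \<Phi> z u v = Re (\<i> / 2 * deldelbar (\<lambda>w. complex_of_real (\<Phi> w)) z u v)"

definition potential_metric ::
  "(complex^'n::finite \<Rightarrow> real) \<Rightarrow> complex^'n \<Rightarrow> complex^'n \<Rightarrow> complex^'n \<Rightarrow> real" where
  "potential_metric \<Phi> z u v = potential_form \<Phi> z u (\<i> *s v)"


section \<open>Kaehler manifolds\<close>

text \<open>A chart is a coordinate domain together with the coordinate map. The metric is given by its
  local expressions: \<open>metric M c x\<close> is the metric in the coordinates of the chart \<open>c\<close> at the point
  with coordinates \<open>x\<close>. The complex dimension is \<open>CARD('r)\<close>.\<close>

type_synonym ('a, 'r) chart = "'a set \<times> ('a \<Rightarrow> complex^'r)"

record ('a, 'r::finite) hermitian_mfd =
  mtop :: "'a topology"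
  atlas :: "('a, 'r) chart set"
  metric :: "('a, 'r) chart \<Rightarrow> complex^'r \<Rightarrow> complex^'r \<Rightarrow> complex^'r \<Rightarrow> real"

definition coord_inv :: "('a, 'r::finite) chart \<Rightarrow> complex^'r \<Rightarrow> 'a" where
  "coord_inv c = inv_into (fst c) (snd c)"

definition local_expr ::
  "('a, 'r::finite) chart \<Rightarrow> ('b, 's::finite) chart \<Rightarrow> ('a \<Rightarrow> 'b) \<Rightarrow> complex^'r \<Rightarrow> complex^'s" where
  "local_expr c d h = snd d \<circ> h \<circ> coord_inv c"

definition local_dom ::
  "('a, 'r::finite) chart \<Rightarrow> ('b, 's::finite) chart \<Rightarrow> ('a \<Rightarrow> 'b) \<Rightarrow> (complex^'r) set" where
  "local_dom c d h = snd c ` (fst c \<inter> h -` fst d)"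

definition complex_manifold :: "('a, 'r::finite) hermitian_mfd \<Rightarrow> bool" where
  "complex_manifold M \<longleftrightarrow>
     Hausdorff_space (mtop M) \<and> second_countable (mtop M) \<and>
     \<Union> (fst ` atlas M) = topspace (mtop M) \<and>
     (\<forall>c\<in>atlas M. openin (mtop M) (fst c) \<and> open (snd c ` fst c) \<and>
        homeomorphic_map (subtopology (mtop M) (fst c)) (top_of_set (snd c ` fst c)) (snd c)) \<and>
     (\<forall>c\<in>atlas M. \<forall>d\<in>atlas M.
        holomorphic_map_on (local_dom c d (\<lambda>p. p)) (local_expr c d (\<lambda>p. p)))"

definition kahler_form ::
  "('a, 'r::finite) hermitian_mfd \<Rightarrow> ('a, 'r) chart \<Rightarrow> complex^'r \<Rightarrow> complex^'r \<Rightarrow> complex^'r \<Rightarrow> real" where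
  "kahler_form M c x u v = metric M c x (\<i> *s u) v"

text \<open>The conditions say, in this order: the local expressions are Riemannian metrics that are
  compatible with the complex structure; they are smooth; they transform as a tensor; the
  Kaehler form \<open>\<omega>\<close> is closed, where
  \<open>d\<omega>(u,v,w) = D\<^sub>u \<omega>(v,w) + D\<^sub>v \<omega>(w,u) + D\<^sub>w \<omega>(u,v)\<close> for constant vector fields \<open>u\<close>, \<open>v\<close>, \<open>w\<close>.\<close>

definition kahler_manifold :: "('a, 'r::finite) hermitian_mfd \<Rightarrow> bool" where
  "kahler_manifold M \<longleftrightarrow>
     complex_manifold M \<and>
     (\<forall>c\<in>atlas M. \<forall>x\<in>snd c ` fst c.
        bilinear (metric M c x) \<and>
        (\<forall>u v. metric M c x u v = metric M c x v u) \<and>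
        (\<forall>u. u \<noteq> 0 \<longrightarrow> metric M c x u u > 0) \<and>
        (\<forall>u v. metric M c x (\<i> *s u) (\<i> *s v) = metric M c x u v)) \<and>
     (\<forall>c\<in>atlas M. \<forall>u v. smooth_on (snd c ` fst c) (\<lambda>x. metric M c x u v)) \<and>
     (\<forall>c\<in>atlas M. \<forall>d\<in>atlas M. \<forall>x\<in>local_dom c d (\<lambda>p. p). \<forall>u v.
        metric M c x u v =
        metric M d (local_expr c d (\<lambda>p. p) x)
          (frechet_derivative (local_expr c d (\<lambda>p. p)) (at x) u)
          (frechet_derivative (local_expr c d (\<lambda>p. p)) (at x) v)) \<and>
     (\<forall>c\<in>atlas M. \<forall>x\<in>snd c ` fst c. \<forall>u v w.
        frechet_derivative (\<lambda>y. kahler_form M c y v w) (at x) u +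
        frechet_derivative (\<lambda>y. kahler_form M c y w u) (at x) v +
        frechet_derivative (\<lambda>y. kahler_form M c y u v) (at x) w = 0)"

definition holomorphic_mfd_map ::
  "('a, 'r::finite) hermitian_mfd \<Rightarrow> ('b, 's::finite) hermitian_mfd \<Rightarrow> ('a \<Rightarrow> 'b) \<Rightarrow> bool" where
  "holomorphic_mfd_map M N h \<longleftrightarrow>
     continuous_map (mtop M) (mtop N) h \<and>
     (\<forall>c\<in>atlas M. \<forall>d\<in>atlas N. holomorphic_map_on (local_dom c d h) (local_expr c d h))"

definition kahler_immersion ::
  "('a, 'r::finite) hermitian_mfd \<Rightarrow> ('b, 's::finite) hermitian_mfd \<Rightarrow> ('a \<Rightarrow> 'b) \<Rightarrow> bool" where
  "kahler_immersion M N h \<longleftrightarrow>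
     holomorphic_mfd_map M N h \<and>
     (\<forall>c\<in>atlas M. \<forall>d\<in>atlas N. \<forall>x\<in>local_dom c d h.
        inj (frechet_derivative (local_expr c d h) (at x)) \<and>
        (\<forall>u v. metric M c x u v =
           metric N d (local_expr c d h x)
             (frechet_derivative (local_expr c d h) (at x) u)
             (frechet_derivative (local_expr c d h) (at x) v)))"

text \<open>Complex submanifolds (embedded: the topology is the subspace topology) with the restricted
  metric.\<close>

definition kahler_submanifold ::
  "('a, 'd::finite) hermitian_mfd \<Rightarrow> ('a, 'n::finite) hermitian_mfd \<Rightarrow> bool" where
  "kahler_submanifold V M \<longleftrightarrow>
     kahler_manifold V \<and>
     topspace (mtop V) \<subseteq> topspace (mtop M) \<and>
     mtop V = subtopology (mtop M) (topspace (mtop V)) \<and>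
     kahler_immersion V M (\<lambda>p. p)"

text \<open>\<open>r\<close>-relatives for \<open>r = CARD('r)\<close>. HOL has no quantification over types inside formulas, so the
  dimension and the type of points of the common submanifold are parameters. Being not relatives
  means that \<open>r_relatives\<close> fails for all instances of the type variables \<open>'s\<close> and \<open>'r\<close>.\<close>

definition r_relatives ::
  "('s, 'r::finite) hermitian_mfd itself \<Rightarrow>
   ('a, 'n::finite) hermitian_mfd \<Rightarrow> ('b, 'm::finite) hermitian_mfd \<Rightarrow> bool" where
  "r_relatives _ M\<^sub>1 M\<^sub>2 \<longleftrightarrow>
     (\<exists>(S :: ('s, 'r) hermitian_mfd) h\<^sub>1 h\<^sub>2.
        kahler_manifold S \<and> topspace (mtop S) \<noteq> {} \<and>
        kahler_immersion S M\<^sub>1 h\<^sub>1 \<and> kahler_immersion S M\<^sub>2 h\<^sub>2)"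


section \<open>The Bergman metric\<close>

definition bounded_domain :: "(complex^'n::finite) set \<Rightarrow> bool" where
  "bounded_domain D \<longleftrightarrow> open D \<and> connected D \<and> D \<noteq> {} \<and> bounded D"

text \<open>The Hilbert space of square-integrable holomorphic functions on \<open>D\<close>. Its elements are
  represented by functions on the whole space whose values outside \<open>D\<close> are irrelevant.\<close>

definition bergman_space :: "(complex^'n::finite) set \<Rightarrow> (complex^'n \<Rightarrow> complex) set" where
  "bergman_space D =
     {f. holomorphic_function_on D f \<and> set_integrable lborel D (\<lambda>z. (cmod (f z))\<^sup>2)}"

definition bergman_inner ::
  "(complex^'n::finite) set \<Rightarrow> (complex^'n \<Rightarrow> complex) \<Rightarrow> (complex^'n \<Rightarrow> complex) \<Rightarrow> complex" where
  "bergman_inner D f g = set_lebesgue_integral lborel D (\<lambda>z. f z * cnj (g z))"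

definition bergman_norm :: "(complex^'n::finite) set \<Rightarrow> (complex^'n \<Rightarrow> complex) \<Rightarrow> real" where
  "bergman_norm D f = sqrt (set_lebesgue_integral lborel D (\<lambda>z. (cmod (f z))\<^sup>2))"

text \<open>Orthonormal sequences with dense linear span. For a bounded domain in positive dimension the
  space is separable and infinite-dimensional, so all orthonormal bases are sequences.\<close>

definition bergman_basis ::
  "(complex^'n::finite) set \<Rightarrow> (nat \<Rightarrow> complex^'n \<Rightarrow> complex) \<Rightarrow> bool" where
  "bergman_basis D F \<longleftrightarrow>
     (\<forall>j. F j \<in> bergman_space D) \<and>
     (\<forall>j k. bergman_inner D (F j) (F k) = (if j = k then 1 else 0)) \<and>
     (\<forall>f\<in>bergman_space D. \<forall>\<epsilon>>0. \<exists>N c. bergman_norm D (\<lambda>z. f z - (\<Sum>j<N. c j * F j z)) < \<epsilon>)"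

text \<open>The kernel on the diagonal; its value on \<open>D\<close> does not depend on the chosen basis.\<close>

definition bergman_kernel_diag :: "(complex^'n::finite) set \<Rightarrow> complex^'n \<Rightarrow> real" where
  "bergman_kernel_diag D z = (\<Sum>j. (cmod ((SOME F. bergman_basis D F) j z))\<^sup>2)"

definition bergman_mfd :: "(complex^'n::finite) set \<Rightarrow> (complex^'n, 'n) hermitian_mfd" where
  "bergman_mfd D =
     \<lparr>mtop = top_of_set D,
      atlas = {(D, \<lambda>z. z)},
      metric = (\<lambda>c. potential_metric (\<lambda>z. ln (bergman_kernel_diag D z)))\<rparr>"


section \<open>Complex projective space with the Fubini--Study metric\<close>

text \<open>Homogeneous coordinates are indexed by \<open>'m option\<close>, with \<open>None\<close> as the index \<open>0\<close>, so that the
  complex dimension is \<open>CARD('m)\<close>. A point is the set of all its homogeneous coordinate vectors.\<close>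

definition proj_point :: "complex^'k::finite \<Rightarrow> (complex^'k) set" where
  "proj_point Z = {c *s Z |c. c \<noteq> 0}"

definition proj_topology :: "(complex^'k::finite) set topology" where
  "proj_topology =
     topology (\<lambda>U. U \<subseteq> proj_point ` (- {0}) \<and> open {Z. Z \<noteq> 0 \<and> proj_point Z \<in> U})"

lemma openin_proj_topology:
  "openin proj_topology U \<longleftrightarrow>
     U \<subseteq> proj_point ` (- {0 :: complex^'k::finite}) \<and> open {Z. Z \<noteq> 0 \<and> proj_point Z \<in> U}"
proof -
  let ?L = "\<lambda>U. U \<subseteq> proj_point ` (- {0 :: complex^'k}) \<and> open {Z. Z \<noteq> 0 \<and> proj_point Z \<in> U}"
  have "istopology ?L"
    unfolding istopology_def
  proof (intro conjI allI impI)
    fix A B assume A: "?L A" and B: "?L B"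
    then show "A \<inter> B \<subseteq> proj_point ` (- {0})" by blast
    have "{Z. Z \<noteq> 0 \<and> proj_point Z \<in> A \<inter> B} =
          {Z. Z \<noteq> 0 \<and> proj_point Z \<in> A} \<inter> {Z. Z \<noteq> 0 \<and> proj_point Z \<in> B}" by blast
    with A B show "open {Z. Z \<noteq> 0 \<and> proj_point Z \<in> A \<inter> B}" by auto
  next
    fix K assume K: "\<forall>U\<in>K. ?L U"
    then show "\<Union> K \<subseteq> proj_point ` (- {0})" by blast
    have "{Z. Z \<noteq> 0 \<and> proj_point Z \<in> \<Union> K} = (\<Union>U\<in>K. {Z. Z \<noteq> 0 \<and> proj_point Z \<in> U})" by blast
    with K show "open {Z. Z \<noteq> 0 \<and> proj_point Z \<in> \<Union> K}" by auto
  qed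
  then show ?thesis
    by (simp add: proj_topology_def topology_inverse')
qed

text \<open>The affine chart \<open>Z\<^sub>a \<noteq> 0\<close> has the coordinates \<open>Z\<^sub>j/Z\<^sub>a\<close> with \<open>j \<noteq> a\<close>, and \<open>aff_index a\<close> is a
  bijection from \<open>'m\<close> to the indices different from \<open>a\<close>.\<close>

definition aff_index :: "'m option \<Rightarrow> 'm \<Rightarrow> 'm option" where
  "aff_index a l = (if Some l = a then None else Some l)"

definition aff_chart :: "'m::finite option \<Rightarrow> ((complex^('m option)) set, 'm) chart" where
  "aff_chart a =
     (proj_point ` {Z. Z $ a \<noteq> 0},
      \<lambda>p. let Z = (SOME Z. Z \<in> p) in \<chi> l. Z $ aff_index a l / Z $ a)"

definition fubini_study :: "((complex^('m::finite option)) set, 'm) hermitian_mfd" where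
  "fubini_study =
     \<lparr>mtop = proj_topology,
      atlas = range aff_chart,
      metric = (\<lambda>c. potential_metric (\<lambda>w. ln (1 + (\<Sum>j\<in>UNIV. (cmod (w $ j))\<^sup>2))))\<rparr>"

end

theory Submission
  imports Defs "HOL-Complex_Analysis.Complex_Analysis"
begin

text \<open>Suppose a common submanifold exists and restrict the two immersions to a complex line through a
  point of it: this gives holomorphic curves \<open>f\<close> in \<open>D\<close> and \<open>g\<close> in an affine chart \<open>\<complex>\<^sup>m\<close> along which the two
  metrics agree. Both potentials are logarithms of sesquiholomorphic kernels on the diagonal, so
  polarizing the equality of the mixed second derivatives yields
  \<open>K(f t, f s) = \<alpha>(t) \<beta>(s) (1 + \<Sum>\<^sub>j g\<^sub>j(t) cnj (g\<^sub>j(s)))\<close> near the origin, i.e. the Bergman kernel has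
  rank at most \<open>m + 1\<close> along \<open>f\<close>. Hence some nontrivial combination of \<open>m + 2\<close> point evaluations on the
  curve annihilates every element of an orthonormal basis, and then the whole Bergman space. But
  the Bergman space of a bounded domain contains the polynomials in a coordinate that is not constant
  along \<open>f\<close>, and these separate the points.\<close>

section \<open>Holomorphic functions of several variables\<close>

text \<open>After restriction to a complex line everything is local and in one variable, and
  \<open>V\<close> enters only through the finite dimension m of the ambient projective space. The
  factors \<alpha> and \<beta> arise because the difference of the two log-potentials has zero mixed
  derivative, so it is a function of t plus a function of s. Finite rank becomes annihilation
  through positivity: if the coefficients a_t kill the m + 1 functions of t on the right, then 0 =
  \<Sum> a_t cnj(a_s) K(f t, f s) = \<Sum> |\<Sum> a_t F_j(f t)|^2, where the outer sum on the right
  runs over the basis F_j, so each of its terms is 0. Most of the work goes into the kernel itself: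
  \<open>bergman_kernel_diag\<close> takes its basis by \<open>SOME\<close>, so a basis that is a
  sequence has to be constructed (separability, Gram-Schmidt, infinite dimension). The common source
  is that point evaluations are bounded, by the mean value inequality on balls. This bounds the
  kernel series locally and lets vanishing on a basis pass to the whole space.\<close>

lemma norm_vector_smult: "norm (c *s (v :: complex^'n)) = cmod c * norm v"
proof -
  have "norm (c *s v) = L2_set (\<lambda>i. cmod c * cmod (v $ i)) UNIV"
    by (simp add: norm_vec_def norm_mult)
  also have "\<dots> = cmod c * norm v"
    by (simp add: L2_set_right_distrib norm_vec_def)
  finally show ?thesis .
qed

lemma of_real_vector_smult: "complex_of_real r *s v = r *\<^sub>R v"
  unfolding vec_eq_iff vector_smult_component vector_scaleR_component by (simp add: scaleR_conv_of_real)

lemma bounded_linear_smult_left: "bounded_linear (\<lambda>c. c *s (v :: complex^'n))"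
proof (rule bounded_linear_intro)
  show "norm (c *s v) \<le> norm c * norm v" for c by (simp add: norm_vector_smult)
qed (simp_all add: vec_eq_iff algebra_simps)

section \<open>Complex-linear derivatives and the algebra of holomorphic functions\<close>

abbreviation fder :: "(complex^'n::finite \<Rightarrow> 'b::real_normed_vector) \<Rightarrow> complex^'n \<Rightarrow> complex^'n \<Rightarrow> 'b" where
  "fder f z \<equiv> frechet_derivative f (at z)"

lemma holomorphic_function_on_has_derivative:
  assumes "holomorphic_function_on S f" "z \<in> S"
  shows "(f has_derivative fder f z) (at z)"
  using assms unfolding holomorphic_function_on_def
  by (meson differentiable_def frechet_derivative_works)

lemma holomorphic_function_onI:
  assumes "\<And>z. z \<in> S \<Longrightarrow> (f has_derivative f' z) (at z)" "\<And>z c v. z \<in> S \<Longrightarrow> f' z (c *s v) = c * f' z v"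
  shows "holomorphic_function_on S f"
  using assms unfolding holomorphic_function_on_def by blast

lemma fder_eq: "(f has_derivative f') (at z) \<Longrightarrow> fder f z = f'"
  by (metis frechet_derivative_at)

lemma fder_smult:
  assumes "holomorphic_function_on S f" "z \<in> S"
  shows "fder f z (c *s v) = c * fder f z v"
  using assms unfolding holomorphic_function_on_def by (metis fder_eq)

lemma fder_linear:
  assumes "holomorphic_function_on S f" "z \<in> S"
  shows "linear (fder f z)"
  using holomorphic_function_on_has_derivative[OF assms] by (simp add: has_derivative_linear)

lemma holomorphic_function_on_subset:
  "holomorphic_function_on S f \<Longrightarrow> T \<subseteq> S \<Longrightarrow> holomorphic_function_on T f"
  unfolding holomorphic_function_on_def by blast

lemma holomorphic_function_on_continuous:
  assumes "holomorphic_function_on S f" shows "continuous_on S f"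
  by (meson assms continuous_at_imp_continuous_on has_derivative_continuous
      holomorphic_function_on_has_derivative)

lemma holomorphic_function_on_const: "holomorphic_function_on S (\<lambda>z. c)"
  by (rule holomorphic_function_onI[where f' = "\<lambda>_ _. 0"]) auto

lemma holomorphic_function_on_nth: "holomorphic_function_on S (\<lambda>z. z $ i)"
  by (rule holomorphic_function_onI[where f' = "\<lambda>_ v. v $ i"])
    (auto intro!: bounded_linear_imp_has_derivative)

lemma holomorphic_function_on_add:
  assumes "holomorphic_function_on S f" "holomorphic_function_on S g"
  shows "holomorphic_function_on S (\<lambda>z. f z + g z)"
  by (rule holomorphic_function_onI[where f' = "\<lambda>z v. fder f z v + fder g z v"])
    (use assms in \<open>auto intro!: has_derivative_add holomorphic_function_on_has_derivative
      simp: fder_smult distrib_left\<close>)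

lemma holomorphic_function_on_mult:
  assumes "holomorphic_function_on S f" "holomorphic_function_on S g"
  shows "holomorphic_function_on S (\<lambda>z. f z * g z)"
  by (rule holomorphic_function_onI[where f' = "\<lambda>z v. f z * fder g z v + fder f z v * g z"])
    (use assms in \<open>auto intro!: has_derivative_mult holomorphic_function_on_has_derivative
      simp: fder_smult distrib_left mult.left_commute mult.assoc\<close>)

lemma holomorphic_function_on_minus:
  assumes "holomorphic_function_on S f" "holomorphic_function_on S g"
  shows "holomorphic_function_on S (\<lambda>z. f z - g z)"
  using holomorphic_function_on_add[OF assms(1)
      holomorphic_function_on_mult[OF holomorphic_function_on_const[of _ "-1"] assms(2)]] by simp

lemma holomorphic_function_on_sum:
  assumes "\<And>i. i \<in> A \<Longrightarrow> holomorphic_function_on S (f i)"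
  shows "holomorphic_function_on S (\<lambda>z. \<Sum>i\<in>A. f i z)"
  using assms
  by (induction A rule: infinite_finite_induct)
    (auto intro: holomorphic_function_on_const holomorphic_function_on_add)

lemma holomorphic_function_on_prod:
  assumes "\<And>i. i \<in> A \<Longrightarrow> holomorphic_function_on S (f i)"
  shows "holomorphic_function_on S (\<lambda>z. \<Prod>i\<in>A. f i z)"
  using assms
  by (induction A rule: infinite_finite_induct)
    (auto intro: holomorphic_function_on_const holomorphic_function_on_mult)

lemma holomorphic_function_on_compose_field:
  assumes "holomorphic_function_on S f" "\<And>z. z \<in> S \<Longrightarrow> (\<phi> has_field_derivative \<phi>' z) (at (f z))"
  shows "holomorphic_function_on S (\<lambda>z. \<phi> (f z))"
proof (rule holomorphic_function_onI)
  show "((\<lambda>z. \<phi> (f z)) has_derivative (\<lambda>v. \<phi>' z * fder f z v)) (at z)" if "z \<in> S" for z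
    using has_derivative_compose[OF holomorphic_function_on_has_derivative[OF assms(1) that]
        assms(2)[OF that, unfolded has_field_derivative_def]] .
  show "\<phi>' z * fder f z (c *s v) = c * (\<phi>' z * fder f z v)" if "z \<in> S" for z c v
    by (simp add: fder_smult[OF assms(1) that])
qed

lemma holomorphic_function_on_compose_map:
  assumes "holomorphic_function_on T f"
    and "\<And>z. z \<in> S \<Longrightarrow> g z \<in> T"
    and "\<And>z. z \<in> S \<Longrightarrow> (g has_derivative g' z) (at z)" "\<And>z c v. z \<in> S \<Longrightarrow> g' z (c *s v) = c *s g' z v"
  shows "holomorphic_function_on S (\<lambda>z. f (g z))"
proof (rule holomorphic_function_onI)
  show "((\<lambda>z. f (g z)) has_derivative (\<lambda>v. fder f (g z) (g' z v))) (at z)" if "z \<in> S" for z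
    using has_derivative_compose[OF assms(3)[OF that]
        holomorphic_function_on_has_derivative[OF assms(1) assms(2)[OF that]]] .
  show "fder f (g z) (g' z (c *s v)) = c * fder f (g z) (g' z v)" if "z \<in> S" for z c v
    by (simp add: assms(4)[OF that] fder_smult[OF assms(1) assms(2)[OF that]])
qed

text \<open>Complex linearity of the derivative makes the restriction to a complex line complex
  differentiable in \<tau>. This is how one-variable theorems are applied in several
  variables.\<close>

lemma line_field_derivative:
  assumes "holomorphic_function_on S f" "z + \<tau> *s v \<in> S"
  shows "((\<lambda>\<tau>. f (z + \<tau> *s v)) has_field_derivative fder f (z + \<tau> *s v) v) (at \<tau>)"
proof -
  have "((\<lambda>\<tau>. z + \<tau> *s v) has_derivative (\<lambda>\<tau>. 0 + \<tau> *s v)) (at \<tau>)"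
    by (rule has_derivative_add[OF has_derivative_const
          bounded_linear_imp_has_derivative[OF bounded_linear_smult_left]])
  from has_derivative_compose[OF this holomorphic_function_on_has_derivative[OF assms]]
  show ?thesis
    unfolding has_field_derivative_def by (simp add: fder_smult[OF assms] mult_commute_abs)
qed

lemma line_holomorphic_on:
  assumes "holomorphic_function_on S f" "\<And>\<tau>. \<tau> \<in> T \<Longrightarrow> z + \<tau> *s v \<in> S"
  shows "(\<lambda>\<tau>. f (z + \<tau> *s v)) holomorphic_on T"
  unfolding holomorphic_on_def field_differentiable_def
  using line_field_derivative[OF assms(1) assms(2)] has_field_derivative_at_within by blast

text \<open>Taylor's formula for \<tau> -> f(z + \<tau> h) between 0 and 1, with Cauchy's inequality
  for the derivatives. The bounds depend on \<open>f\<close> only through \<open>M\<close>, so they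
  are uniform over a bounded family and survive a pointwise limit.\<close>

lemma remainder_estimate:
  assumes hol: "holomorphic_function_on (ball z R) f"
    and M: "\<And>w. w \<in> ball z R \<Longrightarrow> cmod (f w) \<le> M"
    and h: "norm h \<le> R / 2" and R: "R > 0"
  shows "cmod (f (z + h) - f z - fder f z h) \<le> 32 * M * (norm h)\<^sup>2 / R\<^sup>2"
    and "cmod (fder f z h) \<le> 4 * M * norm h / R"
proof -
  have M0: "M \<ge> 0" using M[of z] R by (meson centre_in_ball norm_ge_zero order_trans)
  have "cmod (f (z + h) - f z - fder f z h) \<le> 32 * M * (norm h)\<^sup>2 / R\<^sup>2 \<and>
    cmod (fder f z h) \<le> 4 * M * norm h / R"
  proof (cases "h = 0")
    case True
    then show ?thesis
      using fder_linear[OF hol, of z] R by (simp add: linear_0)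
  next
    case False
    define \<rho> where "\<rho> = R / norm h"
    define \<phi> where "\<phi> \<tau> = f (z + \<tau> *s h)" for \<tau>
    have \<rho>: "\<rho> \<ge> 2" "norm h > 0" using h False by (auto simp: \<rho>_def field_simps)
    have inball: "z + \<tau> *s h \<in> ball z R" if "cmod \<tau> < \<rho>" for \<tau>
      using that \<rho> by (simp add: dist_norm norm_vector_smult \<rho>_def field_simps)
    have der: "(\<phi> has_field_derivative fder f (z + \<tau> *s h) h) (at \<tau>)" if "cmod \<tau> < \<rho>" for \<tau>
      unfolding \<phi>_def by (rule line_field_derivative[OF hol inball[OF that]])
    have holphi: "\<phi> holomorphic_on ball 0 \<rho>"
      unfolding holomorphic_on_def field_differentiable_def
      by (metis der has_field_derivative_at_within mem_ball_0)
    have bd: "cmod (\<phi> \<tau>) \<le> M" if "cmod \<tau> < \<rho>" for \<tau>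
      using M[OF inball[OF that]] by (simp add: \<phi>_def)
    \<comment> \<open>As \<rho> \<ge> 2, a disc of radius \<rho>/4 about a point of the closed unit
      disc stays inside \<open>ball 0 \<rho>\<close>. The case n = 1 gives 4 M / \<rho>, and n = 2
      gives 2 M / (\<rho>/4)^2 = 32 M / \<rho>^2: the constants of the statement.\<close>
    have cauchy: "cmod ((deriv ^^ n) \<phi> \<tau>) \<le> fact n * M / (\<rho>/4) ^ n" if "cmod \<tau> \<le> 1" for \<tau> n
    proof (rule Cauchy_inequality)
      have sub: "cball \<tau> (\<rho>/4) \<subseteq> ball 0 \<rho>"
      proof
        fix x assume "x \<in> cball \<tau> (\<rho>/4)"
        then have "cmod (\<tau> - x) \<le> \<rho>/4" by (simp add: dist_norm)
        moreover have "cmod x \<le> cmod \<tau> + cmod (\<tau> - x)" using norm_triangle_sub[of x \<tau>] by (simp add: norm_minus_commute)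
        ultimately show "x \<in> ball 0 \<rho>" using \<rho> that by simp
      qed
      show "\<phi> holomorphic_on ball \<tau> (\<rho>/4)"
        using holphi sub by (meson ball_subset_cball holomorphic_on_subset order_trans)
      show "continuous_on (cball \<tau> (\<rho>/4)) \<phi>"
        using holphi sub holomorphic_on_imp_continuous_on continuous_on_subset by blast
      show "0 < \<rho>/4" using \<rho> by simp
      show "cmod (\<phi> x) \<le> M" if "cmod (\<tau> - x) = \<rho>/4" for x
        using bd sub that by (metis dist_norm mem_ball_0 mem_cball order_refl subsetD)
    qed
    have d0: "deriv \<phi> 0 = fder f z h"
      using DERIV_imp_deriv[OF der[of 0]] \<rho> by simp
    have "cmod (\<phi> 1 - (\<Sum>i\<le>1. (deriv ^^ i) \<phi> 0 * (1-0) ^ i / fact i))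
        \<le> (fact 2 * M / (\<rho>/4) ^ 2) * cmod (1 - 0) ^ Suc 1 / fact 1"
    proof (rule complex_Taylor[where S = "cball 0 1" and f = "\<lambda>i. (deriv ^^ i) \<phi>", unfolded funpow_0])
      fix i
      show "((deriv ^^ i) \<phi> has_field_derivative (deriv ^^ Suc i) \<phi> x) (at x within cball 0 1)" 
        if "x \<in> cball 0 1" for x :: complex
        using holomorphic_derivI[OF holomorphic_higher_deriv[OF holphi, of i], of x] that \<rho>
        by (simp add: has_field_derivative_at_within)
    next
      fix x :: complex assume "x \<in> cball 0 1"
      then show "cmod ((deriv ^^ Suc 1) \<phi> x) \<le> fact 2 * M / (\<rho>/4) ^ 2"
        unfolding Suc_1 by (intro cauchy) simp
    qed (auto)
    then have "cmod (\<phi> 1 - \<phi> 0 - deriv \<phi> 0) \<le> 32 * M / \<rho>\<^sup>2"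
      by (simp add: power_divide diff_diff_eq)
    moreover have "cmod (deriv \<phi> 0) \<le> 4 * M / \<rho>" using cauchy[of 0 1] by (simp add: mult.commute)
    ultimately show ?thesis
      by (simp add: \<phi>_def d0 \<rho>_def power_divide)
  qed
  then show "cmod (f (z + h) - f z - fder f z h) \<le> 32 * M * (norm h)\<^sup>2 / R\<^sup>2"
    and "cmod (fder f z h) \<le> 4 * M * norm h / R" by auto
qed

section \<open>Pointwise limits and directional derivatives\<close>

lemma norm_le_triangle3:
  fixes a b p q :: "'a::real_normed_vector"
  shows "norm (a - b) \<le> norm (p - a) + norm (q - b) + norm (p - q)"
proof -
  have "norm (a - b) = norm ((q - b) - (p - a) + (p - q))" by simp
  also have "\<dots> \<le> norm ((q - b) - (p - a)) + norm (p - q)" by (rule norm_triangle_ineq)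
  also have "\<dots> \<le> norm (q - b) + norm (p - a) + norm (p - q)" using norm_triangle_ineq4 by simp
  finally show ?thesis by simp
qed

text \<open>Steps of this size along \<open>v\<close> stay within half the radius; the
  \<open>+ 1\<close> keeps the size usable when \<open>v = 0\<close>.\<close>

lemma mult_divide_norm_le:
  assumes "R > 0" shows "R / (2 * (norm v + 1)) * norm v \<le> R / 2"
proof -
  have "R / (2 * (norm v + 1)) * norm v = R / 2 * (norm v / (norm v + 1))" by simp
  also have "\<dots> \<le> R / 2 * 1"
    by (rule mult_left_mono) (use assms in \<open>auto simp: divide_le_eq_1 add_nonneg_pos\<close>)
  finally show ?thesis by simp
qed

text \<open>Uniform boundedness replaces uniform convergence. The quadratic remainder bound is the
  same for all \<open>f n\<close>, so derivatives are close to difference quotients uniformly in n,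
  and the quotients converge. The bound itself passes to the limit and makes \<open>F\<close>
  differentiable.\<close>

lemma holomorphic_pointwise_limit:
  fixes f :: "nat \<Rightarrow> complex^'n::finite \<Rightarrow> complex"
  assumes hol: "\<And>n. holomorphic_function_on (ball z R) (f n)"
    and M: "\<And>n w. w \<in> ball z R \<Longrightarrow> cmod (f n w) \<le> M"
    and lim: "\<And>w. w \<in> ball z R \<Longrightarrow> (\<lambda>n. f n w) \<longlonglongrightarrow> F w"
    and R: "R > 0"
  shows "(F has_derivative fder F z) (at z)"
    and "fder F z (c *s v) = c * fder F z v"
    and "(\<lambda>n. fder (f n) z v) \<longlonglongrightarrow> fder F z v"
proof -
  have z: "z \<in> ball z R" using R by simp
  have M0: "M \<ge> 0" using M[OF z, of 0] norm_ge_zero order_trans by blast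
  have inball: "z + h \<in> ball z R" if "norm h \<le> R / 2" for h
    using that R by (simp add: dist_norm)
  have rem: "cmod (f n (z + h) - f n z - fder (f n) z h) \<le> 32 * M * (norm h)\<^sup>2 / R\<^sup>2"
    if "norm h \<le> R / 2" for n h
    by (rule remainder_estimate(1)[OF hol M that R])
  have lin: "linear (fder (f n) z)" for n using fder_linear[OF hol z] .
  have "convergent (\<lambda>n. fder (f n) z v)" for v
  proof (rule Cauchy_convergent, rule CauchyI)
    fix e :: real assume e: "e > 0"
    define C where "C = 32 * M * (norm v)\<^sup>2 / R\<^sup>2"
    have C0: "C \<ge> 0" using M0 by (simp add: C_def)
    \<comment> \<open>The first entry keeps the step inside half the ball. The second makes each of
      two remainders at most \<tau> e / 4; with another \<tau> e / 4 from the Cauchy property the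
      total stays below \<tau> e.\<close>
    define \<tau> where "\<tau> = min (R / (2 * (norm v + 1))) (e / (4 * (C + 1)))"
    have \<tau>: "\<tau> > 0" using R e C0 by (simp add: \<tau>_def add_nonneg_pos)
    have "\<tau> * norm v \<le> R / (2 * (norm v + 1)) * norm v"
      by (rule mult_right_mono) (auto simp: \<tau>_def)
    also have "\<dots> \<le> R / 2"
      by (rule mult_divide_norm_le[OF R])
    finally have small: "norm (\<tau> *\<^sub>R v) \<le> R / 2" using \<tau> by simp
    have "\<tau> * C \<le> e / (4 * (C + 1)) * C" using C0 by (intro mult_right_mono) (auto simp: \<tau>_def)
    also have "\<dots> \<le> e / 4" using C0 e by (simp add: divide_simps add_pos_nonneg)
    finally have \<tau>C: "\<tau> * C \<le> e / 4" .
    have "Cauchy (\<lambda>n. f n (z + \<tau> *\<^sub>R v) - f n z)"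
      by (intro LIMSEQ_imp_Cauchy[OF tendsto_diff[OF lim lim]] inball[OF small] z)
    then obtain N where N: "\<And>m n. m \<ge> N \<Longrightarrow> n \<ge> N \<Longrightarrow>
      cmod ((f m (z + \<tau> *\<^sub>R v) - f m z) - (f n (z + \<tau> *\<^sub>R v) - f n z)) < \<tau> * e / 4"
      using CauchyD[OF \<open>Cauchy (\<lambda>n. f n (z + \<tau> *\<^sub>R v) - f n z)\<close>, of "\<tau> * e / 4"] \<tau> e by auto
    have "cmod (fder (f m) z v - fder (f n) z v) < e" if mn: "m \<ge> N" "n \<ge> N" for m n
    proof -
      have r: "cmod (f k (z + \<tau> *\<^sub>R v) - f k z - \<tau> *\<^sub>R fder (f k) z v) \<le> \<tau> * (e / 4)" for k
      proof -
        have "cmod (f k (z + \<tau> *\<^sub>R v) - f k z - \<tau> *\<^sub>R fder (f k) z v) \<le> 32 * M * (norm (\<tau> *\<^sub>R v))\<^sup>2 / R\<^sup>2"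
          using rem[OF small, of k] by (simp add: linear_scale[OF lin])
        also have "\<dots> = \<tau> * (\<tau> * C)" by (simp add: C_def power_mult_distrib power2_eq_square)
        also have "\<dots> \<le> \<tau> * (e / 4)" using \<tau>C \<tau> by (intro mult_left_mono) auto
        finally show ?thesis .
      qed
      have "\<tau> * cmod (fder (f m) z v - fder (f n) z v) = cmod (\<tau> *\<^sub>R fder (f m) z v - \<tau> *\<^sub>R fder (f n) z v)"
        using \<tau> by (simp flip: scaleR_right_diff_distrib)
      also have "\<dots> \<le> \<tau> * (e / 4) + \<tau> * (e / 4) + \<tau> * e / 4"
        using r[of m] r[of n] N[OF mn]
          norm_le_triangle3[of "\<tau> *\<^sub>R fder (f m) z v" "\<tau> *\<^sub>R fder (f n) z v"
            "f m (z + \<tau> *\<^sub>R v) - f m z" "f n (z + \<tau> *\<^sub>R v) - f n z"] by linarith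
      also have "\<dots> < \<tau> * e" using \<tau> e by (simp add: field_simps)
      finally show ?thesis using \<tau> by simp
    qed
    then show "\<exists>N. \<forall>m\<ge>N. \<forall>n\<ge>N. cmod (fder (f m) z v - fder (f n) z v) < e" by blast
  qed
  then obtain G where G: "\<And>v. (\<lambda>n. fder (f n) z v) \<longlonglongrightarrow> G v"
    unfolding convergent_def by metis
  have Gadd: "G (v + w) = G v + G w" for v w
    by (rule LIMSEQ_unique[OF G]) (use tendsto_add[OF G[of v] G[of w]] in \<open>simp add: linear_add[OF lin]\<close>)
  have Gs: "G (c *s v) = c * G v" for c v
    by (rule LIMSEQ_unique[OF G])
      (use tendsto_mult[OF tendsto_const[of c] G[of v]] in \<open>simp add: fder_smult[OF hol z]\<close>)
  have linG: "linear G"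
    by (rule linearI) (use Gadd Gs[of "complex_of_real _"] in
        \<open>auto simp: of_real_vector_smult scaleR_conv_of_real\<close>)
  have remG: "cmod (F (z + h) - F z - G h) \<le> 32 * M * (norm h)\<^sup>2 / R\<^sup>2" if h: "norm h \<le> R / 2" for h
    by (rule LIMSEQ_le_const2[OF tendsto_norm[OF tendsto_diff[OF
            tendsto_diff[OF lim[OF inball[OF h]] lim[OF z]] G]]]) (use rem[OF h] in auto)
  have der: "(F has_derivative G) (at z)"
    unfolding has_derivative_at
  proof
    show "bounded_linear G" using linG by (simp add: linear_conv_bounded_linear)
    have "isCont (\<lambda>h::complex^'n. 32 * M * norm h / R\<^sup>2) 0"
      using R by (intro continuous_intros) auto
    then have "((\<lambda>h::complex^'n. 32 * M * norm h / R\<^sup>2) \<longlongrightarrow> 32 * M * norm (0::complex^'n) / R\<^sup>2) (at 0)"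
      unfolding isCont_def .
    then have 0: "((\<lambda>h::complex^'n. 32 * M * norm h / R\<^sup>2) \<longlongrightarrow> 0) (at 0)" by simp
    show "(\<lambda>h. norm (F (z + h) - F z - G h) / norm h) \<midarrow>0\<rightarrow> 0"
    proof (rule tendsto_sandwich[OF _ _ tendsto_const 0])
      show "\<forall>\<^sub>F h in at 0. norm (F (z + h) - F z - G h) / norm h \<le> 32 * M * norm h / R\<^sup>2"
        unfolding eventually_at
      proof (intro exI[of _ "R/2"] conjI ballI impI)
        fix h :: "complex^'n" assume "h \<noteq> 0 \<and> dist h 0 < R / 2"
        then show "norm (F (z + h) - F z - G h) / norm h \<le> 32 * M * norm h / R\<^sup>2"
          using remG[of h] by (simp add: pos_divide_le_eq power2_eq_square mult.assoc)
      qed (use R in simp)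
    qed simp
  qed
  then have FG: "fder F z = G" by (rule fder_eq)
  show "(F has_derivative fder F z) (at z)" "fder F z (c *s v) = c * fder F z v"
    "(\<lambda>n. fder (f n) z v) \<longlonglongrightarrow> fder F z v"
    using der Gs G by (simp_all add: FG)
qed

lemma holomorphic_function_on_shift:
  assumes "holomorphic_function_on S f" "\<And>z. z \<in> T \<Longrightarrow> z + h \<in> S"
  shows "holomorphic_function_on T (\<lambda>z. f (z + h))"
  by (rule holomorphic_function_on_compose_map[OF assms(1), where g' = "\<lambda>_ v. v"])
    (auto intro!: assms(2) has_derivative_eq_rhs[OF has_derivative_add_const[OF has_derivative_ident]])

text \<open>Directional derivatives are pointwise limits of difference quotients, which are again
  holomorphic and locally uniformly bounded. Convergence of their derivatives also gives the symmetry of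
  second derivatives.\<close>

lemma directional_derivative:
  fixes f :: "complex^'n::finite \<Rightarrow> complex"
  assumes hol: "holomorphic_function_on S f" and S: "open S"
  shows directional_derivative_holomorphic: "holomorphic_function_on S (\<lambda>w. fder f w v)"
    and directional_derivative_commute:
      "z \<in> S \<Longrightarrow> fder (\<lambda>w. fder f w v) z u = fder (\<lambda>w. fder f w u) z v"
proof -
  have main: "((\<lambda>w. fder f w v) has_derivative fder (\<lambda>w. fder f w v) z) (at z) \<and>
    (\<forall>c u. fder (\<lambda>w. fder f w v) z (c *s u) = c * fder (\<lambda>w. fder f w v) z u) \<and>
    (\<exists>\<epsilon>. filterlim \<epsilon> (at 0) sequentially \<and>
      (\<forall>u. (\<lambda>n. (fder f (z + \<epsilon> n *\<^sub>R v) u - fder f z u) /\<^sub>R \<epsilon> n) \<longlonglongrightarrow> fder (\<lambda>w. fder f w v) z u))"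
    if z: "z \<in> S" for z v
  proof -
    obtain r where r: "r > 0" "cball z r \<subseteq> S" using S z open_contains_cball by blast
    define R where "R = r / 2"
    have R: "R > 0" "cball z (2 * R) \<subseteq> S" using r by (auto simp: R_def)
    have "compact (f ` cball z (2 * R))"
      using R hol holomorphic_function_on_continuous continuous_on_subset
      by (metis compact_cball compact_continuous_image)
    then obtain M where M: "\<And>w. w \<in> cball z (2 * R) \<Longrightarrow> cmod (f w) \<le> M"
      using compact_imp_bounded[of "f ` cball z (2 * R)"] unfolding bounded_iff by blast
    have sub: "ball w R \<subseteq> cball z (2 * R)" if "w \<in> ball z R" for w
    proof
      fix x assume "x \<in> ball w R"
      then show "x \<in> cball z (2 * R)" using that dist_triangle[of z x w] by auto
    qed
    define \<epsilon> where "\<epsilon> n = R / (2 * (norm v + 1)) / real (Suc n)" for n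
    have \<epsilon>0: "\<epsilon> n > 0" for n using R by (simp add: \<epsilon>_def add_nonneg_pos)
    have \<epsilon>le: "\<epsilon> n \<le> R / (2 * (norm v + 1))" for n
      using R by (simp add: \<epsilon>_def divide_simps add_nonneg_pos)
    have \<epsilon>v: "norm (\<epsilon> n *\<^sub>R v) \<le> R / 2" for n
    proof -
      have "norm (\<epsilon> n *\<^sub>R v) = \<epsilon> n * norm v" using \<epsilon>0[of n] by simp
      also have "\<dots> \<le> R / (2 * (norm v + 1)) * norm v"
        using \<epsilon>le[of n] by (intro mult_right_mono) auto
      also have "\<dots> \<le> R / 2" by (rule mult_divide_norm_le[OF R(1)])
      finally show ?thesis .
    qed
    have \<epsilon>lim: "\<epsilon> \<longlonglongrightarrow> 0"
      unfolding \<epsilon>_def using tendsto_mult[OF tendsto_const LIMSEQ_inverse_real_of_nat]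
      by (simp add: divide_inverse)
    have \<epsilon>at: "filterlim \<epsilon> (at 0) sequentially"
      unfolding filterlim_at using \<epsilon>lim \<epsilon>0 by (auto intro!: always_eventually simp: less_imp_neq[symmetric])
    define Q where "Q n w = (f (w + \<epsilon> n *\<^sub>R v) - f w) * complex_of_real (inverse (\<epsilon> n))" for n w
    have inS: "w + \<epsilon> n *\<^sub>R v \<in> cball z (2 * R)" if "w \<in> ball z R" for w n
    proof -
      have "w + \<epsilon> n *\<^sub>R v \<in> ball w R" using \<epsilon>v[of n] R by (simp add: dist_norm)
      then show ?thesis using sub[OF that] by blast
    qed
    have holb: "holomorphic_function_on (ball z R) f"
      using hol R sub[of z] by (meson centre_in_ball holomorphic_function_on_subset order_trans)
    have holsh: "holomorphic_function_on (ball z R) (\<lambda>w. f (w + \<epsilon> n *\<^sub>R v))" for n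
      by (rule holomorphic_function_on_shift[OF hol]) (use inS R in blast)
    have holQ: "holomorphic_function_on (ball z R) (Q n)" for n
      unfolding Q_def
      by (intro holomorphic_function_on_mult holomorphic_function_on_minus holsh holb
          holomorphic_function_on_const)
    have derQ: "fder (Q n) w u = (fder f (w + \<epsilon> n *\<^sub>R v) u - fder f w u) /\<^sub>R \<epsilon> n"
      if "w \<in> ball z R" for n w u
    proof -
      have w: "w \<in> S" "w + \<epsilon> n *\<^sub>R v \<in> S" using inS[OF that] sub[OF that] R that by auto
      have "((\<lambda>w. w + \<epsilon> n *\<^sub>R v) has_derivative (\<lambda>v. v)) (at w)"
        by (rule has_derivative_eq_rhs[OF has_derivative_add_const[OF has_derivative_ident]]) simp
      from has_derivative_compose[OF this holomorphic_function_on_has_derivative[OF hol w(2)]]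
      have "(Q n has_derivative (\<lambda>u. (fder f (w + \<epsilon> n *\<^sub>R v) u - fder f w u) * complex_of_real (inverse (\<epsilon> n)))) (at w)"
        unfolding Q_def
        by (intro has_derivative_mult_left has_derivative_diff
            holomorphic_function_on_has_derivative[OF hol w(1)])
      from fder_eq[OF this] show ?thesis by (simp add: scaleR_conv_of_real mult.commute)
    qed
    \<comment> \<open>Cauchy's bound for the first derivative plus the quadratic remainder at the
      largest step, both divided by the step: a bound on the difference quotients that is
      independent of n.\<close>
    define B where "B = 4 * M * norm v / R + 32 * M * (norm v)\<^sup>2 / R\<^sup>2 * (R / (2 * (norm v + 1)))"
    have rem: "cmod (f (w + \<epsilon> n *\<^sub>R v) - f w - fder f w (\<epsilon> n *\<^sub>R v)) \<le> 32 * M * (norm (\<epsilon> n *\<^sub>R v))\<^sup>2 / R\<^sup>2"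
      and cau: "cmod (fder f w (\<epsilon> n *\<^sub>R v)) \<le> 4 * M * norm (\<epsilon> n *\<^sub>R v) / R"
      if "w \<in> ball z R" for w n
    proof -
      have h: "holomorphic_function_on (ball w R) f"
        using hol R sub[OF that] by (meson holomorphic_function_on_subset order_trans)
      have m: "cmod (f x) \<le> M" if "x \<in> ball w R" for x using M sub[OF \<open>w \<in> ball z R\<close>] that by blast
      show "cmod (f (w + \<epsilon> n *\<^sub>R v) - f w - fder f w (\<epsilon> n *\<^sub>R v)) \<le> 32 * M * (norm (\<epsilon> n *\<^sub>R v))\<^sup>2 / R\<^sup>2"
        "cmod (fder f w (\<epsilon> n *\<^sub>R v)) \<le> 4 * M * norm (\<epsilon> n *\<^sub>R v) / R"
        using remainder_estimate[OF h m \<epsilon>v R(1)] by auto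
    qed
    have M0: "M \<ge> 0" using M[of z] R by (meson centre_in_cball less_eq_real_def mult_nonneg_nonneg norm_ge_zero order_trans zero_le_numeral)
    have bdQ: "cmod (Q n w) \<le> B" if w: "w \<in> ball z R" for n w
    proof -
      have "cmod (f (w + \<epsilon> n *\<^sub>R v) - f w) \<le> 4 * M * norm (\<epsilon> n *\<^sub>R v) / R + 32 * M * (norm (\<epsilon> n *\<^sub>R v))\<^sup>2 / R\<^sup>2"
        using rem[OF w, of n] cau[OF w, of n]
          norm_triangle_sub[of "f (w + \<epsilon> n *\<^sub>R v) - f w" "fder f w (\<epsilon> n *\<^sub>R v)"] by linarith
      also have "\<dots> = \<epsilon> n * (4 * M * norm v / R + 32 * M * (norm v)\<^sup>2 / R\<^sup>2 * \<epsilon> n)"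
        using \<epsilon>0[of n] by (simp add: power_mult_distrib power2_eq_square algebra_simps)
      also have "\<dots> \<le> \<epsilon> n * B"
        unfolding B_def
        using \<epsilon>0[of n] \<epsilon>le[of n] M0 by (intro mult_left_mono add_left_mono) auto
      finally have "cmod (f (w + \<epsilon> n *\<^sub>R v) - f w) \<le> \<epsilon> n * B" .
      then show ?thesis using \<epsilon>0[of n] by (simp add: Q_def norm_mult norm_divide field_simps)
    qed
    have limQ: "(\<lambda>n. Q n w) \<longlonglongrightarrow> fder f w v" if w: "w \<in> ball z R" for w
    proof -
      have wS: "w + complex_of_real 0 *s v \<in> S" using sub[OF w] R w by auto
      have "((\<lambda>\<tau>. f (w + \<tau> *s v)) has_field_derivative fder f w v) (at 0)"
        using line_field_derivative[OF hol, of w 0 v] wS by simp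
      then have "((\<lambda>h. (f (w + h *s v) - f w) / h) \<longlongrightarrow> fder f w v) (at 0)"
        by (simp add: DERIV_def)
      moreover have "filterlim (\<lambda>n. complex_of_real (\<epsilon> n)) (at 0) sequentially"
        using \<epsilon>at tendsto_of_real[OF \<epsilon>lim] unfolding filterlim_at by auto
      ultimately have "(\<lambda>n. (f (w + complex_of_real (\<epsilon> n) *s v) - f w) / complex_of_real (\<epsilon> n)) \<longlonglongrightarrow> fder f w v"
        by (rule filterlim_compose)
      then show ?thesis by (simp add: Q_def of_real_vector_smult divide_inverse)
    qed
    note lim = holomorphic_pointwise_limit[OF holQ bdQ limQ R(1)]
    have "(\<lambda>n. (fder f (z + \<epsilon> n *\<^sub>R v) u - fder f z u) /\<^sub>R \<epsilon> n) \<longlonglongrightarrow> fder (\<lambda>w. fder f w v) z u" for u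
      using lim(3)[of u] R by (simp add: derQ)
    then show ?thesis using lim(1,2) \<epsilon>at by blast
  qed
  show h: "holomorphic_function_on S (\<lambda>w. fder f w v)" for v
    by (rule holomorphic_function_onI[where f' = "\<lambda>z. fder (\<lambda>w. fder f w v) z"]) (use main in blast)+
  show "fder (\<lambda>w. fder f w v) z u = fder (\<lambda>w. fder f w u) z v" if z: "z \<in> S"
  proof -
    obtain \<epsilon> where \<epsilon>: "filterlim \<epsilon> (at 0) sequentially"
      "\<And>u. (\<lambda>n. (fder f (z + \<epsilon> n *\<^sub>R v) u - fder f z u) /\<^sub>R \<epsilon> n) \<longlonglongrightarrow> fder (\<lambda>w. fder f w v) z u"
      using main[OF z, of v] by blast
    have "((\<lambda>\<tau>. fder f (z + \<tau> *s v) u) has_field_derivative fder (\<lambda>w. fder f w u) z v) (at 0)"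
      using line_field_derivative[OF h[of u], of z 0 v] z by simp
    then have "((\<lambda>k. (fder f (z + k *s v) u - fder f z u) / k) \<longlongrightarrow> fder (\<lambda>w. fder f w u) z v) (at 0)"
      by (simp add: DERIV_def)
    moreover have "filterlim (\<lambda>n. complex_of_real (\<epsilon> n)) (at 0) sequentially"
      using \<epsilon>(1) tendsto_of_real[of \<epsilon> 0 sequentially] unfolding filterlim_at by auto
    ultimately have "(\<lambda>n. (fder f (z + complex_of_real (\<epsilon> n) *s v) u - fder f z u) / complex_of_real (\<epsilon> n))
        \<longlonglongrightarrow> fder (\<lambda>w. fder f w u) z v"
      by (rule filterlim_compose)
    then have "(\<lambda>n. (fder f (z + \<epsilon> n *\<^sub>R v) u - fder f z u) /\<^sub>R \<epsilon> n) \<longlonglongrightarrow> fder (\<lambda>w. fder f w u) z v"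
      by (simp add: of_real_vector_smult scaleR_conv_of_real divide_inverse mult.commute)
    from LIMSEQ_unique[OF \<epsilon>(2) this] show ?thesis .
  qed
qed

section \<open>Polarization of potentials\<close>

text \<open>Pairs are encoded over a sum of index types so that a function of (z, w) again lives on
  some \<open>complex^'k\<close> and \<open>holomorphic_function_on\<close> applies to it.\<close>

definition join :: "complex^'a::finite \<Rightarrow> complex^'b::finite \<Rightarrow> complex^('a + 'b)" where
  "join z w = (\<chi> i. case i of Inl a \<Rightarrow> z $ a | Inr b \<Rightarrow> w $ b)"

definition left_part :: "complex^('a::finite + 'b::finite) \<Rightarrow> complex^'a" where
  "left_part p = (\<chi> a. p $ Inl a)"

definition right_part :: "complex^('a::finite + 'b::finite) \<Rightarrow> complex^'b" where
  "right_part p = (\<chi> b. p $ Inr b)"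

definition vcnj :: "complex^'n \<Rightarrow> complex^'n" where
  "vcnj z = (\<chi> i. cnj (z $ i))"

text \<open>The antiholomorphic involution (z, w) -> (cnj w, cnj z). Its fixed points are the pairs
  (z, cnj z), and Hermitian symmetry of a kernel reads
  \<open>k (flip p) = cnj (k p)\<close>.\<close>

definition flip :: "complex^('n::finite + 'n) \<Rightarrow> complex^('n + 'n)" where
  "flip p = join (vcnj (right_part p)) (vcnj (left_part p))"

lemma join_nth [simp]: "join z w $ Inl a = z $ a" "join z w $ Inr b = w $ b"
  by (simp_all add: join_def)

lemma left_part_join [simp]: "left_part (join z w) = z"
  and right_part_join [simp]: "right_part (join z w) = w"
  and join_parts [simp]: "join (left_part p) (right_part p) = p"
  by (simp_all add: left_part_def right_part_def join_def vec_eq_iff split: sum.split)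

lemma left_part_nth [simp]: "left_part p $ a = p $ Inl a"
  and right_part_nth [simp]: "right_part p $ b = p $ Inr b"
  and vcnj_nth [simp]: "vcnj z $ i = cnj (z $ i)"
  by (simp_all add: left_part_def right_part_def vcnj_def)

lemma vcnj_vcnj [simp]: "vcnj (vcnj z) = z"
  and vcnj_smult: "vcnj (c *s z) = cnj c *s vcnj z"
  and vcnj_0 [simp]: "vcnj 0 = 0"
  by (simp_all add: vec_eq_iff)

lemma join_add: "join (z + z') (w + w') = join z w + join z' w'"
  and join_smult: "join (c *s z) (c *s w) = c *s join z w"
  and join_scaleR: "join (r *\<^sub>R z) (r *\<^sub>R w) = r *\<^sub>R join z w"
  by (simp_all add: vec_eq_iff join_def split: sum.split)

lemma flip_join [simp]: "flip (join z w) = join (vcnj w) (vcnj z)"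
  by (simp add: flip_def)

lemma linear_vcnj: "linear vcnj"
  by (rule linearI) (simp_all add: vec_eq_iff)

lemma linear_left_part: "linear left_part" and linear_right_part: "linear right_part"
  by (rule linearI; simp add: vec_eq_iff)+

lemma linear_join: "linear f \<Longrightarrow> linear g \<Longrightarrow> linear (\<lambda>v. join (f v) (g v))"
  by (rule linearI) (simp_all add: linear_add linear_scale join_add join_scaleR)

lemma has_derivative_linear_vec: "linear f \<Longrightarrow> (f has_derivative f) (at z)"
  for f :: "complex^'a::finite \<Rightarrow> complex^'b::finite"
  by (simp add: bounded_linear_imp_has_derivative linear_conv_bounded_linear)

lemma bounded_linear_join: "bounded_linear (\<lambda>z. join z 0)" "bounded_linear (\<lambda>z. join 0 z)"
  by (simp_all flip: linear_conv_bounded_linear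
      add: linear_join linear_id[unfolded id_def] linear_zero)

lemma has_derivative_join:
  fixes f :: "'a::real_normed_vector \<Rightarrow> complex^'b::finite" and g :: "'a \<Rightarrow> complex^'c::finite"
  assumes "(f has_derivative f') F" "(g has_derivative g') F"
  shows "((\<lambda>x. join (f x) (g x)) has_derivative (\<lambda>v. join (f' v) (g' v))) F"
proof -
  have e: "join (a :: complex^'b) (b :: complex^'c) = join a 0 + join 0 b" for a b
    by (simp flip: join_add)
  have "((\<lambda>x. join (f x) 0 + join 0 (g x)) has_derivative (\<lambda>v. join (f' v) 0 + join 0 (g' v))) F"
    by (rule has_derivative_add[OF bounded_linear.has_derivative[OF bounded_linear_join(1) assms(1)]
          bounded_linear.has_derivative[OF bounded_linear_join(2) assms(2)]])
  then show ?thesis by (simp flip: e)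
qed

text \<open>Along (w, cnj w) a tangent vector u moves the two slots by u and cnj u. Replacing u by
  iu multiplies the two contributions by i and -i, so \<open>del\<close> and \<open>delbar\<close>
  each cancel one of them.\<close>

lemma del_polarized:
  fixes \<Psi> :: "complex^'n::finite \<Rightarrow> complex"
  assumes U: "open U" "z \<in> U" and hol: "holomorphic_function_on Q L"
    and Q: "\<And>w. w \<in> U \<Longrightarrow> join w (vcnj w) \<in> Q" and eq: "\<And>w. w \<in> U \<Longrightarrow> \<Psi> w = L (join w (vcnj w))"
  shows "del \<Psi> z u = fder L (join z (vcnj z)) (join u 0)"
    and "delbar \<Psi> z u = fder L (join z (vcnj z)) (join 0 (vcnj u))"
proof -
  let ?p = "join z (vcnj z)"
  have "((\<lambda>w. join w (vcnj w)) has_derivative (\<lambda>v. join v (vcnj v))) (at z)"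
    by (intro has_derivative_linear_vec linear_join linear_vcnj linear_id[unfolded id_def])
  from has_derivative_compose[OF this holomorphic_function_on_has_derivative[OF hol Q[OF U(2)]]]
  have "((\<lambda>w. L (join w (vcnj w))) has_derivative (\<lambda>v. fder L ?p (join v (vcnj v)))) (at z)" .
  then have "(\<Psi> has_derivative (\<lambda>v. fder L ?p (join v (vcnj v)))) (at z)"
    by (rule has_derivative_transform_within_open[OF _ U]) (simp add: eq)
  from fder_eq[OF this] have X: "fder \<Psi> z v = fder L ?p (join v (vcnj v))" for v by simp
  have split: "fder L ?p (join (a *s v) (b *s w)) = a * fder L ?p (join v 0) + b * fder L ?p (join 0 w)" for a b v w
  proof -
    have "join (a *s v) (b *s w) = a *s join v 0 + b *s join 0 w"
      by (simp add: vec_eq_iff join_def split: sum.split)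
    then show ?thesis
      using linear_add[OF fder_linear[OF hol Q[OF U(2)]]] by (simp add: fder_smult[OF hol Q[OF U(2)]])
  qed
  have 1: "fder \<Psi> z u = fder L ?p (join u 0) + fder L ?p (join 0 (vcnj u))"
    using split[of 1 u 1 "vcnj u"] by (simp add: X)
  have 2: "fder \<Psi> z (\<i> *s u) = \<i> * fder L ?p (join u 0) - \<i> * fder L ?p (join 0 (vcnj u))"
    using split[of \<i> u "-\<i>" "vcnj u"] by (simp add: X vcnj_smult)
  show "del \<Psi> z u = fder L ?p (join u 0)" "delbar \<Psi> z u = fder L ?p (join 0 (vcnj u))"
    unfolding del_def delbar_def 1 2 by (simp_all add: algebra_simps)
qed

text \<open>\<open>del_polarized\<close> applied twice turns the metric into a mixed derivative of
  \<open>L\<close>, one derivative per slot. Along a curve the metric is determined by its value on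
  the velocity, hence the same \<open>u\<close> in both arguments.\<close>

lemma potential_metric_polarized:
  fixes \<Phi> :: "complex^'n::finite \<Rightarrow> real"
  assumes U: "open U" "z \<in> U" and Q: "open Q" and hol: "holomorphic_function_on Q L"
    and UQ: "\<And>w. w \<in> U \<Longrightarrow> join w (vcnj w) \<in> Q"
    and eq: "\<And>w. w \<in> U \<Longrightarrow> complex_of_real (\<Phi> w) = L (join w (vcnj w))"
  shows "potential_metric \<Phi> z u u =
    Re (fder (\<lambda>p. fder L p (join 0 (vcnj u))) (join z (vcnj z)) (join u 0))"
proof -
  let ?\<Phi> = "\<lambda>w. complex_of_real (\<Phi> w)"
  let ?L = "\<lambda>v p. fder L p (join 0 (vcnj v))"
  let ?p = "join z (vcnj z)"
  have holL: "holomorphic_function_on Q (?L v)" for v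
    by (rule directional_derivative_holomorphic[OF hol Q])
  have db: "delbar ?\<Phi> w v = ?L v (join w (vcnj w))" if "w \<in> U" for w v
    by (rule del_polarized(2)[OF U(1) that hol UQ eq])
  have d: "del (\<lambda>w. delbar ?\<Phi> w v) z u = fder (?L v) ?p (join u 0)" for u v
    by (rule del_polarized(1)[OF U holL UQ db])
  have iu: "join 0 (vcnj (\<i> *s u)) = (-\<i>) *s join 0 (vcnj u)"
    using join_smult[of "-\<i>" 0 "vcnj u"] by (simp add: vcnj_smult)
  have iu': "join (\<i> *s u) 0 = \<i> *s join u 0"
    using join_smult[of \<i> u 0] by simp
  have pQ: "?p \<in> Q" using U UQ by blast
  have "fder (?L (\<i> *s u)) ?p (join u 0) = -\<i> * fder (?L u) ?p (join u 0)"
  proof -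
    have "((\<lambda>p. -\<i> * ?L u p) has_derivative (\<lambda>v. -\<i> * fder (?L u) ?p v)) (at ?p)"
      by (intro has_derivative_mult_right holomorphic_function_on_has_derivative[OF holL pQ])
    then have "(?L (\<i> *s u) has_derivative (\<lambda>v. -\<i> * fder (?L u) ?p v)) (at ?p)"
      by (rule has_derivative_transform_within_open[OF _ Q pQ]) (simp only: iu fder_smult[OF hol])
    then show ?thesis by (simp add: fder_eq)
  qed
  \<comment> \<open>Both terms of \<open>deldelbar\<close> contribute -i times the mixed derivative;
    the factor i/2 of the form then turns -2i into 1.\<close>
  then have "deldelbar ?\<Phi> z u (\<i> *s u) = -2 * \<i> * fder (?L u) ?p (join u 0)"
    unfolding deldelbar_def d by (simp add: iu' fder_smult[OF holL pQ])
  then show ?thesis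
    unfolding potential_metric_def potential_form_def by simp
qed

section \<open>Equal metrics along curves\<close>

abbreviation pt :: "complex \<Rightarrow> complex \<Rightarrow> complex^2" where
  "pt t s \<equiv> vector [t, s]"

text \<open>A bidisc rather than a ball: for each fixed value of one coordinate the other one ranges
  over the full disc of radius \<open>r\<close>.\<close>

definition bidisc :: "real \<Rightarrow> (complex^2) set" where
  "bidisc r = {p. cmod (p $ 1) < r \<and> cmod (p $ 2) < r}"

lemma pt_in_bidisc [simp]: "pt t s \<in> bidisc r \<longleftrightarrow> cmod t < r \<and> cmod s < r"
  by (simp add: bidisc_def)

lemma pt_line: "pt t s + \<tau> *s pt a b = pt (t + \<tau> * a) (s + \<tau> * b)"
  by (simp add: vec_eq_iff forall_2)

lemma open_bidisc: "open (bidisc r)"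
  unfolding bidisc_def
  by (intro open_Collect_conj open_Collect_less continuous_intros)

lemma bidisc_mono: "r \<le> r' \<Longrightarrow> bidisc r \<subseteq> bidisc r'"
  by (auto simp: bidisc_def)

lemma bidisc_subset_ball: "bidisc (r / 2) \<subseteq> ball 0 r"
proof
  fix p assume p: "p \<in> bidisc (r / 2)"
  have "norm p \<le> cmod (p $ 1) + cmod (p $ 2)"
    using L2_set_le_sum[of UNIV "\<lambda>i. cmod (p $ i)"] by (simp add: norm_vec_def sum_2)
  then show "p \<in> ball 0 r" using p by (simp add: bidisc_def)
qed

lemma holomorphic_zero_on_reals:
  assumes "f holomorphic_on ball 0 R" "\<And>x. \<bar>x\<bar> < R \<Longrightarrow> f (complex_of_real x) = 0" "cmod z < R"
  shows "f z = 0"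
proof (rule analytic_continuation[OF assms(1)])
  have R: "R > 0" using assms(3) norm_ge_zero le_less_trans by blast
  show "complex_of_real ` {-R<..<R} \<subseteq> ball 0 R" by auto
  show "(0::complex) islimpt complex_of_real ` {-R<..<R}"
    unfolding islimpt_approachable
  proof (intro allI impI)
    fix e :: real assume "e > 0"
    then show "\<exists>x'\<in>complex_of_real ` {-R<..<R}. x' \<noteq> 0 \<and> dist x' 0 < e"
      using R by (intro bexI[of _ "complex_of_real (min (R/2) (e/2))"]) auto
  qed
  show "0 \<in> ball (0::complex) R" using R by simp
qed (use assms in auto)

text \<open>In the coordinates \<open>t = x + \<i>y\<close>, \<open>s = x - \<i>y\<close> the set \<open>s = cnj t\<close> is the set of real \<open>x\<close>, \<open>y\<close>, so the
  identity theorem in one variable applies twice.\<close>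

lemma polarization:
  assumes hol: "holomorphic_function_on (bidisc r) q"
    and diag: "\<And>t. cmod t < r \<Longrightarrow> q (pt t (cnj t)) = 0"
    and ts: "cmod t < r / 2" "cmod s < r / 2"
  shows "q (pt t s) = 0"
proof -
  have in1: "pt (x + \<i> * y) (x - \<i> * y) \<in> bidisc r" if "cmod x < r / 2" "cmod y < r / 2" for x y
    using that norm_triangle_ineq[of x "\<i> * y"] norm_triangle_ineq4[of x "\<i> * y"]
    by (simp add: norm_mult)
  have real: "q (pt (x + \<i> * of_real y) (x - \<i> * of_real y)) = 0" if x: "cmod x < r / 2" and y: "\<bar>y\<bar> < r / 2" for x y
  proof (rule holomorphic_zero_on_reals[OF _ _ x, of "\<lambda>x. q (pt (x + \<i> * of_real y) (x - \<i> * of_real y))"])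
    have e: "pt (x + \<i> * of_real y) (x - \<i> * of_real y) = pt (\<i> * of_real y) (- (\<i> * of_real y)) + x *s pt 1 1" for x
      unfolding pt_line by (simp add: add.commute)
    show "(\<lambda>x. q (pt (x + \<i> * of_real y) (x - \<i> * of_real y))) holomorphic_on ball 0 (r/2)"
      unfolding e
      by (rule line_holomorphic_on[OF hol]) (use in1[of _ "of_real y"] y in \<open>simp flip: e\<close>)
    fix x' :: real assume "\<bar>x'\<bar> < r / 2"
    then have "cmod (of_real x' + \<i> * of_real y) < r"
      using norm_triangle_ineq[of "of_real x'" "\<i> * of_real y"] y by (simp add: norm_mult)
    from diag[OF this] show "q (pt (of_real x' + \<i> * of_real y) (of_real x' - \<i> * of_real y)) = 0" by simp
  qed
  have all: "q (pt (x + \<i> * y) (x - \<i> * y)) = 0" if x: "cmod x < r / 2" and y: "cmod y < r / 2" for x y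
  proof (rule holomorphic_zero_on_reals[OF _ _ y, of "\<lambda>y. q (pt (x + \<i> * y) (x - \<i> * y))"])
    have "(\<lambda>y. q (pt x x + y *s pt \<i> (-\<i>))) holomorphic_on ball 0 (r/2)"
      by (rule line_holomorphic_on[OF hol]) (use in1[OF x] in \<open>simp add: pt_line mult.commute\<close>)
    then show "(\<lambda>y. q (pt (x + \<i> * y) (x - \<i> * y))) holomorphic_on ball 0 (r/2)"
      by (simp add: pt_line mult.commute)
  qed (use real[OF x] in simp)
  \<comment> \<open>These are the x and y with t = x + iy and s = x - iy. The radius r / 2 for x and
    y keeps x + iy and x - iy within r; for t and s it puts x and y back within r / 2.\<close>
  have "cmod ((t + s) / 2) < r / 2" "cmod ((t - s) / (2 * \<i>)) < r / 2"
    using ts norm_triangle_ineq[of t s] norm_triangle_ineq4[of t s] by (simp_all add: norm_divide norm_mult)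
  from all[OF this] show ?thesis by (simp add: field_simps)
qed

text \<open>The derivative in s does not change with t, so l(t, s) - l(0, s) is constant in s and
  equals its value at s = 0.\<close>

lemma mixed_derivative_zero_splits:
  assumes hol: "holomorphic_function_on (bidisc r) l"
    and zero: "\<And>t s. cmod t < r \<Longrightarrow> cmod s < r \<Longrightarrow> fder (\<lambda>p. fder l p (pt 0 1)) (pt t s) (pt 1 0) = 0"
    and ts: "cmod t < r" "cmod s < r"
  shows "l (pt t s) = l (pt t 0) + l (pt 0 s) - l (pt 0 0)"
proof -
  have r: "0 < r" using ts(1) norm_ge_zero le_less_trans by blast
  note hol2 = directional_derivative_holomorphic[OF hol open_bidisc]
  have c: "fder l (pt t s) (pt 0 1) = fder l (pt 0 s) (pt 0 1)" if s: "cmod s < r" for s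
  proof -
    have "\<exists>c. \<forall>x\<in>ball 0 r. fder l (pt x s) (pt 0 1) = c"
    proof (rule has_field_derivative_zero_constant[OF convex_ball])
      fix x :: complex assume x: "x \<in> ball 0 r"
      have "((\<lambda>\<tau>. fder l (pt 0 s + \<tau> *s pt 1 0) (pt 0 1)) has_field_derivative 0) (at x)"
        using line_field_derivative[OF hol2, of "pt 0 s" x "pt 1 0" "pt 0 1"] zero[of x s] x s
        by (simp add: pt_line)
      then show "((\<lambda>x. fder l (pt x s) (pt 0 1)) has_field_derivative 0) (at x within ball 0 r)"
        by (simp add: pt_line has_field_derivative_at_within)
    qed
    then show ?thesis using ts r by (metis centre_in_ball mem_ball_0)
  qed
  have "\<exists>c. \<forall>x\<in>ball 0 r. l (pt t x) - l (pt 0 x) = c"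
  proof (rule has_field_derivative_zero_constant[OF convex_ball])
    fix x :: complex assume x: "x \<in> ball 0 r"
    have "((\<lambda>\<tau>. l (pt t 0 + \<tau> *s pt 0 1) - l (pt 0 0 + \<tau> *s pt 0 1)) has_field_derivative
      fder l (pt t 0 + x *s pt 0 1) (pt 0 1) - fder l (pt 0 0 + x *s pt 0 1) (pt 0 1)) (at x)"
      by (intro DERIV_diff line_field_derivative[OF hol]) (use x ts r in \<open>simp_all add: pt_line\<close>)
    then show "((\<lambda>x. l (pt t x) - l (pt 0 x)) has_field_derivative 0) (at x within ball 0 r)"
      using c[of x] x by (simp add: pt_line has_field_derivative_at_within)
  qed
  then obtain c where "\<And>x. x \<in> ball 0 r \<Longrightarrow> l (pt t x) - l (pt 0 x) = c" by blast
  from this[of 0] this[of s] show ?thesis using r ts by (simp add: algebra_simps)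
qed

text \<open>The map (t, s) -> (f t, cnj (f (cnj s))) carries this involution to \<open>flip\<close>.
  The fixed points are the pairs (t, cnj t).\<close>

definition bidisc_flip :: "complex^2 \<Rightarrow> complex^2" where
  "bidisc_flip p = pt (cnj (p $ 2)) (cnj (p $ 1))"

lemma bidisc_flip_pt [simp]: "bidisc_flip (pt t s) = pt (cnj s) (cnj t)"
  by (simp add: bidisc_flip_def)

lemma bidisc_flip_in [simp]: "bidisc_flip p \<in> bidisc r \<longleftrightarrow> p \<in> bidisc r"
  by (auto simp: bidisc_flip_def) (auto simp: bidisc_def)

lemma linear_bidisc_flip: "linear bidisc_flip"
  by (rule linearI) (simp_all add: bidisc_flip_def vec_eq_iff forall_2)

text \<open>The chain rule through a conjugation. The flip exchanges the two coordinate directions,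
  so one partial derivative of a symmetric function is tied to the other; hence two functions
  \<open>A\<close> and \<open>B\<close>.\<close>

lemma fder_bidisc_flip:
  assumes A: "holomorphic_function_on (bidisc r) A" and B: "holomorphic_function_on (bidisc r) B"
    and sym: "\<And>p. p \<in> bidisc r \<Longrightarrow> A (bidisc_flip p) = cnj (B p)" and p: "p \<in> bidisc r"
  shows "fder A (bidisc_flip p) (bidisc_flip v) = cnj (fder B p v)"
proof -
  have "(A has_derivative fder A (bidisc_flip p)) (at (bidisc_flip p))"
    using holomorphic_function_on_has_derivative[OF A] p by simp
  from has_derivative_compose[OF has_derivative_linear_vec[OF linear_bidisc_flip] this]
  have 1: "((\<lambda>p. A (bidisc_flip p)) has_derivative (\<lambda>v. fder A (bidisc_flip p) (bidisc_flip v))) (at p)" .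
  have "((\<lambda>p. cnj (B p)) has_derivative (\<lambda>v. cnj (fder B p v))) (at p)"
    by (rule bounded_linear.has_derivative[OF bounded_linear_cnj holomorphic_function_on_has_derivative[OF B p]])
  then have "((\<lambda>p. A (bidisc_flip p)) has_derivative (\<lambda>v. cnj (fder B p v))) (at p)"
    by (rule has_derivative_transform_within_open[OF _ open_bidisc p]) (simp add: sym)
  from fun_cong[OF has_derivative_unique[OF 1 this]] show ?thesis .
qed

text \<open>At a fixed point of the flip the mixed derivative is its own conjugate, by the symmetry
  of second derivatives. This complements the metric, which captures only the real part.\<close>

lemma mixed_derivative_real_on_diagonal:
  assumes hol: "holomorphic_function_on (bidisc r) l"
    and sym: "\<And>p. p \<in> bidisc r \<Longrightarrow> l (bidisc_flip p) = cnj (l p)" and t: "cmod t < r"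
  shows "Im (fder (\<lambda>p. fder l p (pt 0 1)) (pt t (cnj t)) (pt 1 0)) = 0"
proof -
  note hol2 = directional_derivative_holomorphic[OF hol open_bidisc]
  have 1: "fder l (bidisc_flip p) (pt 0 1) = cnj (fder l p (pt 1 0))" if "p \<in> bidisc r" for p
    using fder_bidisc_flip[OF hol hol sym that, of "pt 1 0"] by simp
  have "fder (\<lambda>p. fder l p (pt 0 1)) (pt t (cnj t)) (pt 1 0)
      = cnj (fder (\<lambda>p. fder l p (pt 1 0)) (pt t (cnj t)) (pt 0 1))"
    using fder_bidisc_flip[OF hol2 hol2 1, of "pt t (cnj t)" "pt 0 1"] t by simp
  also have "fder (\<lambda>p. fder l p (pt 1 0)) (pt t (cnj t)) (pt 0 1)
      = fder (\<lambda>p. fder l p (pt 0 1)) (pt t (cnj t)) (pt 1 0)"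
    by (rule directional_derivative_commute[OF hol open_bidisc]) (simp add: t)
  finally show ?thesis by (metis Im_complex_of_real Reals_cnj_iff complex_is_Real_iff)
qed

text \<open>\<open>k\<close> is the polarization of \<open>K\<close>: \<open>K(z,w)\<close> is represented by \<open>k (join z (vcnj w))\<close>, which makes it
  holomorphic in all variables.\<close>

definition hermitian_kernel ::
  "(complex^'n::finite) set \<Rightarrow> (complex^('n + 'n)) set \<Rightarrow> (complex^('n + 'n) \<Rightarrow> complex) \<Rightarrow> (complex^'n \<Rightarrow> real) \<Rightarrow> bool" where
  "hermitian_kernel U Q k K \<longleftrightarrow> open U \<and> open Q \<and> holomorphic_function_on Q k \<and>
    (\<forall>p\<in>Q. flip p \<in> Q \<and> k (flip p) = cnj (k p)) \<and>
    (\<forall>z\<in>U. join z (vcnj z) \<in> Q \<and> k (join z (vcnj z)) = complex_of_real (K z) \<and> K z > 0)"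

text \<open>A holomorphic curve with velocity \<open>f'\<close>; the form \<open>c *s f' t\<close>
  of the derivative encodes the Cauchy-Riemann equations.\<close>

definition curve_deriv :: "real \<Rightarrow> (complex \<Rightarrow> complex^'n::finite) \<Rightarrow> (complex \<Rightarrow> complex^'n) \<Rightarrow> bool" where
  "curve_deriv r f f' \<longleftrightarrow> (\<forall>t. cmod t < r \<longrightarrow> (f has_derivative (\<lambda>c. c *s f' t)) (at t))"

text \<open>Conjugating both the parameter and the value makes the second slot holomorphic in
  \<open>p $ 2\<close>.\<close>

lemma bilinear_curve_derivative:
  fixes f :: "complex \<Rightarrow> complex^'n::finite"
  assumes f: "curve_deriv r f f'" and p: "p \<in> bidisc r"
  shows "((\<lambda>p. join (f (p $ 1)) (vcnj (f (cnj (p $ 2))))) has_derivative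
    (\<lambda>v. join (v $ 1 *s f' (p $ 1)) (v $ 2 *s vcnj (f' (cnj (p $ 2)))))) (at p)"
proof (rule has_derivative_join)
  have nth: "((\<lambda>p. p $ i) has_derivative (\<lambda>v. v $ i)) (at p)" for i
    by (rule bounded_linear_imp_has_derivative) (rule bounded_linear_vec_nth)
  have "(f has_derivative (\<lambda>c. c *s f' (p $ 1))) (at (p $ 1))"
    using f p by (auto simp: curve_deriv_def bidisc_def)
  from has_derivative_compose[OF nth this]
  show "((\<lambda>p. f (p $ 1)) has_derivative (\<lambda>v. v $ 1 *s f' (p $ 1))) (at p)" .
  have "(f has_derivative (\<lambda>c. c *s f' (cnj (p $ 2)))) (at (cnj (p $ 2)))"
    using f p by (auto simp: curve_deriv_def bidisc_def)
  from has_derivative_compose[OF bounded_linear.has_derivative[OF bounded_linear_cnj nth] this]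
  have "((\<lambda>p. f (cnj (p $ 2))) has_derivative (\<lambda>v. cnj (v $ 2) *s f' (cnj (p $ 2)))) (at p)" .
  from has_derivative_compose[OF this has_derivative_linear_vec[OF linear_vcnj]]
  show "((\<lambda>p. vcnj (f (cnj (p $ 2)))) has_derivative (\<lambda>v. v $ 2 *s vcnj (f' (cnj (p $ 2))))) (at p)"
    by (simp add: vcnj_smult)
qed

text \<open>\<open>l (pt t s)\<close> is a branch of log K(f t, f (cnj s)), fixed only through its
  exponential. The last clause identifies its mixed derivative on the diagonal with the pulled-back
  metric.\<close>

definition log_along ::
  "real \<Rightarrow> (complex^('n::finite + 'n) \<Rightarrow> complex) \<Rightarrow> (complex^'n \<Rightarrow> real) \<Rightarrow> (complex \<Rightarrow> complex^'n) \<Rightarrow>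
    (complex \<Rightarrow> complex^'n) \<Rightarrow> real \<Rightarrow> (complex^2 \<Rightarrow> complex) \<Rightarrow> bool" where
  "log_along r k \<Phi> f f' \<rho> l \<longleftrightarrow> 0 < \<rho> \<and> \<rho> \<le> r \<and> holomorphic_function_on (bidisc \<rho>) l \<and>
    (\<forall>p\<in>bidisc \<rho>. l (bidisc_flip p) = cnj (l p)) \<and>
    (\<forall>t s. cmod t < \<rho> \<longrightarrow> cmod s < \<rho> \<longrightarrow> exp (l (pt t (cnj s))) = k (join (f t) (vcnj (f s)))) \<and>
    (\<forall>t. cmod t < \<rho> \<longrightarrow> Re (fder (\<lambda>p. fder l p (pt 0 1)) (pt t (cnj t)) (pt 1 0)) =
       potential_metric \<Phi> (f t) (f' t) (f' t))"

text \<open>The kernel is positive on the diagonal, so near the point over \<open>f 0\<close> the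
  polarized kernel has positive real part. There the principal \<open>Ln\<close> is holomorphic,
  commutes with conjugation and restricts to \<open>ln\<close> of \<open>K\<close> on the
  diagonal.\<close>

lemma log_kernel_along_curve:
  fixes f :: "complex \<Rightarrow> complex^'n::finite"
  assumes hk: "hermitian_kernel U Q k K" and f: "curve_deriv r f f'" and fU: "\<And>t. cmod t < r \<Longrightarrow> f t \<in> U"
    and r: "r > 0"
  shows "\<exists>\<rho> l. log_along r k (\<lambda>z. ln (K z)) f f' \<rho> l"
proof -
  define Q' where "Q' = {p \<in> Q. Re (k p) > 0}"
  define L where "L p = Ln (k p)" for p
  define \<Gamma> where "\<Gamma> p = join (f (p $ 1)) (vcnj (f (cnj (p $ 2))))" for p :: "complex^2"
  have Q: "open Q" "holomorphic_function_on Q k" and U: "open U"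
    and flipQ: "\<And>p. p \<in> Q \<Longrightarrow> flip p \<in> Q" "\<And>p. p \<in> Q \<Longrightarrow> k (flip p) = cnj (k p)"
    and diag: "\<And>z. z \<in> U \<Longrightarrow> join z (vcnj z) \<in> Q"
      "\<And>z. z \<in> U \<Longrightarrow> k (join z (vcnj z)) = complex_of_real (K z)" "\<And>z. z \<in> U \<Longrightarrow> K z > 0"
    using hk by (auto simp: hermitian_kernel_def)
  have "open (Q \<inter> k -` {z. Re z > 0})"
    by (rule continuous_open_preimage[OF holomorphic_function_on_continuous[OF Q(2)] Q(1)
          open_halfspace_Re_gt])
  moreover have "Q' = Q \<inter> k -` {z. Re z > 0}" by (auto simp: Q'_def)
  ultimately have Q': "open Q'" by simp
  have notneg: "k p \<notin> \<real>\<^sub>\<le>\<^sub>0" if "p \<in> Q'" for p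
    using that by (auto simp: Q'_def complex_nonpos_Reals_iff)
  have holL: "holomorphic_function_on Q' L"
    unfolding L_def
    by (rule holomorphic_function_on_compose_field[where \<phi>' = "\<lambda>p. inverse (k p)"])
      (use Q notneg holomorphic_function_on_subset[of Q k Q'] in \<open>auto simp: Q'_def intro!: has_field_derivative_Ln\<close>)
  have flipL: "flip p \<in> Q'" "L (flip p) = cnj (L p)" if "p \<in> Q'" for p
    using that flipQ notneg[OF that] by (auto simp: Q'_def L_def cnj_Ln)
  have diagL: "join z (vcnj z) \<in> Q'" "complex_of_real (ln (K z)) = L (join z (vcnj z))" if "z \<in> U" for z
    using diag[OF that] by (auto simp: Q'_def L_def Ln_of_real)
  have der\<Gamma>: "(\<Gamma> has_derivative (\<lambda>v. join (v $ 1 *s f' (p $ 1)) (v $ 2 *s vcnj (f' (cnj (p $ 2)))))) (at p)"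
    if "p \<in> bidisc r" for p
    unfolding \<Gamma>_def by (rule bilinear_curve_derivative[OF f that])
  have "\<Gamma> 0 \<in> Q'" using fU[of 0] diagL r by (simp add: \<Gamma>_def)
  moreover have "isCont \<Gamma> 0"
    using has_derivative_continuous[OF der\<Gamma>[of 0]] r by (simp add: bidisc_def)
  ultimately obtain W where W: "open W" "0 \<in> W" "\<forall>p\<in>W. \<Gamma> p \<in> Q'"
    using Q' unfolding continuous_at_open by meson
  then obtain \<delta> where \<delta>: "\<delta> > 0" "ball 0 \<delta> \<subseteq> W" using open_contains_ball by blast
  define \<rho> where "\<rho> = min r (\<delta> / 2)"
  have \<rho>: "0 < \<rho>" "\<rho> \<le> r" using r \<delta> by (auto simp: \<rho>_def)
  have sub: "bidisc \<rho> \<subseteq> bidisc r" using \<rho> bidisc_mono by blast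
  have \<Gamma>Q: "\<Gamma> p \<in> Q'" if "p \<in> bidisc \<rho>" for p
  proof -
    have "bidisc \<rho> \<subseteq> bidisc (\<delta> / 2)" by (rule bidisc_mono) (simp add: \<rho>_def)
    then show ?thesis using that bidisc_subset_ball[of \<delta>] \<delta>(2) W(3) by blast
  qed
  define l where "l p = L (\<Gamma> p)" for p
  have \<Gamma>smult: "join ((c *s v) $ 1 *s a) ((c *s v) $ 2 *s b) = c *s join (v $ 1 *s a) (v $ 2 *s b)"
    for c a b and v :: "complex^2"
    by (simp add: vec_eq_iff join_def split: sum.split)
  have holl: "holomorphic_function_on (bidisc \<rho>) l"
    unfolding l_def
    by (rule holomorphic_function_on_compose_map[OF holL \<Gamma>Q der\<Gamma>]) (use sub \<Gamma>smult in auto)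
  have derl: "fder l p v = fder L (\<Gamma> p) (join (v $ 1 *s f' (p $ 1)) (v $ 2 *s vcnj (f' (cnj (p $ 2)))))"
    if p: "p \<in> bidisc \<rho>" for p v
    using fder_eq[OF has_derivative_compose[OF der\<Gamma> holomorphic_function_on_has_derivative[OF holL \<Gamma>Q]]] p sub
    by (auto simp: l_def[abs_def])
  have "\<Gamma> (bidisc_flip p) = flip (\<Gamma> p)" for p by (simp add: \<Gamma>_def bidisc_flip_def)
  then have "l (bidisc_flip p) = cnj (l p)" if "p \<in> bidisc \<rho>" for p
    using flipL(2)[OF \<Gamma>Q[OF that]] by (simp add: l_def)
  moreover have "exp (l (pt t (cnj s))) = k (join (f t) (vcnj (f s)))"
    if "cmod t < \<rho>" "cmod s < \<rho>" for t s
  proof -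
    have "k (\<Gamma> (pt t (cnj s))) \<noteq> 0" using notneg[OF \<Gamma>Q[of "pt t (cnj s)"]] that by auto
    then show ?thesis by (simp add: l_def L_def \<Gamma>_def)
  qed
  moreover have "Re (fder (\<lambda>p. fder l p (pt 0 1)) (pt t (cnj t)) (pt 1 0)) =
       potential_metric (\<lambda>z. ln (K z)) (f t) (f' t) (f' t)" if t: "cmod t < \<rho>" for t
  proof -
    let ?p = "pt t (cnj t)" and ?w = "join 0 (vcnj (f' t))"
    have p: "?p \<in> bidisc \<rho>" using t by simp
    have \<Gamma>p: "\<Gamma> ?p = join (f t) (vcnj (f t))" by (simp add: \<Gamma>_def)
    have holLw: "holomorphic_function_on Q' (\<lambda>q. fder L q ?w)"
      by (rule directional_derivative_holomorphic[OF holL Q'])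
    have hol1: "holomorphic_function_on (bidisc \<rho>) (\<lambda>p. fder l p (pt 0 1))"
      by (rule directional_derivative_holomorphic[OF holl open_bidisc])
    have hol2: "holomorphic_function_on (bidisc \<rho>) (\<lambda>p. fder L (\<Gamma> p) ?w)"
      by (rule holomorphic_function_on_compose_map[OF holLw \<Gamma>Q der\<Gamma>]) (use sub \<Gamma>smult in auto)
    have d1: "((\<lambda>\<tau>. fder l (?p + \<tau> *s pt 1 0) (pt 0 1)) has_field_derivative
        fder (\<lambda>p. fder l p (pt 0 1)) ?p (pt 1 0)) (at 0)"
      using line_field_derivative[OF hol1, of ?p 0] p by simp
    have d0: "((\<lambda>\<tau>. fder L (\<Gamma> (?p + \<tau> *s pt 1 0)) ?w) has_field_derivative
        fder (\<lambda>p. fder L (\<Gamma> p) ?w) ?p (pt 1 0)) (at 0)"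
      using line_field_derivative[OF hol2, of ?p 0] p by simp
    \<comment> \<open>A move in the direction \<open>pt 1 0\<close> keeps the second coordinate, so
      the vector \<open>?w\<close> stays the same along this line and \<open>derl\<close> applies
      with it at every point.\<close>
    have ev: "\<forall>\<^sub>F \<tau> in nhds 0. fder L (\<Gamma> (?p + \<tau> *s pt 1 0)) ?w = fder l (?p + \<tau> *s pt 1 0) (pt 0 1)"
      unfolding eventually_nhds_metric
    proof (intro exI[of _ "\<rho> - cmod t"] conjI allI impI)
      fix \<tau> :: complex assume "dist \<tau> 0 < \<rho> - cmod t"
      then have "pt (t + \<tau>) (cnj t) \<in> bidisc \<rho>" using t norm_triangle_ineq[of t \<tau>] by simp
      from derl[OF this, of "pt 0 1"] show "fder L (\<Gamma> (?p + \<tau> *s pt 1 0)) ?w = fder l (?p + \<tau> *s pt 1 0) (pt 0 1)"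
        by (simp add: pt_line)
    qed (use t in simp)
    have d2: "((\<lambda>\<tau>. fder l (?p + \<tau> *s pt 1 0) (pt 0 1)) has_field_derivative
        fder (\<lambda>p. fder L (\<Gamma> p) ?w) ?p (pt 1 0)) (at 0)"
      using DERIV_cong_ev[OF refl ev refl] d0 by blast
    have pr: "?p \<in> bidisc r" using p sub by blast
    have "fder (\<lambda>p. fder L (\<Gamma> p) ?w) ?p (pt 1 0) = fder (\<lambda>q. fder L q ?w) (\<Gamma> ?p) (join (f' t) 0)"
      unfolding fder_eq[OF has_derivative_compose[OF der\<Gamma>[OF pr]
            holomorphic_function_on_has_derivative[OF holLw \<Gamma>Q[OF p]]]] by simp
    then have "fder (\<lambda>p. fder l p (pt 0 1)) ?p (pt 1 0) = fder (\<lambda>q. fder L q ?w) (\<Gamma> ?p) (join (f' t) 0)"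
      using DERIV_unique[OF d1 d2] by simp
    then show ?thesis
      using potential_metric_polarized[OF U fU[of t] Q' holL diagL, where u = "f' t"] t \<rho> by (simp add: \<Gamma>p)
  qed
  ultimately have "log_along r k (\<lambda>z. ln (K z)) f f' \<rho> l"
    using \<rho> holl unfolding log_along_def by blast
  then show ?thesis by blast
qed

text \<open>The mixed derivative of the difference of the logarithms vanishes on the diagonal: its
  real part because the metrics agree, its imaginary part by Hermitian symmetry. Polarization
  spreads this zero to a bidisc, where the difference splits and can be exponentiated.\<close>

lemma equal_metrics_kernels_proportional:
  fixes f :: "complex \<Rightarrow> complex^'n::finite" and g :: "complex \<Rightarrow> complex^'m::finite"
  assumes k1: "hermitian_kernel U1 Q1 k1 K1" and f: "curve_deriv r f f'" "\<And>t. cmod t < r \<Longrightarrow> f t \<in> U1"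
    and k2: "hermitian_kernel U2 Q2 k2 K2" and g: "curve_deriv r g g'" "\<And>t. cmod t < r \<Longrightarrow> g t \<in> U2"
    and r: "r > 0"
    and eq: "\<And>t. cmod t < r \<Longrightarrow> potential_metric (\<lambda>z. ln (K1 z)) (f t) (f' t) (f' t)
      = potential_metric (\<lambda>z. ln (K2 z)) (g t) (g' t) (g' t)"
  obtains \<rho> \<alpha> \<beta> where "0 < \<rho>" "\<rho> \<le> r"
    "\<And>t s. cmod t < \<rho> \<Longrightarrow> cmod s < \<rho> \<Longrightarrow>
      k1 (join (f t) (vcnj (f s))) = \<alpha> t * \<beta> s * k2 (join (g t) (vcnj (g s)))"
proof -
  obtain \<rho>1 l1 where "log_along r k1 (\<lambda>z. ln (K1 z)) f f' \<rho>1 l1"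
    using log_kernel_along_curve[OF k1 f r] by blast
  then have l1: "0 < \<rho>1" "\<rho>1 \<le> r" "holomorphic_function_on (bidisc \<rho>1) l1"
    "\<And>p. p \<in> bidisc \<rho>1 \<Longrightarrow> l1 (bidisc_flip p) = cnj (l1 p)"
    "\<And>t s. cmod t < \<rho>1 \<Longrightarrow> cmod s < \<rho>1 \<Longrightarrow> exp (l1 (pt t (cnj s))) = k1 (join (f t) (vcnj (f s)))"
    "\<And>t. cmod t < \<rho>1 \<Longrightarrow> Re (fder (\<lambda>p. fder l1 p (pt 0 1)) (pt t (cnj t)) (pt 1 0)) =
       potential_metric (\<lambda>z. ln (K1 z)) (f t) (f' t) (f' t)"
    unfolding log_along_def by blast+
  obtain \<rho>2 l2 where "log_along r k2 (\<lambda>z. ln (K2 z)) g g' \<rho>2 l2"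
    using log_kernel_along_curve[OF k2 g r] by blast
  then have l2: "0 < \<rho>2" "\<rho>2 \<le> r" "holomorphic_function_on (bidisc \<rho>2) l2"
    "\<And>p. p \<in> bidisc \<rho>2 \<Longrightarrow> l2 (bidisc_flip p) = cnj (l2 p)"
    "\<And>t s. cmod t < \<rho>2 \<Longrightarrow> cmod s < \<rho>2 \<Longrightarrow> exp (l2 (pt t (cnj s))) = k2 (join (g t) (vcnj (g s)))"
    "\<And>t. cmod t < \<rho>2 \<Longrightarrow> Re (fder (\<lambda>p. fder l2 p (pt 0 1)) (pt t (cnj t)) (pt 1 0)) =
       potential_metric (\<lambda>z. ln (K2 z)) (g t) (g' t) (g' t)"
    unfolding log_along_def by blast+
  define \<rho> where "\<rho> = min \<rho>1 \<rho>2"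
  have sub: "bidisc \<rho> \<subseteq> bidisc \<rho>1" "bidisc \<rho> \<subseteq> bidisc \<rho>2" by (auto simp: \<rho>_def bidisc_def)
  have \<rho>: "0 < \<rho>" "\<rho> \<le> r" using l1(1,2) l2(1) by (auto simp: \<rho>_def)
  have h1: "holomorphic_function_on (bidisc \<rho>) l1" and h2: "holomorphic_function_on (bidisc \<rho>) l2"
    using l1(3) l2(3) sub holomorphic_function_on_subset by blast+
  define l where "l p = l1 p - l2 p" for p
  have hl: "holomorphic_function_on (bidisc \<rho>) l"
    unfolding l_def by (intro holomorphic_function_on_minus h1 h2)
  have dl: "fder (\<lambda>p. A p - B p) p v = fder A p v - fder B p v"
    if "holomorphic_function_on (bidisc \<rho>) A" "holomorphic_function_on (bidisc \<rho>) B" "p \<in> bidisc \<rho>"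
    for A B p v
    using fder_eq[OF has_derivative_diff[OF that(1,2)[THEN holomorphic_function_on_has_derivative, OF that(3)]]]
    by simp
  note dh = directional_derivative_holomorphic[OF _ open_bidisc]
  define q where "q p = fder (\<lambda>p. fder l p (pt 0 1)) p (pt 1 0)" for p
  have q_eq: "q p = fder (\<lambda>p. fder l1 p (pt 0 1)) p (pt 1 0) - fder (\<lambda>p. fder l2 p (pt 0 1)) p (pt 1 0)"
    if p: "p \<in> bidisc \<rho>" for p
  proof -
    have "((\<lambda>p. fder l1 p (pt 0 1) - fder l2 p (pt 0 1)) has_derivative
      (\<lambda>v. fder (\<lambda>p. fder l1 p (pt 0 1)) p v - fder (\<lambda>p. fder l2 p (pt 0 1)) p v)) (at p)"
      by (intro has_derivative_diff holomorphic_function_on_has_derivative[OF _ p] dh h1 h2)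
    then have "((\<lambda>p. fder l p (pt 0 1)) has_derivative
      (\<lambda>v. fder (\<lambda>p. fder l1 p (pt 0 1)) p v - fder (\<lambda>p. fder l2 p (pt 0 1)) p v)) (at p)"
      by (rule has_derivative_transform_within_open[OF _ open_bidisc p])
        (simp add: l_def[abs_def] dl[OF h1 h2])
    then show ?thesis by (simp add: q_def fder_eq)
  qed
  have "q (pt t (cnj t)) = 0" if t: "cmod t < \<rho>" for t
  proof (rule complex_eqI)
    have "Re (q (pt t (cnj t))) = 0"
      using q_eq[of "pt t (cnj t)"] l1(6)[of t] l2(6)[of t] eq[of t] t \<rho> by (auto simp: \<rho>_def)
    then show "Re (q (pt t (cnj t))) = Re 0" by simp
    have "l (bidisc_flip p) = cnj (l p)" if "p \<in> bidisc \<rho>" for p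
      using l1(4)[OF subsetD[OF sub(1) that]] l2(4)[OF subsetD[OF sub(2) that]] by (simp add: l_def)
    from mixed_derivative_real_on_diagonal[OF hl this t]
    show "Im (q (pt t (cnj t))) = Im 0" by (simp add: q_def)
  qed
  moreover have "holomorphic_function_on (bidisc \<rho>) q"
    unfolding q_def by (intro dh hl)
  ultimately have q0: "q (pt t s) = 0" if "cmod t < \<rho> / 2" "cmod s < \<rho> / 2" for t s
    using polarization that by blast
  have hl2: "holomorphic_function_on (bidisc (\<rho>/2)) l"
    by (rule holomorphic_function_on_subset[OF hl bidisc_mono]) (use \<rho> in simp)
  have split: "l (pt t s) = l (pt t 0) + l (pt 0 s) - l (pt 0 0)" if "cmod t < \<rho> / 2" "cmod s < \<rho> / 2" for t s
    by (rule mixed_derivative_zero_splits[OF hl2 _ that]) (use q0 in \<open>simp add: q_def\<close>)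
  show ?thesis
  \<comment> \<open>The second parameter of \<open>l\<close> is cnj s, hence the conjugate in
    \<beta>, which also absorbs the constant l(0, 0). The radius \<rho>/2 is what
    \<open>polarization\<close> leaves.\<close>
  proof (rule that[of "\<rho>/2" "\<lambda>t. exp (l (pt t 0))" "\<lambda>s. exp (l (pt 0 (cnj s)) - l (pt 0 0))"])
    fix t s :: complex assume ts: "cmod t < \<rho> / 2" "cmod s < \<rho> / 2"
    have "l1 (pt t (cnj s)) = l (pt t 0) + (l (pt 0 (cnj s)) - l (pt 0 0)) + l2 (pt t (cnj s))"
      using split[of t "cnj s"] ts by (simp add: l_def algebra_simps)
    moreover have "cmod t < \<rho>1 \<and> cmod s < \<rho>1 \<and> cmod t < \<rho>2 \<and> cmod s < \<rho>2"
      using ts \<rho> by (auto simp: \<rho>_def)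
    ultimately show "k1 (join (f t) (vcnj (f s))) =
        exp (l (pt t 0)) * exp (l (pt 0 (cnj s)) - l (pt 0 0)) * k2 (join (g t) (vcnj (g s)))"
      using l1(5)[of t s] l2(5)[of t s] by (simp add: exp_add)
  qed (use \<rho> in auto)
qed

section \<open>The mean value inequality\<close>

text \<open>An isometry maps balls to balls of the same volume, and by the Vitali covering theorem an open
  set is a disjoint union of balls up to a null set.\<close>

lemma emeasure_linear_isometry_le:
  fixes T :: "'a::euclidean_space \<Rightarrow> 'a"
  assumes lin: "linear T" and iso: "\<And>x. norm (T x) = norm x" and U: "open U" and V: "open V" "V \<subseteq> T ` U"
  shows "emeasure lborel V \<le> emeasure lborel U"
proof -
  have inj: "inj T"
    using iso by (simp add: linear_injective_0[OF lin]) (metis norm_eq_zero)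
  then have surj: "surj T" by (rule eucl.linear_inj_imp_surj[OF lin])
  have dist: "dist (T x) (T y) = dist x y" for x y
    using iso[of "x - y"] by (simp add: dist_norm linear_diff[OF lin])
  define K where "K = {(a, r). 0 < r \<and> ball a r \<subseteq> U}"
  have cov: "\<exists>i. i \<in> K \<and> x \<in> ball (fst i) (snd i) \<and> snd i < d" if "x \<in> U" "0 < d" for x d
  proof -
    obtain e where "e > 0" "ball x e \<subseteq> U" using U \<open>x \<in> U\<close> open_contains_ball by blast
    then show ?thesis using \<open>0 < d\<close>
      by (intro exI[of _ "(x, min e (d / 2))"]) (auto simp: K_def)
  qed
  obtain C where C: "countable C" "C \<subseteq> K"
    and disj: "pairwise (\<lambda>i j. disjnt (ball (fst i) (snd i)) (ball (fst j) (snd j))) C"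
    and neg: "negligible (U - (\<Union>i\<in>C. ball (fst i) (snd i)))"
    using Vitali_covering_theorem_balls[of U K fst snd] cov by blast
  let ?B = "\<Union>i\<in>C. ball (T (fst i)) (snd i)"
  let ?N = "U - (\<Union>i\<in>C. ball (fst i) (snd i))"
  have d1: "disjoint_family_on (\<lambda>i. ball (fst i) (snd i)) C"
    using disj by (auto simp: disjoint_family_on_def pairwise_def disjnt_def)
  have d2: "disjoint_family_on (\<lambda>i. ball (T (fst i)) (snd i)) C"
    unfolding disjoint_family_on_def
  proof (intro ballI impI equals0I)
    fix i j y assume ij: "i \<in> C" "j \<in> C" "i \<noteq> j" and y: "y \<in> ball (T (fst i)) (snd i) \<inter> ball (T (fst j)) (snd j)"
    obtain x where "y = T x" using surj by blast
    with y have "x \<in> ball (fst i) (snd i) \<inter> ball (fst j) (snd j)" by (simp add: dist)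
    then show False using disjoint_family_onD[OF d1 ij] by blast
  qed
  have "negligible (T ` ?N)"
    by (rule negligible_differentiable_image_negligible[OF order_refl neg])
      (simp add: lin linear_imp_differentiable_on)
  moreover have "V - ?B \<subseteq> T ` ?N"
  proof
    fix y assume y: "y \<in> V - ?B"
    then obtain x where x: "x \<in> U" "y = T x" using V by blast
    then show "y \<in> T ` ?N" using y by (auto simp: dist)
  qed
  ultimately have "negligible (V - ?B)" by (rule negligible_subset)
  then have "V - ?B \<in> null_sets lebesgue" by (simp add: negligible_iff_null_sets)
  moreover have B: "?B \<in> sets borel" by (intro borel_open open_UN ballI open_ball)
  ultimately have null: "V - ?B \<in> null_sets lborel"
    using V by (simp add: null_sets_completion_iff borel_open)
  have "emeasure lborel V \<le> emeasure lborel (?B \<union> (V - ?B))"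
    using V B by (intro emeasure_mono) auto
  also have "\<dots> = emeasure lborel ?B" using null B by (intro emeasure_Un_null_set) auto
  also have "\<dots> = (\<integral>\<^sup>+i. emeasure lborel (ball (T (fst i)) (snd i)) \<partial>count_space C)"
    by (intro emeasure_UN_countable C d2) auto
  also have "\<dots> = (\<integral>\<^sup>+i. emeasure lborel (ball (fst i) (snd i)) \<partial>count_space C)"
    by (intro nn_integral_cong) (use C in \<open>auto simp: emeasure_ball K_def\<close>)
  also have "\<dots> = emeasure lborel (\<Union>i\<in>C. ball (fst i) (snd i))"
    by (intro emeasure_UN_countable[symmetric] C d1) auto
  also have "\<dots> \<le> emeasure lborel U"
    using C(2) U by (intro emeasure_mono) (force simp: K_def)+
  finally show ?thesis .
qed

text \<open>The preceding inequality for \<open>T\<close> and for its inverse \<open>S\<close> gives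
  equality on boxes, and these determine Lebesgue measure.\<close>

lemma distr_lborel_linear_isometry:
  fixes T :: "'a::euclidean_space \<Rightarrow> 'a"
  assumes lin: "linear T" and iso: "\<And>x. norm (T x) = norm x"
  shows "distr lborel borel T = lborel"
proof (rule lborel_eqI[symmetric])
  have inj: "inj T"
    using iso by (simp add: linear_injective_0[OF lin]) (metis norm_eq_zero)
  then have surj: "surj T" by (rule eucl.linear_inj_imp_surj[OF lin])
  obtain S where S: "linear S" "T \<circ> S = id" using linear_surjective_right_inverse[OF lin surj] by blast
  have TS: "T (S x) = x" for x using S(2) by (metis comp_apply id_apply)
  have ST: "S (T x) = x" for x using TS[of "T x"] inj by (rule injD[rotated])
  have isoS: "norm (S x) = norm x" for x using iso[of "S x"] by (simp add: TS)
  have cont: "continuous_on UNIV T"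
    using lin by (simp add: linear_continuous_on linear_conv_bounded_linear)
  have meas: "T \<in> borel_measurable borel" using cont by (rule borel_measurable_continuous_onI)
  fix l u :: 'a assume lu: "\<And>b. b \<in> Basis \<Longrightarrow> l \<bullet> b \<le> u \<bullet> b"
  have op: "open (T -` box l u)" using cont open_box by (metis continuous_on_open_vimage inf_top_right open_UNIV)
  have "emeasure lborel (T -` box l u) \<le> emeasure lborel (box l u)"
    by (rule emeasure_linear_isometry_le[OF S(1) isoS open_box op])
      (metis ST imageI subsetI vimageE)
  moreover have "emeasure lborel (box l u) \<le> emeasure lborel (T -` box l u)"
    by (rule emeasure_linear_isometry_le[OF lin iso op open_box]) (metis surj surj_image_vimage_eq order_refl)
  ultimately have "emeasure lborel (T -` box l u) = emeasure lborel (box l u)" by (rule antisym)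
  then show "emeasure (distr lborel borel T) (box l u) = (\<Prod>b\<in>Basis. (u - l) \<bullet> b)"
    using meas lu by (simp add: emeasure_distr)
qed simp

text \<open>Cauchy's integral formula on the unit circle, parametrized by [0, 1]. A
  \<open>nn_integral\<close> on the right allows a second integration by Tonelli's theorem.\<close>

lemma mean_value_inequality_circle:
  assumes "\<phi> holomorphic_on ball 0 R" "R > 1"
  shows "ennreal (cmod (\<phi> 0)) \<le> (\<integral>\<^sup>+x. indicator {0..1} x * ennreal (cmod (\<phi> (exp (2 * of_real pi * \<i> * of_real x)))) \<partial>lborel)"
proof -
  have sub: "cball 0 1 \<subseteq> ball (0::complex) R" using assms by auto
  have cont: "continuous_on (cball 0 1) \<phi>" "\<phi> holomorphic_on ball 0 1"
    using assms sub holomorphic_on_imp_continuous_on continuous_on_subset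
    by (blast, meson ball_subset_cball holomorphic_on_subset order_trans)
  let ?e = "\<lambda>x::real. exp (2 * of_real pi * \<i> * of_real x)"
  have "((\<lambda>u. \<phi> u / (u - 0)) has_contour_integral (2 * of_real pi * \<i> * \<phi> 0)) (circlepath 0 1)"
    by (rule Cauchy_integral_circlepath[OF cont]) simp
  then have "((\<lambda>x. \<phi> (circlepath 0 1 x) / circlepath 0 1 x * vector_derivative (circlepath 0 1) (at x within {0..1}))
      has_integral (2 * of_real pi * \<i> * \<phi> 0)) {0..1}"
    unfolding has_contour_integral_def by simp
  then have "((\<lambda>x. (2 * of_real pi * \<i>) * \<phi> (?e x)) has_integral (2 * of_real pi * \<i> * \<phi> 0)) {0..1}"
  proof (rule has_integral_eq[rotated])
    fix x :: real assume "x \<in> {0..1}"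
    then have "vector_derivative (circlepath 0 1) (at x within {0..1}) = 2 * of_real pi * \<i> * ?e x"
      by (simp add: vector_derivative_circlepath01)
    then show "\<phi> (circlepath 0 1 x) / circlepath 0 1 x * vector_derivative (circlepath 0 1) (at x within {0..1})
        = (2 * of_real pi * \<i>) * \<phi> (?e x)"
      by (simp add: circlepath)
  qed
  then have "((\<lambda>x. inverse (2 * of_real pi * \<i>) * ((2 * of_real pi * \<i>) * \<phi> (?e x))) has_integral
      inverse (2 * of_real pi * \<i>) * ((2 * of_real pi * \<i>) * \<phi> 0)) {0..1}"
    by (rule has_integral_mult_right)
  moreover have inv: "c \<noteq> 0 \<Longrightarrow> inverse c * (c * y) = y" for c y :: complex
    by simp
  have "inverse (2 * of_real pi * \<i>) * ((2 * of_real pi * \<i>) * y) = y" for y :: complex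
    by (rule inv) simp
  ultimately have int: "((\<lambda>x. \<phi> (?e x)) has_integral \<phi> 0) {0..1}" by (simp only: \<open>\<And>y. inverse (2 * of_real pi * \<i>) * ((2 * of_real pi * \<i>) * y) = y\<close>)
  have ec: "continuous_on {0..1} (\<lambda>x. \<phi> (?e x))"
    by (rule continuous_on_compose2[OF cont(1)]) (auto intro!: continuous_intros simp: norm_exp_eq_Re)
  then have c: "continuous_on {0..1} (\<lambda>x. cmod (\<phi> (?e x)))" by (rule continuous_on_norm)
  then have int2: "((\<lambda>x. cmod (\<phi> (?e x))) has_integral integral {0..1} (\<lambda>x. cmod (\<phi> (?e x)))) {0..1}"
    by (intro integrable_integral integrable_continuous_interval)
  have "cmod (\<phi> 0) \<le> integral {0..1} (\<lambda>x. cmod (\<phi> (?e x)))"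
    using integral_norm_bound_integral[OF has_integral_integrable[OF int] has_integral_integrable[OF int2]]
      integral_unique[OF int] by simp
  then have "ennreal (cmod (\<phi> 0)) \<le> ennreal (integral {0..1} (\<lambda>x. cmod (\<phi> (?e x))))" by (rule ennreal_leI)
  also have "\<dots> = (\<integral>\<^sup>+x. ennreal (indicator {0..1} x * cmod (\<phi> (?e x))) \<partial>lborel)"
    using nn_integral_has_integral_lebesgue[OF _ int2] by simp
  finally show ?thesis by (simp add: ennreal_mult' ennreal_indicator)
qed

lemma nn_integral_rotate:
  fixes h :: "complex^'n::finite \<Rightarrow> ennreal"
  assumes "h \<in> borel_measurable borel" "cmod c = 1"
  shows "(\<integral>\<^sup>+w. h (c *s w) \<partial>lborel) = (\<integral>\<^sup>+w. h w \<partial>lborel)"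
proof -
  have lin: "linear (\<lambda>w. c *s (w :: complex^'n))" by (rule linearI) (simp_all add: vec_eq_iff algebra_simps)
  then have "(\<lambda>w. c *s (w :: complex^'n)) \<in> borel_measurable borel"
    by (intro borel_measurable_continuous_onI) (simp add: linear_continuous_on linear_conv_bounded_linear)
  then have "(\<integral>\<^sup>+w. h (c *s w) \<partial>lborel) = (\<integral>\<^sup>+w. h w \<partial>distr lborel borel (\<lambda>w. c *s w))"
    using assms(1) by (simp add: nn_integral_distr)
  also have "distr lborel borel (\<lambda>w. c *s (w :: complex^'n)) = lborel"
    by (rule distr_lborel_linear_isometry[OF lin]) (simp add: norm_vector_smult assms(2))
  finally show ?thesis .
qed

text \<open>Averaging the inequality on the circles through \<open>w\<close> over all \<open>w\<close> in the ball, and rotation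
  invariance of the Lebesgue measure.\<close>

lemma mean_value_inequality_ball:
  fixes f :: "complex^'n::finite \<Rightarrow> complex"
  assumes hol: "holomorphic_function_on (ball z r) f"
  shows "ennreal ((cmod (f z))\<^sup>2) * emeasure lborel (ball (0 :: complex^'n) r)
    \<le> (\<integral>\<^sup>+w. indicator (ball z r) w * ennreal ((cmod (f w))\<^sup>2) \<partial>lborel)"
proof -
  define h where "h w = indicator (ball 0 r) w * ennreal ((cmod (f (z + w)))\<^sup>2)" for w
  have inb: "z + w \<in> ball z r" if "w \<in> ball 0 r" for w using that by (simp add: dist_norm)
  have "continuous_on (ball 0 r) (\<lambda>w. (cmod (f (z + w)))\<^sup>2)"
    by (intro continuous_intros continuous_on_compose2[OF holomorphic_function_on_continuous[OF hol]])
      (use inb in auto)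
  then have "(\<lambda>w. indicator (ball 0 r) w *\<^sub>R (cmod (f (z + w)))\<^sup>2) \<in> borel_measurable borel"
    by (intro borel_measurable_continuous_on_indicator) auto
  then have "(\<lambda>w. ennreal (indicator (ball 0 r) w *\<^sub>R (cmod (f (z + w)))\<^sup>2)) \<in> borel_measurable borel"
    by (rule measurable_compose[OF _ measurable_ennreal])
  then have hm[measurable]: "h \<in> borel_measurable borel"
    by (simp add: h_def[abs_def] ennreal_mult' ennreal_indicator)
  let ?e = "\<lambda>x::real. exp (2 * of_real pi * \<i> * of_real x)"
  have "continuous_on UNIV (\<lambda>(x::real, w :: complex^'n). ?e x *s w)"
    unfolding case_prod_beta vector_scalar_mult_def
    by (intro continuous_on_vec_lambda continuous_intros)
  then have "(\<lambda>(x::real, w :: complex^'n). ?e x *s w) \<in> borel_measurable (borel \<Otimes>\<^sub>M borel)"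
    unfolding borel_prod by (rule borel_measurable_continuous_onI)
  from measurable_compose[OF this hm]
  have [measurable]: "(\<lambda>(x, w). h (?e x *s w)) \<in> borel_measurable (borel \<Otimes>\<^sub>M borel)"
    by (simp add: case_prod_beta)
  have "ennreal ((cmod (f z))\<^sup>2) * emeasure lborel (ball (0 :: complex^'n) r)
      = (\<integral>\<^sup>+w. ennreal ((cmod (f z))\<^sup>2) * indicator (ball (0 :: complex^'n) r) w \<partial>lborel)"
    by (simp add: nn_integral_cmult_indicator)
  also have "\<dots> \<le> (\<integral>\<^sup>+w. (\<integral>\<^sup>+x. indicator {0..1} x * h (?e x *s w) \<partial>lborel) \<partial>lborel)"
  proof (rule nn_integral_mono)
    fix w :: "complex^'n"
    show "ennreal ((cmod (f z))\<^sup>2) * indicator (ball 0 r) w \<le> (\<integral>\<^sup>+x. indicator {0..1} x * h (?e x *s w) \<partial>lborel)"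
    proof (cases "w \<in> ball 0 r \<and> w \<noteq> 0")
      case True
      define R where "R = r / norm w"
      have R: "R > 1" using True by (auto simp: R_def)
      have inR: "z + \<tau> *s w \<in> ball z r" if "\<tau> \<in> ball 0 R" for \<tau>
        using that True by (simp add: dist_norm norm_vector_smult R_def field_simps)
      have "(\<lambda>\<tau>. f (z + \<tau> *s w)) holomorphic_on ball 0 R"
        by (rule line_holomorphic_on[OF hol inR])
      \<comment> \<open>The circle inequality is applied to the square of \<open>f\<close>, whose
        modulus is the integrand |f|^2.\<close>
      then have "(\<lambda>\<tau>. (f (z + \<tau> *s w))\<^sup>2) holomorphic_on ball 0 R" by (intro holomorphic_intros)
      from mean_value_inequality_circle[OF this R] True
      show ?thesis
        by (simp add: h_def norm_power norm_vector_smult)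
    next
      \<comment> \<open>For \<open>w = 0\<close> the circle degenerates to a point and both sides
        agree; for \<open>w\<close> outside the ball the left side is 0.\<close>
      case False
      have "(\<integral>\<^sup>+x. indicator {0..1} x * h (?e x *s 0) \<partial>lborel) = h 0"
        by (simp add: nn_integral_multc)
      then show ?thesis using False by (auto simp: h_def indicator_def)
    qed
  qed
  also have "\<dots> = (\<integral>\<^sup>+x. (\<integral>\<^sup>+w. indicator {0..1} x * h (?e x *s w) \<partial>lborel) \<partial>lborel)"
    by (rule lborel_pair.Fubini') (simp add: case_prod_beta split_beta')
  also have "\<dots> = (\<integral>\<^sup>+x. indicator {0..1::real} x * (\<integral>\<^sup>+w. h w \<partial>lborel) \<partial>lborel)"
    by (intro nn_integral_cong) (simp add: nn_integral_cmult nn_integral_rotate[OF hm])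
  also have "\<dots> = (\<integral>\<^sup>+w. h w \<partial>lborel)" by (simp add: nn_integral_multc)
  also have "\<dots> = (\<integral>\<^sup>+w. indicator (ball z r) w * ennreal ((cmod (f w))\<^sup>2) \<partial>lborel)"
  proof -
    let ?g = "\<lambda>w. indicator (ball z r) w * ennreal ((cmod (f w))\<^sup>2)"
    have "continuous_on (ball z r) (\<lambda>w. (cmod (f w))\<^sup>2)"
      by (intro continuous_intros holomorphic_function_on_continuous[OF hol])
    then have "(\<lambda>w. indicator (ball z r) w *\<^sub>R (cmod (f w))\<^sup>2) \<in> borel_measurable borel"
      by (intro borel_measurable_continuous_on_indicator) auto
    then have "(\<lambda>w. ennreal (indicator (ball z r) w *\<^sub>R (cmod (f w))\<^sup>2)) \<in> borel_measurable borel"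
      by (rule measurable_compose[OF _ measurable_ennreal])
    then have g: "?g \<in> borel_measurable borel"
      by (simp add: ennreal_mult' ennreal_indicator)
    have "h w = ?g (z + w)" for w by (simp add: h_def indicator_def dist_norm)
    then have "(\<integral>\<^sup>+w. h w \<partial>lborel) = (\<integral>\<^sup>+w. ?g w \<partial>distr lborel borel ((+) z))"
      using g by (simp add: nn_integral_distr)
    then show ?thesis by (simp add: lborel_distr_plus)
  qed
  finally show ?thesis .
qed

section \<open>The Bergman space\<close>

definition norm_sq :: "(complex^'n::finite) set \<Rightarrow> (complex^'n \<Rightarrow> complex) \<Rightarrow> real" where
  "norm_sq D f = set_lebesgue_integral lborel D (\<lambda>z. (cmod (f z))\<^sup>2)"

lemma norm_sq_nonneg: "norm_sq D f \<ge> 0"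
  unfolding norm_sq_def set_lebesgue_integral_def by (intro integral_nonneg_AE) auto

lemma bergman_norm_eq: "bergman_norm D f = sqrt (norm_sq D f)"
  by (simp add: bergman_norm_def norm_sq_def)

section \<open>The Bergman space as an inner product space\<close>

locale bounded_dom =
  fixes D :: "(complex^'n::finite) set"
  assumes D: "bounded_domain D"
begin

lemma openD: "open D" and boundedD: "bounded D" and nonemptyD: "D \<noteq> {}"
  using D by (auto simp: bounded_domain_def)

lemma setsD [measurable]: "D \<in> sets borel"
  using openD by simp

lemma emeasureD: "emeasure lborel D < \<infinity>"
  by (rule emeasure_bounded_finite[OF boundedD])

lemma set_measurable:
  fixes f :: "complex^'n \<Rightarrow> 'b::{second_countable_topology, real_normed_vector}"
  assumes "continuous_on D f"
  shows "set_borel_measurable lborel D f"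
  unfolding set_borel_measurable_def
  using borel_measurable_continuous_on_indicator[OF setsD assms] by simp

lemma bergman_holomorphic: "f \<in> bergman_space D \<Longrightarrow> holomorphic_function_on D f"
  and bergman_sq_integrable: "f \<in> bergman_space D \<Longrightarrow> set_integrable lborel D (\<lambda>z. (cmod (f z))\<^sup>2)"
  by (auto simp: bergman_space_def)

lemma bergman_continuous: "f \<in> bergman_space D \<Longrightarrow> continuous_on D f"
  using bergman_holomorphic holomorphic_function_on_continuous by blast

lemma set_integrable_bounded_by:
  fixes f :: "complex^'n \<Rightarrow> 'b::{banach, second_countable_topology}"
  assumes "set_integrable lborel D g" "continuous_on D f" "\<And>z. z \<in> D \<Longrightarrow> norm (f z) \<le> norm (g z :: real)"
  shows "set_integrable lborel D f"
  by (rule set_integrable_bound[OF assms(1) set_measurable[OF assms(2)]]) (use assms(3) in auto)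

lemma bergman_add:
  assumes f: "f \<in> bergman_space D" and g: "g \<in> bergman_space D"
  shows "(\<lambda>z. f z + g z) \<in> bergman_space D"
proof -
  have "set_integrable lborel D (\<lambda>z. 2 * (cmod (f z))\<^sup>2 + 2 * (cmod (g z))\<^sup>2)"
    by (intro set_integral_add set_integrable_mult_right bergman_sq_integrable f g impI)
  then have "set_integrable lborel D (\<lambda>z. (cmod (f z + g z))\<^sup>2)"
  proof (rule set_integrable_bounded_by)
    show "continuous_on D (\<lambda>z. (cmod (f z + g z))\<^sup>2)"
      by (intro continuous_intros bergman_continuous f g)
    fix z
    have "(cmod (f z + g z))\<^sup>2 \<le> (cmod (f z) + cmod (g z))\<^sup>2"
      by (intro power_mono norm_triangle_ineq) auto
    also have "\<dots> \<le> 2 * (cmod (f z))\<^sup>2 + 2 * (cmod (g z))\<^sup>2"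
      using sum_squares_bound[of "cmod (f z)" "cmod (g z)"] by (simp add: power2_sum)
    finally show "norm ((cmod (f z + g z))\<^sup>2) \<le> norm (2 * (cmod (f z))\<^sup>2 + 2 * (cmod (g z))\<^sup>2)" by simp
  qed
  then show ?thesis
    using holomorphic_function_on_add[OF bergman_holomorphic[OF f] bergman_holomorphic[OF g]]
    by (simp add: bergman_space_def)
qed

lemma bergman_smult:
  assumes f: "f \<in> bergman_space D" shows "(\<lambda>z. c * f z) \<in> bergman_space D"
proof -
  have "set_integrable lborel D (\<lambda>z. (cmod c)\<^sup>2 * (cmod (f z))\<^sup>2)"
    by (intro set_integrable_mult_right bergman_sq_integrable f impI)
  then show ?thesis
    using holomorphic_function_on_mult[OF holomorphic_function_on_const bergman_holomorphic[OF f]]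
    by (simp add: bergman_space_def norm_mult power_mult_distrib)
qed

text \<open>\<open>D\<close> has finite volume. This supplies the concrete elements of the Bergman
  space: constants and polynomials.\<close>

lemma bergman_bounded:
  assumes "holomorphic_function_on D f" "\<And>z. z \<in> D \<Longrightarrow> cmod (f z) \<le> M"
  shows "f \<in> bergman_space D"
proof -
  have "set_integrable lborel D (\<lambda>z. M\<^sup>2)"
    unfolding set_integrable_def using emeasureD
    by (intro integrable_scaleR_left integrable_real_indicator) auto
  then have "set_integrable lborel D (\<lambda>z. (cmod (f z))\<^sup>2)"
    by (rule set_integrable_bounded_by)
      (use assms holomorphic_function_on_continuous[OF assms(1)] in \<open>auto intro!: continuous_intros power_mono\<close>)
  then show ?thesis using assms by (simp add: bergman_space_def)
qed

lemma bergman_zero: "(\<lambda>z. 0) \<in> bergman_space D"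
  by (rule bergman_bounded[of _ 0]) (auto simp: holomorphic_function_on_const)

lemma bergman_diff:
  "f \<in> bergman_space D \<Longrightarrow> g \<in> bergman_space D \<Longrightarrow> (\<lambda>z. f z - g z) \<in> bergman_space D"
  using bergman_add[of f "\<lambda>z. -1 * g z"] bergman_smult[of g "-1"] by simp

lemma bergman_sum:
  "(\<And>i. i \<in> A \<Longrightarrow> f i \<in> bergman_space D) \<Longrightarrow> (\<lambda>z. \<Sum>i\<in>A. f i z) \<in> bergman_space D"
  by (induction A rule: infinite_finite_induct) (auto intro: bergman_zero bergman_add)

lemma bergman_product_integrable:
  assumes f: "f \<in> bergman_space D" and g: "g \<in> bergman_space D"
  shows "set_integrable lborel D (\<lambda>z. f z * cnj (g z))"
proof -
  have "set_integrable lborel D (\<lambda>z. (cmod (f z))\<^sup>2 + (cmod (g z))\<^sup>2)"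
    by (intro set_integral_add bergman_sq_integrable f g)
  then show ?thesis
  proof (rule set_integrable_bounded_by)
    show "continuous_on D (\<lambda>z. f z * cnj (g z))"
      by (intro continuous_intros bergman_continuous f g)
    fix z
    have "cmod (f z) * cmod (g z) \<le> (cmod (f z))\<^sup>2 + (cmod (g z))\<^sup>2"
      using sum_squares_bound[of "cmod (f z)" "cmod (g z)"]
        mult_nonneg_nonneg[OF norm_ge_zero[of "f z"] norm_ge_zero[of "g z"]] by linarith
    then show "norm (f z * cnj (g z)) \<le> norm ((cmod (f z))\<^sup>2 + (cmod (g z))\<^sup>2)"
      by (simp add: norm_mult)
  qed
qed

lemma inner_add_left:
  assumes "f \<in> bergman_space D" "g \<in> bergman_space D" "h \<in> bergman_space D"
  shows "bergman_inner D (\<lambda>z. f z + g z) h = bergman_inner D f h + bergman_inner D g h"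
  using set_integral_add(2)[OF bergman_product_integrable[OF assms(1,3)] bergman_product_integrable[OF assms(2,3)]]
  by (simp add: bergman_inner_def distrib_right)

lemma inner_smult_left: "bergman_inner D (\<lambda>z. c * f z) h = c * bergman_inner D f h"
  by (simp add: bergman_inner_def mult.assoc)

lemma inner_zero_left [simp]: "bergman_inner D (\<lambda>z. 0) h = 0"
  by (simp add: bergman_inner_def)

lemma inner_commute: "bergman_inner D g f = cnj (bergman_inner D f g)"
  unfolding bergman_inner_def set_lebesgue_integral_def Bochner_Integration.integral_cnj[symmetric]
  by (rule Bochner_Integration.integral_cong) (simp_all add: mult.commute scaleR_conv_of_real)

lemma inner_diff_left:
  assumes "f \<in> bergman_space D" "g \<in> bergman_space D" "h \<in> bergman_space D"
  shows "bergman_inner D (\<lambda>z. f z - g z) h = bergman_inner D f h - bergman_inner D g h"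
  using inner_add_left[OF assms(1) bergman_smult[OF assms(2), of "-1"] assms(3)]
  by (simp add: inner_smult_left[of "-1", simplified])

lemma inner_sum_left:
  assumes "\<And>i. i \<in> A \<Longrightarrow> f i \<in> bergman_space D" "h \<in> bergman_space D"
  shows "bergman_inner D (\<lambda>z. \<Sum>i\<in>A. f i z) h = (\<Sum>i\<in>A. bergman_inner D (f i) h)"
  using assms(1)
  by (induction A rule: infinite_finite_induct)
    (auto simp: inner_add_left bergman_sum assms(2))

lemma inner_self: "bergman_inner D f f = complex_of_real (norm_sq D f)"
  by (simp add: bergman_inner_def norm_sq_def complex_norm_square[symmetric] set_integral_complex_of_real del: of_real_power)

lemma norm_sq_smult: "norm_sq D (\<lambda>z. c * f z) = (cmod c)\<^sup>2 * norm_sq D f"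
  unfolding norm_sq_def by (simp add: norm_mult power_mult_distrib set_integral_mult_right)

text \<open>Pointwise |a + b|^2 \<le> 2 |a|^2 + 2 |b|^2. It serves as triangle inequality for
  squared norms; the factor 2 is harmless in approximation arguments.\<close>

lemma norm_sq_le_add:
  assumes f: "f \<in> bergman_space D" and g: "g \<in> bergman_space D"
  shows "norm_sq D (\<lambda>z. f z + g z) \<le> 2 * norm_sq D f + 2 * norm_sq D g"
proof -
  have "norm_sq D (\<lambda>z. f z + g z) \<le> (LINT z:D|lborel. 2 * (cmod (f z))\<^sup>2 + 2 * (cmod (g z))\<^sup>2)"
    unfolding norm_sq_def
  proof (rule set_integral_mono)
    show "set_integrable lborel D (\<lambda>z. (cmod (f z + g z))\<^sup>2)"
      using bergman_sq_integrable[OF bergman_add[OF f g]] .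
    show "set_integrable lborel D (\<lambda>z. 2 * (cmod (f z))\<^sup>2 + 2 * (cmod (g z))\<^sup>2)"
      by (intro set_integral_add set_integrable_mult_right bergman_sq_integrable f g impI)
    fix z
    have "(cmod (f z + g z))\<^sup>2 \<le> (cmod (f z) + cmod (g z))\<^sup>2"
      by (intro power_mono norm_triangle_ineq) auto
    also have "\<dots> \<le> 2 * (cmod (f z))\<^sup>2 + 2 * (cmod (g z))\<^sup>2"
      using sum_squares_bound[of "cmod (f z)" "cmod (g z)"] by (simp add: power2_sum)
    finally show "(cmod (f z + g z))\<^sup>2 \<le> 2 * (cmod (f z))\<^sup>2 + 2 * (cmod (g z))\<^sup>2" .
  qed
  also have "\<dots> = 2 * norm_sq D f + 2 * norm_sq D g"
    using f g by (subst set_integral_add)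
      (auto simp: norm_sq_def set_integral_mult_right intro!: set_integrable_mult_right bergman_sq_integrable)
  finally show ?thesis .
qed

section \<open>Boundedness of point evaluations\<close>

lemma evaluation_bound:
  assumes f: "f \<in> bergman_space D" and r: "ball z r \<subseteq> D"
  shows "(cmod (f z))\<^sup>2 * measure lborel (ball (0 :: complex^'n) r) \<le> norm_sq D f"
proof -
  have fin: "emeasure lborel (ball (0 :: complex^'n) r) = ennreal (measure lborel (ball (0 :: complex^'n) r))"
    using emeasure_lborel_ball_finite[of "0 :: complex^'n" r] by (simp add: emeasure_eq_ennreal_measure)
  have "ennreal ((cmod (f z))\<^sup>2) * emeasure lborel (ball (0 :: complex^'n) r)
    \<le> (\<integral>\<^sup>+w. indicator (ball z r) w * ennreal ((cmod (f w))\<^sup>2) \<partial>lborel)"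
    by (rule mean_value_inequality_ball[OF holomorphic_function_on_subset[OF bergman_holomorphic[OF f] r]])
  also have "\<dots> \<le> (\<integral>\<^sup>+w. ennreal (indicator D w *\<^sub>R (cmod (f w))\<^sup>2) \<partial>lborel)"
    by (rule nn_integral_mono) (use r in \<open>auto simp: indicator_def\<close>)
  also have "\<dots> = ennreal (norm_sq D f)"
    unfolding norm_sq_def set_lebesgue_integral_def
    by (rule nn_integral_eq_integral) (use bergman_sq_integrable[OF f] in \<open>auto simp: set_integrable_def\<close>)
  finally have "ennreal ((cmod (f z))\<^sup>2 * measure lborel (ball (0 :: complex^'n) r)) \<le> ennreal (norm_sq D f)"
    by (simp add: fin ennreal_mult')
  then show ?thesis by (simp add: norm_sq_nonneg)
qed

text \<open>Half of the radius is kept in reserve: a ball of one fixed size then fits into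
  \<open>D\<close> around every nearby point, so they all share the constant
  \<open>C\<close>.\<close>

lemma evaluation_bound_uniform:
  assumes "z \<in> D"
  obtains r C where "r > 0" "ball z r \<subseteq> D" "C > 0"
    "\<And>w f. w \<in> ball z r \<Longrightarrow> f \<in> bergman_space D \<Longrightarrow> (cmod (f w))\<^sup>2 \<le> C * norm_sq D f"
proof -
  obtain e where e: "e > 0" "ball z e \<subseteq> D" using openD assms open_contains_ball by blast
  let ?c = "measure lborel (ball (0 :: complex^'n) (e / 2))"
  have c: "?c > 0" using e by simp
  show ?thesis
  proof (rule that[of "e / 2" "1 / ?c"])
    fix w f assume w: "w \<in> ball z (e / 2)" and f: "f \<in> bergman_space D"
    have "ball w (e / 2) \<subseteq> ball z e"
    proof
      fix x assume "x \<in> ball w (e / 2)"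
      then show "x \<in> ball z e" using w dist_triangle[of z x w] by auto
    qed
    then have "(cmod (f w))\<^sup>2 * ?c \<le> norm_sq D f" using e by (intro evaluation_bound[OF f]) auto
    then show "(cmod (f w))\<^sup>2 \<le> 1 / ?c * norm_sq D f" using c by (simp add: field_simps)
  qed (use e c in auto)
qed

lemma norm_sq_orthonormal_combination:
  assumes fin: "finite A" and F: "\<And>j. j \<in> A \<Longrightarrow> F j \<in> bergman_space D"
    and on: "\<And>j k. j \<in> A \<Longrightarrow> k \<in> A \<Longrightarrow> bergman_inner D (F j) (F k) = (if j = k then 1 else 0)"
  shows "norm_sq D (\<lambda>z. \<Sum>j\<in>A. c j * F j z) = (\<Sum>j\<in>A. (cmod (c j))\<^sup>2)"
proof -
  let ?f = "\<lambda>z. \<Sum>j\<in>A. c j * F j z"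
  have f: "?f \<in> bergman_space D" using F by (intro bergman_sum bergman_smult)
  have 1: "bergman_inner D ?f (F k) = c k" if "k \<in> A" for k
  proof -
    have "bergman_inner D ?f (F k) = (\<Sum>j\<in>A. c j * bergman_inner D (F j) (F k))"
      using F that by (subst inner_sum_left) (auto simp: inner_smult_left intro: bergman_smult)
    also have "\<dots> = (\<Sum>j\<in>A. if j = k then c j else 0)" using on that by (intro sum.cong) auto
    finally show ?thesis using fin that by simp
  qed
  have 2: "bergman_inner D (F j) ?f = cnj (c j)" if "j \<in> A" for j
    unfolding inner_commute[where g = "F j" and f = ?f] 1[OF that] ..
  have "complex_of_real (norm_sq D ?f) = bergman_inner D ?f ?f" by (simp add: inner_self)
  also have "\<dots> = (\<Sum>j\<in>A. c j * bergman_inner D (F j) ?f)"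
    using F f by (subst inner_sum_left) (auto simp: inner_smult_left intro: bergman_smult)
  also have "\<dots> = (\<Sum>j\<in>A. c j * cnj (c j))"
    by (intro sum.cong refl) (simp only: 2)
  also have "\<dots> = complex_of_real (\<Sum>j\<in>A. (cmod (c j))\<^sup>2)"
    by (simp add: complex_norm_square del: of_real_power)
  finally show ?thesis by (simp only: of_real_eq_iff)
qed

text \<open>The evaluation bound is tested on the combination with coefficients
  \<open>cnj (F j w)\<close>, a partial sum of the reproducing kernel at \<open>w\<close>. Its value
  at \<open>w\<close> and its squared norm are both the sum S in question, so S^2 \<le> C S. The
  bound does not depend on \<open>A\<close>, which makes the kernel series converge.\<close>

lemma orthonormal_sum_bound:
  assumes fin: "finite A" and F: "\<And>j. j \<in> A \<Longrightarrow> F j \<in> bergman_space D"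
    and on: "\<And>j k. j \<in> A \<Longrightarrow> k \<in> A \<Longrightarrow> bergman_inner D (F j) (F k) = (if j = k then 1 else 0)"
    and C: "\<And>f. f \<in> bergman_space D \<Longrightarrow> (cmod (f w))\<^sup>2 \<le> C * norm_sq D f" "C > 0"
  shows "(\<Sum>j\<in>A. (cmod (F j w))\<^sup>2) \<le> C"
proof -
  let ?S = "\<Sum>j\<in>A. (cmod (F j w))\<^sup>2"
  let ?f = "\<lambda>z. \<Sum>j\<in>A. cnj (F j w) * F j z"
  have f: "?f \<in> bergman_space D" using F by (intro bergman_sum bergman_smult)
  have "?f w = complex_of_real ?S" by (simp add: complex_norm_square mult.commute del: of_real_power)
  then have "?S\<^sup>2 = (cmod (?f w))\<^sup>2" by (simp only: norm_of_real power2_abs)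
  also have "\<dots> \<le> C * norm_sq D ?f" by (rule C(1)[OF f])
  also have "norm_sq D ?f = ?S" using norm_sq_orthonormal_combination[OF fin F on, of "\<lambda>j. cnj (F j w)"] by simp
  finally have "?S * ?S \<le> C * ?S" by (simp add: power2_eq_square)
  show ?thesis
  proof (rule ccontr)
    assume "\<not> ?S \<le> C"
    then have "C < ?S" "0 < ?S" using C(2) by linarith+
    from mult_strict_right_mono[OF this] \<open>?S * ?S \<le> C * ?S\<close> show False by linarith
  qed
qed

end

text \<open>Gaussian elimination: equation \<open>k\<close> is solved for an unknown
  \<open>y\<close> with nonzero coefficient, leaving one equation and one unknown fewer. A rank
  bound is used in this form.\<close>

lemma common_annihilator:
  fixes \<phi> :: "'j \<Rightarrow> 'a \<Rightarrow> complex"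
  assumes "finite J" "finite A" "card A > card J"
  shows "\<exists>a. (\<exists>x\<in>A. a x \<noteq> 0) \<and> (\<forall>j\<in>J. (\<Sum>x\<in>A. a x * \<phi> j x) = 0)"
  using assms
proof (induction J arbitrary: A \<phi> rule: finite_induct)
  case empty
  then have "A \<noteq> {}" by auto
  then show ?case by (intro exI[of _ "\<lambda>_. 1"]) auto
next
  case (insert k J)
  show ?case
  proof (cases "\<forall>x\<in>A. \<phi> k x = 0")
    case True
    then show ?thesis using insert.IH[of A \<phi>] insert.prems insert.hyps by auto
  next
    case False
    then obtain y where y: "y \<in> A" "\<phi> k y \<noteq> 0" by blast
    let ?\<phi> = "\<lambda>j x. \<phi> j x - \<phi> j y / \<phi> k y * \<phi> k x"
    have "card (A - {y}) > card J" using insert.prems insert.hyps y by simp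
    then obtain a where a: "\<exists>x\<in>A - {y}. a x \<noteq> 0" "\<forall>j\<in>J. (\<Sum>x\<in>A - {y}. a x * ?\<phi> j x) = 0"
      using insert.IH[of "A - {y}" ?\<phi>] insert.prems by auto
    define s where "s = (\<Sum>x\<in>A - {y}. a x * \<phi> k x)"
    \<comment> \<open>The value at \<open>y\<close> is the one that solves the eliminated
      equation.\<close>
    define b where "b = a(y := - s / \<phi> k y)"
    have sum_b: "(\<Sum>x\<in>A. b x * \<psi> x) = - s / \<phi> k y * \<psi> y + (\<Sum>x\<in>A - {y}. a x * \<psi> x)" for \<psi>
      using insert.prems(1) y(1) by (simp add: b_def sum.remove)
    have "(\<Sum>x\<in>A. b x * \<phi> j x) = 0" if "j \<in> insert k J" for j
    proof (cases "j = k")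
      case True
      then show ?thesis using y by (simp add: sum_b s_def)
    next
      case False
      then have "(\<Sum>x\<in>A - {y}. a x * ?\<phi> j x) = 0" using a(2) that by blast
      then have "(\<Sum>x\<in>A - {y}. a x * \<phi> j x) = \<phi> j y / \<phi> k y * s"
        by (simp add: s_def right_diff_distrib sum_subtractf sum_distrib_left mult_ac)
      then show ?thesis by (simp add: sum_b)
    qed
    moreover have "\<exists>x\<in>A. b x \<noteq> 0" using a(1) by (auto simp: b_def)
    ultimately show ?thesis by blast
  qed
qed

lemma ex_inj_on_card:
  assumes "infinite (h ` B)"
  shows "\<exists>T\<subseteq>B. finite T \<and> card T = N \<and> inj_on h T"
proof -
  obtain S where S: "S \<subseteq> h ` B" "finite S" "card S = N"
    using infinite_arbitrarily_large[OF assms] by blast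
  then obtain T where T: "T \<subseteq> B" "inj_on h T" "S = h ` T" by (meson subset_image_inj)
  then show ?thesis using S by (metis card_image finite_imageD)
qed

section \<open>Finite combinations of point evaluations\<close>

context bounded_dom
begin

text \<open>A finite combination of evaluations is a bounded functional, with the constant
  \<open>S\<close> of the proof, so vanishing on the \<open>G j\<close> extends to whatever they
  approximate.\<close>

lemma annihilator_closure:
  assumes fin: "finite T" and x: "\<And>t. t \<in> T \<Longrightarrow> x t \<in> D"
    and G: "\<And>j. j \<in> J \<Longrightarrow> G j \<in> bergman_space D" "\<And>j. j \<in> J \<Longrightarrow> (\<Sum>t\<in>T. a t * G j (x t)) = 0"
    and f: "f \<in> bergman_space D"
    and approx: "\<And>\<epsilon>. \<epsilon> > 0 \<Longrightarrow> \<exists>N c. N \<subseteq> J \<and> norm_sq D (\<lambda>z. f z - (\<Sum>j\<in>N. c j * G j z)) < \<epsilon>"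
  shows "(\<Sum>t\<in>T. a t * f (x t)) = 0"
proof -
  have "\<exists>C>0. \<forall>u\<in>bergman_space D. (cmod (u (x t)))\<^sup>2 \<le> C * norm_sq D u" if t: "t \<in> T" for t
  proof -
    from evaluation_bound_uniform[OF x[OF t]] obtain r C where "r > 0" "C > 0"
      and *: "\<And>w f. w \<in> ball (x t) r \<Longrightarrow> f \<in> bergman_space D \<Longrightarrow> (cmod (f w))\<^sup>2 \<le> C * norm_sq D f"
      by metis
    show ?thesis
      by (intro exI[of _ C] conjI ballI *) (use \<open>r > 0\<close> \<open>C > 0\<close> in auto)
  qed
  then obtain C where C: "\<And>t. t \<in> T \<Longrightarrow> C t > 0"
      "\<And>t u. t \<in> T \<Longrightarrow> u \<in> bergman_space D \<Longrightarrow> (cmod (u (x t)))\<^sup>2 \<le> C t * norm_sq D u"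
    by metis
  define S where "S = (\<Sum>t\<in>T. cmod (a t) * sqrt (C t))"
  have S: "S \<ge> 0" unfolding S_def by (intro sum_nonneg mult_nonneg_nonneg) (use C in \<open>auto simp: less_imp_le\<close>)
  have bound: "cmod (\<Sum>t\<in>T. a t * u (x t)) \<le> S * sqrt (norm_sq D u)" if u: "u \<in> bergman_space D" for u
  proof -
    have "cmod (\<Sum>t\<in>T. a t * u (x t)) \<le> (\<Sum>t\<in>T. cmod (a t) * cmod (u (x t)))"
      by (rule order_trans[OF norm_sum]) (simp add: norm_mult)
    also have "\<dots> \<le> (\<Sum>t\<in>T. cmod (a t) * (sqrt (C t) * sqrt (norm_sq D u)))"
      by (intro sum_mono mult_left_mono) (use C(2)[OF _ u] in \<open>auto simp flip: real_sqrt_mult intro!: real_le_rsqrt\<close>)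
    also have "\<dots> = S * sqrt (norm_sq D u)" by (simp add: S_def sum_distrib_right mult.assoc)
    finally show ?thesis .
  qed
  have small: "cmod (\<Sum>t\<in>T. a t * f (x t)) \<le> S * sqrt \<epsilon>" if \<epsilon>: "\<epsilon> > 0" for \<epsilon>
  proof -
    obtain N c where N: "N \<subseteq> J" and c: "norm_sq D (\<lambda>z. f z - (\<Sum>j\<in>N. c j * G j z)) < \<epsilon>"
      using approx[OF \<epsilon>] by blast
    let ?u = "\<lambda>z. f z - (\<Sum>j\<in>N. c j * G j z)"
    have u: "?u \<in> bergman_space D"
      using N G(1) by (intro bergman_diff f bergman_sum bergman_smult) auto
    have "(\<Sum>t\<in>T. a t * (\<Sum>j\<in>N. c j * G j (x t))) = (\<Sum>j\<in>N. c j * (\<Sum>t\<in>T. a t * G j (x t)))"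
      unfolding sum_distrib_left by (subst sum.swap) (simp add: mult_ac)
    also have "\<dots> = 0" using N G(2) by (intro sum.neutral) auto
    finally have "(\<Sum>t\<in>T. a t * f (x t)) = (\<Sum>t\<in>T. a t * ?u (x t))"
      by (simp add: right_diff_distrib sum_subtractf)
    then have "cmod (\<Sum>t\<in>T. a t * f (x t)) \<le> S * sqrt (norm_sq D ?u)" using bound[OF u] by simp
    also have "\<dots> \<le> S * sqrt \<epsilon>" using c S by (intro mult_left_mono) auto
    finally show ?thesis .
  qed
  have "cmod (\<Sum>t\<in>T. a t * f (x t)) \<le> 0"
  proof (rule field_le_epsilon)
    fix e :: real assume e: "e > 0"
    \<comment> \<open>The \<epsilon> for \<open>small\<close> is the square of e / (S + 1), which
      makes S * sqrt \<epsilon> at most e; the \<open>+ 1\<close> covers S = 0.\<close>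
    have "sqrt ((e / (S + 1))\<^sup>2) = e / (S + 1)" unfolding real_sqrt_abs using S e by simp
    then have "S * sqrt ((e / (S + 1))\<^sup>2) = S * (e / (S + 1))" by (simp only:)
    also have "\<dots> \<le> e" using S e by (simp add: field_simps)
    finally have "S * sqrt ((e / (S + 1))\<^sup>2) \<le> e" .
    moreover have "(e / (S + 1))\<^sup>2 > 0" using S e by simp
    ultimately show "cmod (\<Sum>t\<in>T. a t * f (x t)) \<le> 0 + e"
      using small[of "(e / (S + 1))\<^sup>2"] by linarith
  qed
  then show ?thesis by simp
qed

text \<open>An unnormalized Lagrange polynomial in the coordinate \<open>i\<close> kills every
  summand except the one at \<open>t0\<close>. On the bounded set \<open>D\<close> it is bounded,
  hence square-integrable.\<close>

lemma bergman_separates_points: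
  fixes x :: "'t \<Rightarrow> complex^'n"
  assumes fin: "finite T" and x: "\<And>t. t \<in> T \<Longrightarrow> x t \<in> D" and inj: "inj_on (\<lambda>t. x t $ i) T"
    and a: "t0 \<in> T" "a t0 \<noteq> 0"
  shows "\<exists>f\<in>bergman_space D. (\<Sum>t\<in>T. a t * f (x t)) \<noteq> 0"
proof
  let ?f = "\<lambda>z :: complex^'n. \<Prod>t\<in>T - {t0}. z $ i - x t $ i"
  have "(\<Sum>t\<in>T. a t * ?f (x t)) = a t0 * ?f (x t0) + (\<Sum>t\<in>T - {t0}. a t * ?f (x t))"
    using fin a by (simp add: sum.remove)
  also have "(\<Sum>t\<in>T - {t0}. a t * ?f (x t)) = 0"
    using fin by (intro sum.neutral) auto
  finally have "(\<Sum>t\<in>T. a t * ?f (x t)) = a t0 * ?f (x t0)" by simp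
  moreover have "?f (x t0) \<noteq> 0" using inj a fin by (auto simp: inj_on_def)
  ultimately show "(\<Sum>t\<in>T. a t * ?f (x t)) \<noteq> 0" using a by simp
  have hol: "holomorphic_function_on S ?f" for S
    by (intro holomorphic_function_on_prod holomorphic_function_on_minus
        holomorphic_function_on_nth holomorphic_function_on_const)
  have "compact (?f ` closure D)"
    using boundedD holomorphic_function_on_continuous[OF hol]
    by (intro compact_continuous_image) (auto simp: compact_closure)
  then obtain M where "\<forall>y\<in>?f ` closure D. cmod y \<le> M" using compact_imp_bounded bounded_iff by blast
  then show "?f \<in> bergman_space D"
    using closure_subset[of D] by (intro bergman_bounded[OF hol, of M]) blast
qed

text \<open>Take one more point on a complex line than there are functions \<open>G j\<close>: some
  combination of evaluations kills all \<open>G j\<close> but not the whole space. This infinite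
  dimensionality later keeps Gram-Schmidt from running dry.\<close>

lemma bergman_not_finitely_approximable:
  assumes fin: "finite J" and G: "\<And>j. j \<in> J \<Longrightarrow> G j \<in> bergman_space D"
  shows "\<exists>f\<in>bergman_space D. \<exists>\<epsilon>>0. \<forall>c. norm_sq D (\<lambda>z. f z - (\<Sum>j\<in>J. c j * G j z)) \<ge> \<epsilon>"
proof (rule ccontr)
  assume "\<not> ?thesis"
  then have approx: "\<exists>c. norm_sq D (\<lambda>z. f z - (\<Sum>j\<in>J. c j * G j z)) < \<epsilon>" if "f \<in> bergman_space D" "\<epsilon> > 0" for f \<epsilon>
    using that by (meson not_le)
  obtain z r where z: "r > 0" "ball z r \<subseteq> D" using nonemptyD openD open_contains_ball by blast
  fix i :: 'n
  define x where "x t = z + t *s axis i 1" for t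
  have x: "x t \<in> D" if "t \<in> ball 0 r" for t
    using that z by (auto simp: x_def dist_norm norm_vector_smult norm_eq_sqrt_inner[of "axis i 1"] inner_axis_axis)
  have h: "inj (\<lambda>t. x t $ i)" by (rule injI) (simp add: x_def)
  have "uncountable (ball (0::complex) r)" using z by (simp add: uncountable_ball)
  then have "infinite ((\<lambda>t. x t $ i) ` ball 0 r)"
    using h by (metis countable_finite finite_imageD inj_on_subset subset_UNIV)
  then obtain T where T: "T \<subseteq> ball 0 r" "finite T" "card T = card J + 1" "inj_on (\<lambda>t. x t $ i) T"
    using ex_inj_on_card by blast
  obtain a where a: "\<exists>t\<in>T. a t \<noteq> 0" "\<forall>j\<in>J. (\<Sum>t\<in>T. a t * G j (x t)) = 0"
    using common_annihilator[OF fin T(2), of "\<lambda>j t. G j (x t)"] T(3) by auto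
  then obtain t0 where t0: "t0 \<in> T" "a t0 \<noteq> 0" by blast
  have xT: "x t \<in> D" if "t \<in> T" for t using x T(1) that by blast
  obtain f where f: "f \<in> bergman_space D" "(\<Sum>t\<in>T. a t * f (x t)) \<noteq> 0"
    using bergman_separates_points[where x = x and a = a, OF T(2) xT T(4) t0] by blast
  have "(\<Sum>t\<in>T. a t * f (x t)) = 0"
    by (rule annihilator_closure[where x = x and a = a, OF T(2) xT G _ f(1)])
      (use a(2) approx[OF f(1)] in blast)+
  with f(2) show False by simp
qed

text \<open>A function is encoded up to a small error by a compact set carrying most of its mass, a
  modulus of continuity there, and its rounded values on a finite net. There are countably many codes,
  and one function is chosen for each.\<close>

lemma bergman_separable:
  "\<exists>d :: nat \<Rightarrow> complex^'n \<Rightarrow> complex. (\<forall>n. d n \<in> bergman_space D) \<and>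
    (\<forall>f\<in>bergman_space D. \<forall>\<epsilon>>0. \<exists>n. norm_sq D (\<lambda>z. f z - d n z) < \<epsilon>)"
proof -
  obtain K where K: "\<And>n::nat. compact (K n)" "\<And>n. K n \<subseteq> D" "\<And>n. K n \<subseteq> interior (K (Suc n))" "\<Union>(range K) = D"
    using open_Union_compact_subsets[OF openD] by metis
  define tail where "tail f n = (LINT z:(D - K n)|lborel. (cmod (f z))\<^sup>2)" for f :: "complex^'n \<Rightarrow> complex" and n
  have Kb[measurable]: "K n \<in> sets borel" for n using K(1) compact_imp_closed borel_closed by blast
  have sub: "set_integrable lborel A (\<lambda>z. (cmod (f z))\<^sup>2)"
    if "f \<in> bergman_space D" "A \<subseteq> D" "A \<in> sets borel" for f A
    using set_integrable_subset[OF bergman_sq_integrable[OF that(1)]] that by simp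
  have tail: "(\<lambda>n. tail f n) \<longlonglongrightarrow> 0" if f: "f \<in> bergman_space D" for f
  proof -
    have "(\<lambda>n. tail f n) \<longlonglongrightarrow> (LINT z:(\<Inter>n. D - K n)|lborel. (cmod (f z))\<^sup>2)"
      unfolding tail_def
    proof (rule set_integral_cont_down)
      show "decseq (\<lambda>n. D - K n)"
        using K(3) interior_subset by (intro decseq_SucI) blast
      show "set_integrable lborel (D - K 0) (\<lambda>z. (cmod (f z))\<^sup>2)" by (rule sub[OF f]) auto
    qed simp
    also have "(\<Inter>n. D - K n) = {}" using K(4) by blast
    finally show ?thesis by (simp add: set_lebesgue_integral_def)
  qed
  have "\<exists>L. set L \<subseteq> K j \<and> K j \<subseteq> (\<Union>y\<in>set L. ball y (1 / real (Suc k)))" for j k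
  proof -
    obtain C where "C \<subseteq> K j" "finite C" "K j \<subseteq> (\<Union>y\<in>C. ball y (1 / real (Suc k)))"
      using compactE_image[OF K(1)[of j], of "K j" "\<lambda>y. ball y (1 / real (Suc k))"] by force
    then show ?thesis using finite_list by metis
  qed
  then obtain L where L: "\<And>j k. set (L j k) \<subseteq> K j" "\<And>j k. K j \<subseteq> (\<Union>y\<in>set (L j k). ball y (1 / real (Suc k)))"
    by metis
  define e where "e q = 1 / real (Suc q)" for q
  define vals where "vals q f y = (\<lfloor>Re (f y) / e q\<rfloor>, \<lfloor>Im (f y) / e q\<rfloor>)" for q and f :: "complex^'n \<Rightarrow> complex" and y
  define R where "R q c f \<longleftrightarrow> (case c of (j, k, vs) \<Rightarrow> tail f j < e q \<and>
    (\<forall>x\<in>K j. \<forall>y\<in>K j. dist x y < 1 / real (Suc k) \<longrightarrow> cmod (f x - f y) < e q) \<and> vs = map (vals q f) (L j k))"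
    for q :: nat and c :: "nat \<times> nat \<times> (int \<times> int) list" and f
  have e: "e q > 0" "e q \<le> 1" for q by (auto simp: e_def)
  define \<mu> where "\<mu> = measure lborel D"
  have ex: "\<exists>c. R q c f" if f: "f \<in> bergman_space D" for q f
  proof -
    obtain j where j: "tail f j < e q"
      using order_tendstoD(2)[OF tail[OF f] e(1)[of q]] by (auto simp: eventually_sequentially)
    have "uniformly_continuous_on (K j) f"
      using K(1,2) bergman_continuous[OF f] by (intro compact_uniformly_continuous) (auto intro: continuous_on_subset)
    then obtain d where d: "d > 0" "\<forall>x\<in>K j. \<forall>y\<in>K j. dist y x < d \<longrightarrow> dist (f y) (f x) < e q"
      using e(1)[of q] unfolding uniformly_continuous_on_def by meson
    obtain k where "1 / real (Suc k) < d" using nat_approx_posE[OF d(1)] by metis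
    then have "R q (j, k, map (vals q f) (L j k)) f"
      using j d(2) by (force simp: R_def dist_norm)
    then show ?thesis by blast
  qed
  \<comment> \<open>With e for \<open>e q\<close>: off \<open>K j\<close> the tails give 2 e + 2 e.
    On \<open>K j\<close> the difference is at most 4 e, namely 2 e from the moduli of continuity
    near a net point and 2 e from rounding real and imaginary parts; its square is at most 16 e
    because e \<le> 1.\<close>
  have close: "norm_sq D (\<lambda>z. f z - g z) \<le> e q * (4 + 16 * \<mu>)"
    if f: "f \<in> bergman_space D" and g: "g \<in> bergman_space D" and Rf: "R q c f" and Rg: "R q c g" for q c f g
  proof -
    obtain j k vs where c: "c = (j, k, vs)" by (cases c)
    have near: "cmod (f x - g x) \<le> 4 * e q" if x: "x \<in> K j" for x
    proof -
      obtain y where y: "y \<in> set (L j k)" "dist y x < 1 / real (Suc k)" using L(2)[of j k] x by auto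
      have yK: "y \<in> K j" using L(1) y by blast
      have v: "vals q f y = vals q g y" using Rf Rg y(1) by (auto simp: R_def c)
      have fl: "\<bar>u - w\<bar> \<le> e q" if "\<lfloor>u / e q\<rfloor> = \<lfloor>w / e q\<rfloor>" for u w
      proof -
        have "\<bar>u / e q - w / e q\<bar> \<le> 1" using that by linarith
        then show ?thesis using e(1)[of q] by (simp add: abs_le_iff field_simps)
      qed
      have "cmod (f y - g y) \<le> \<bar>Re (f y) - Re (g y)\<bar> + \<bar>Im (f y) - Im (g y)\<bar>"
        using cmod_le[of "f y - g y"] by simp
      also have "\<dots> \<le> e q + e q" using v by (intro add_mono fl) (auto simp: vals_def)
      finally have 1: "cmod (f y - g y) \<le> e q + e q" .
      have "cmod (f x - f y) < e q" "cmod (g x - g y) < e q"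
        using Rf Rg x yK y(2) by (auto simp: R_def c dist_commute)
      then show ?thesis
        using 1 norm_le_triangle3[of "f x" "g x" "f y" "g y"] by (simp add: norm_minus_commute)
    qed
    let ?h = "\<lambda>z. (cmod (f z - g z))\<^sup>2"
    have h: "set_integrable lborel A ?h" if "A \<subseteq> D" "A \<in> sets borel" for A
      using sub[OF bergman_diff[OF f g] that] .
    have "norm_sq D (\<lambda>z. f z - g z) = (LINT z:(D - K j) \<union> K j|lborel. ?h z)"
      unfolding norm_sq_def
      by (rule arg_cong[where f = "\<lambda>A. LINT z:A|lborel. ?h z"]) (use K(2)[of j] in blast)
    also have "\<dots> = (LINT z:(D - K j)|lborel. ?h z) + (LINT z:K j|lborel. ?h z)"
      by (rule set_integral_Un) (use K(2)[of j] in \<open>auto intro!: h\<close>)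
    also have "(LINT z:(D - K j)|lborel. ?h z) \<le> (LINT z:(D - K j)|lborel. 2 * (cmod (f z))\<^sup>2 + 2 * (cmod (g z))\<^sup>2)"
    proof (rule set_integral_mono)
      show "set_integrable lborel (D - K j) ?h" by (rule h) auto
      show "set_integrable lborel (D - K j) (\<lambda>z. 2 * (cmod (f z))\<^sup>2 + 2 * (cmod (g z))\<^sup>2)"
        by (intro set_integral_add set_integrable_mult_right sub f g impI) auto
      fix z
      have "(cmod (f z - g z))\<^sup>2 \<le> (cmod (f z) + cmod (g z))\<^sup>2"
        by (intro power_mono norm_triangle_ineq4) auto
      also have "\<dots> \<le> 2 * (cmod (f z))\<^sup>2 + 2 * (cmod (g z))\<^sup>2"
        using sum_squares_bound[of "cmod (f z)" "cmod (g z)"] by (simp add: power2_sum)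
      finally show "?h z \<le> 2 * (cmod (f z))\<^sup>2 + 2 * (cmod (g z))\<^sup>2" .
    qed
    also have "\<dots> = 2 * tail f j + 2 * tail g j"
      unfolding tail_def by (subst set_integral_add) (auto intro!: set_integrable_mult_right sub f g)
    also have "\<dots> \<le> 4 * e q" using Rf Rg by (auto simp: R_def c)
    also have "(LINT z:K j|lborel. ?h z) \<le> (LINT z:K j|lborel. 16 * e q)"
    proof (rule set_integral_mono)
      show "set_integrable lborel (K j) ?h" using K(2) by (intro h) auto
      show "set_integrable lborel (K j) (\<lambda>z. 16 * e q)"
        unfolding set_integrable_def using emeasure_bounded_finite[OF compact_imp_bounded[OF K(1)[of j]]]
        by (intro integrable_scaleR_left integrable_real_indicator) auto
      fix z assume "z \<in> K j"
      then have "?h z \<le> (4 * e q)\<^sup>2" by (intro power_mono near) auto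
      also have "\<dots> = 16 * (e q * e q)" by (simp add: power2_eq_square)
      also have "\<dots> \<le> 16 * e q" using e[of q] mult_left_le by simp
      finally show "?h z \<le> 16 * e q" .
    qed
    also have "\<dots> = 16 * e q * measure lborel (K j)"
      by (simp add: set_lebesgue_integral_def)
    also have "\<dots> \<le> 16 * e q * \<mu>"
      unfolding \<mu>_def using e[of q] K(2) emeasureD
      by (intro mult_left_mono measure_mono_fmeasurable) (auto simp: fmeasurable_def)
    finally show ?thesis by (simp add: algebra_simps)
  qed
  \<comment> \<open>The choice depends on the code alone, so one countable family serves every
    \<open>f\<close>. Codes that belong to no function get 0, which keeps \<open>d\<close> inside
    the Bergman space.\<close>
  define d where "d n = (let (q, c) = from_nat n in
    if \<exists>f\<in>bergman_space D. R q c f then SOME f. f \<in> bergman_space D \<and> R q c f else (\<lambda>z. 0))" for n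
  have dR: "f \<in> bergman_space D \<Longrightarrow> R q c f \<Longrightarrow> d (to_nat (q, c)) \<in> bergman_space D \<and> R q c (d (to_nat (q, c)))" for q c f
    unfolding d_def by (simp add: Let_def) (metis (mono_tags, lifting) someI_ex)
  have "d n \<in> bergman_space D" for n
  proof -
    obtain q c where Pair: "(from_nat n :: nat \<times> nat \<times> nat \<times> (int \<times> int) list) = (q, c)"
      by (rule prod.exhaust)
    show ?thesis
    proof (cases "\<exists>f\<in>bergman_space D. R q c f")
      case True
      then have "\<exists>f. f \<in> bergman_space D \<and> R q c f" by blast
      from someI_ex[OF this] show ?thesis using True by (simp add: d_def Pair)
    qed (use bergman_zero in \<open>simp add: d_def Pair\<close>)
  qed
  moreover have "\<exists>n. norm_sq D (\<lambda>z. f z - d n z) < \<epsilon>" if f: "f \<in> bergman_space D" and \<epsilon>: "\<epsilon> > 0" for f \<epsilon>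
  proof -
    have \<mu>: "\<mu> \<ge> 0" by (simp add: \<mu>_def)
    then obtain q where q: "1 / real (Suc q) < \<epsilon> / (4 + 16 * \<mu>)"
      using nat_approx_posE[of "\<epsilon> / (4 + 16 * \<mu>)"] \<epsilon> by (metis add_pos_nonneg divide_pos_pos mult_nonneg_nonneg zero_le_numeral zero_less_numeral)
    obtain c where c: "R q c f" using ex[OF f] by blast
    have "norm_sq D (\<lambda>z. f z - d (to_nat (q, c)) z) \<le> e q * (4 + 16 * \<mu>)"
      using dR[OF f c] by (intro close[OF f _ c]) auto
    also have "\<dots> < \<epsilon>" using q \<mu> by (simp add: e_def field_simps)
    finally show ?thesis by blast
  qed
  ultimately show ?thesis by blast
qed

end

section \<open>The Bergman kernel\<close>

text \<open>Linearly dependent steps produce the zero function; these are removed by enumerating the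
  other indices.\<close>

definition normalized :: "(complex^'n::finite) set \<Rightarrow> (complex^'n \<Rightarrow> complex) \<Rightarrow> complex^'n \<Rightarrow> complex" where
  "normalized D r = (if norm_sq D r = 0 then (\<lambda>z. 0) else (\<lambda>z. complex_of_real (1 / sqrt (norm_sq D r)) * r z))"

context
  notes sum.cong [fundef_cong]
begin

fun gram_schmidt :: "(complex^'n::finite) set \<Rightarrow> (nat \<Rightarrow> complex^'n \<Rightarrow> complex) \<Rightarrow> nat \<Rightarrow> complex^'n \<Rightarrow> complex" where
  "gram_schmidt D d n = normalized D (\<lambda>z. d n z -
     (\<Sum>i<n. bergman_inner D (d n) (gram_schmidt D d i) * gram_schmidt D d i z))"

end

declare gram_schmidt.simps [simp del]

section \<open>Orthonormal bases from Gram-Schmidt\<close>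

context bounded_dom
begin

lemma norm_sq_zero: "norm_sq D (\<lambda>z. 0) = 0"
  by (simp add: norm_sq_def)

text \<open>Functions are determined by the norm only on \<open>D\<close>, so that
  \<open>d n\<close> lies in the span is expressed by a residual with zero \<open>norm_sq\<close>. A
  step yields a unit vector, or the zero function when \<open>d n\<close> is dependent on its
  predecessors.\<close>

lemma gram_schmidt_step:
  fixes d :: "nat \<Rightarrow> complex^'n \<Rightarrow> complex"
  assumes d: "\<And>n. d n \<in> bergman_space D"
  defines "e \<equiv> gram_schmidt D d"
  shows "e n \<in> bergman_space D \<and> (\<forall>i<n. bergman_inner D (e n) (e i) = 0) \<and>
    (e n = (\<lambda>z. 0) \<or> norm_sq D (e n) = 1) \<and> (\<exists>c. norm_sq D (\<lambda>z. d n z - (\<Sum>i\<le>n. c i * e i z)) = 0)"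
proof (induction n rule: less_induct)
  case (less n)
  have eH: "e i \<in> bergman_space D" if "i < n" for i using less.IH[OF that] by blast
  define p where "p z = (\<Sum>i<n. bergman_inner D (d n) (e i) * e i z)" for z
  define r where "r z = d n z - p z" for z
  have en: "e n = normalized D r"
    unfolding r_def p_def e_def by (subst gram_schmidt.simps) simp
  have p: "p \<in> bergman_space D" unfolding p_def by (intro bergman_sum bergman_smult eH) simp
  have r: "r \<in> bergman_space D" unfolding r_def by (intro bergman_diff d p)
  have orth: "bergman_inner D (e i) (e j) = (if i = j \<and> e i \<noteq> (\<lambda>z. 0) then 1 else 0)" if "i < n" "j < n" for i j
  proof (cases i j rule: linorder_cases)
    case less
    then have "bergman_inner D (e j) (e i) = 0" using less.IH[OF that(2)] by blast
    then show ?thesis using less by (subst inner_commute) simp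
  next
    case equal
    then show ?thesis using less.IH[OF that(1)] by (auto simp: inner_self norm_sq_zero)
  next
    case greater
    then show ?thesis using less.IH[OF that(1)] by auto
  qed
  have r_orth: "bergman_inner D r (e j) = 0" if j: "j < n" for j
  proof -
    have "bergman_inner D p (e j) = (\<Sum>i<n. bergman_inner D (d n) (e i) * bergman_inner D (e i) (e j))"
      unfolding p_def using j eH by (subst inner_sum_left) (auto simp: inner_smult_left intro: bergman_smult)
    also have "\<dots> = (\<Sum>i<n. if i = j then bergman_inner D (d n) (e j) else 0)"
    proof (intro sum.cong refl)
      fix i assume i: "i \<in> {..<n}"
      \<comment> \<open>If \<open>e j\<close> is the zero function, \<open>orth\<close> gives 0 on
        the diagonal, but then the coefficient vanishes too, so the formula for the summand still
        holds.\<close>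
      have "bergman_inner D (d n) (\<lambda>z. 0) = 0" by (subst inner_commute) simp
      then show "bergman_inner D (d n) (e i) * bergman_inner D (e i) (e j) = (if i = j then bergman_inner D (d n) (e j) else 0)"
        using orth[of i j] i j by auto
    qed
    also have "\<dots> = bergman_inner D (d n) (e j)" using j by simp
    finally show ?thesis unfolding r_def using inner_diff_left[OF d p eH[OF j]] by simp
  qed
  show ?case
  proof (cases "norm_sq D r = 0")
    case True
    then have z: "e n = (\<lambda>z. 0)" by (simp add: en normalized_def)
    let ?c = "\<lambda>i. bergman_inner D (d n) (e i)"
    have "(\<lambda>z. d n z - (\<Sum>i\<le>n. ?c i * e i z)) = r"
      by (simp add: r_def p_def fun_eq_iff lessThan_Suc_atMost[symmetric] z)
    then have "norm_sq D (\<lambda>z. d n z - (\<Sum>i\<le>n. ?c i * e i z)) = 0" using True by simp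
    then show ?thesis using z bergman_zero by auto
  next
    case False
    let ?s = "complex_of_real (1 / sqrt (norm_sq D r))"
    have e: "e n = (\<lambda>z. ?s * r z)" using False by (simp add: en normalized_def)
    have pos: "norm_sq D r > 0" using False norm_sq_nonneg[of D r] by linarith
    have mem: "e n \<in> bergman_space D" unfolding e by (intro bergman_smult r)
    have "norm_sq D (e n) = (cmod ?s)\<^sup>2 * norm_sq D r" unfolding e by (rule norm_sq_smult)
    also have "\<dots> = 1" using pos by (simp add: norm_divide power_divide)
    finally have one: "norm_sq D (e n) = 1" .
    have o: "bergman_inner D (e n) (e i) = 0" if "i < n" for i
      unfolding e inner_smult_left using r_orth[OF that] by simp
    \<comment> \<open>The coefficient at n undoes the normalization of \<open>r\<close>.\<close>
    let ?c = "\<lambda>i. if i < n then bergman_inner D (d n) (e i) else complex_of_real (sqrt (norm_sq D r))"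
    have "(\<lambda>z. d n z - (\<Sum>i\<le>n. ?c i * e i z)) = (\<lambda>z. 0)"
    proof
      fix z
      have "(\<Sum>i\<le>n. ?c i * e i z) = p z + complex_of_real (sqrt (norm_sq D r)) * e n z"
        by (simp add: lessThan_Suc_atMost[symmetric] p_def)
      also have "complex_of_real (sqrt (norm_sq D r)) * e n z = r z" using pos by (simp add: e)
      finally show "d n z - (\<Sum>i\<le>n. ?c i * e i z) = 0" by (simp add: r_def)
    qed
    then have "norm_sq D (\<lambda>z. d n z - (\<Sum>i\<le>n. ?c i * e i z)) = 0" by (simp add: norm_sq_def)
    from exI[of "\<lambda>c. norm_sq D (\<lambda>z. d n z - (\<Sum>i\<le>n. c i * e i z)) = 0", OF this]
    show ?thesis using mem one o by simp
  qed
qed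

text \<open>Without existence nothing could be said about the \<open>SOME\<close> in
  \<open>bergman_kernel_diag\<close>. The nonzero Gram-Schmidt vectors of a countable dense family
  form the basis.\<close>

lemma bergman_basis_exists: "\<exists>F. bergman_basis D F"
proof -
  obtain d :: "nat \<Rightarrow> complex^'n \<Rightarrow> complex" where "(\<forall>n. d n \<in> bergman_space D) \<and>
    (\<forall>f\<in>bergman_space D. \<forall>\<epsilon>>0. \<exists>n. norm_sq D (\<lambda>z. f z - d n z) < \<epsilon>)"
    using bergman_separable by (rule exE)
  then have d: "\<And>n. d n \<in> bergman_space D"
    and dense: "\<And>f \<epsilon>. f \<in> bergman_space D \<Longrightarrow> \<epsilon> > 0 \<Longrightarrow> \<exists>n. norm_sq D (\<lambda>z. f z - d n z) < \<epsilon>"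
    by simp_all
  define e where "e = gram_schmidt D d"
  note step = gram_schmidt_step[where d = d, OF d, folded e_def]
  have eH: "e n \<in> bergman_space D" and orth: "\<And>i. i < n \<Longrightarrow> bergman_inner D (e n) (e i) = 0"
    and norm: "e n = (\<lambda>z. 0) \<or> norm_sq D (e n) = 1" for n
    using step[of n] by simp_all
  have approx: "\<exists>c. norm_sq D (\<lambda>z. d n z - (\<Sum>i\<le>n. c i * e i z)) = 0" for n
    using step[of n] by (elim conjE)
  define I where "I = {n. e n \<noteq> (\<lambda>z. 0)}"
  have span: "\<exists>n c. norm_sq D (\<lambda>z. f z - (\<Sum>i\<in>{..n} \<inter> I. c i * e i z)) < \<epsilon>"
    if f: "f \<in> bergman_space D" and \<epsilon>: "\<epsilon> > 0" for f \<epsilon>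
  proof -
    obtain n where n: "norm_sq D (\<lambda>z. f z - d n z) < \<epsilon> / 2" using dense[OF f] \<epsilon> by (meson half_gt_zero)
    obtain c where c: "norm_sq D (\<lambda>z. d n z - (\<Sum>i\<le>n. c i * e i z)) = 0" using approx[of n] by (rule exE)
    have s: "(\<Sum>i\<le>n. c i * e i z) = (\<Sum>i\<in>{..n} \<inter> I. c i * e i z)" for z
      by (rule sum.mono_neutral_right) (auto simp: I_def)
    have "norm_sq D (\<lambda>z. (f z - d n z) + (d n z - (\<Sum>i\<le>n. c i * e i z)))
        \<le> 2 * norm_sq D (\<lambda>z. f z - d n z) + 2 * norm_sq D (\<lambda>z. d n z - (\<Sum>i\<le>n. c i * e i z))"
      by (intro norm_sq_le_add bergman_diff f d bergman_sum bergman_smult eH)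
    then have "norm_sq D (\<lambda>z. f z - (\<Sum>i\<in>{..n} \<inter> I. c i * e i z)) < \<epsilon>" using n c by (simp add: s)
    then show ?thesis by blast
  qed
  \<comment> \<open>\<open>bergman_basis\<close> asks for a sequence, so infinitely many vectors
    have to survive; otherwise the finitely many survivors would approximate the whole
    space.\<close>
  have inf: "infinite I"
  proof
    assume fin: "finite I"
    obtain f \<epsilon> where f: "f \<in> bergman_space D" and \<epsilon>: "\<epsilon> > 0"
      "\<And>c. norm_sq D (\<lambda>z. f z - (\<Sum>j\<in>I. c j * e j z)) \<ge> \<epsilon>"
      using bergman_not_finitely_approximable[OF fin, of e] eH by blast
    obtain n c where nc: "norm_sq D (\<lambda>z. f z - (\<Sum>i\<in>{..n} \<inter> I. c i * e i z)) < \<epsilon>" using span[OF f \<epsilon>(1)] by blast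
    have "(\<Sum>i\<in>{..n} \<inter> I. c i * e i z) = (\<Sum>i\<in>I. (if i \<le> n then c i else 0) * e i z)" for z
      using fin by (intro sum.mono_neutral_cong_left) auto
    then show False using nc \<epsilon>(2)[of "\<lambda>i. if i \<le> n then c i else 0"] by simp
  qed
  define F where "F j = e (enumerate I j)" for j
  have mono: "strict_mono (enumerate I)" using strict_mono_enumerate[OF inf] .
  have inI: "enumerate I j \<in> I" for j using enumerate_in_set[OF inf] .
  have "bergman_inner D (F j) (F k) = (if j = k then 1 else 0)" for j k
  proof (cases j k rule: linorder_cases)
    case less
    then have "bergman_inner D (F k) (F j) = 0"
      unfolding F_def by (intro orth) (simp add: mono strict_mono_less)
    then show ?thesis using less by (subst inner_commute) simp
  next
    case equal
    then show ?thesis using norm[of "enumerate I j"] inI[of j] by (auto simp: F_def inner_self I_def)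
  next
    case greater
    then show ?thesis unfolding F_def by (auto intro!: orth simp: mono strict_mono_less)
  qed
  moreover have "\<exists>N c. bergman_norm D (\<lambda>z. f z - (\<Sum>j<N. c j * F j z)) < \<epsilon>"
    if f: "f \<in> bergman_space D" and \<epsilon>: "\<epsilon> > 0" for f \<epsilon>
  proof -
    obtain n c where nc: "norm_sq D (\<lambda>z. f z - (\<Sum>i\<in>{..n} \<inter> I. c i * e i z)) < \<epsilon>\<^sup>2"
      using span[OF f, of "\<epsilon>\<^sup>2"] \<epsilon> by auto
    \<comment> \<open>Terms with \<open>enumerate I j > n\<close> get coefficient 0; since
      \<open>j \<le> enumerate I j\<close>, all others occur among the first
      \<open>Suc n\<close>.\<close>
    let ?c = "\<lambda>j. if enumerate I j \<le> n then c (enumerate I j) else 0"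
    have "(\<Sum>j<Suc n. ?c j * F j z) = (\<Sum>i\<in>{..n} \<inter> I. c i * e i z)" for z
    proof -
      have "(\<Sum>j<Suc n. ?c j * F j z) = (\<Sum>j\<in>{j. enumerate I j \<le> n}. c (enumerate I j) * e (enumerate I j) z)"
        by (rule sum.mono_neutral_cong_right)
          (auto simp: F_def less_Suc_eq_le intro: order_trans[OF le_enumerate[OF inf]])
      also have "\<dots> = (\<Sum>i\<in>enumerate I ` {j. enumerate I j \<le> n}. c i * e i z)"
        using strict_mono_imp_inj_on[OF mono] by (subst sum.reindex) (auto intro: inj_on_subset)
      also have "enumerate I ` {j. enumerate I j \<le> n} = {..n} \<inter> I"
        using inI enumerate_Ex[OF inf] by (auto simp: image_iff)
      finally show ?thesis .
    qed
    then have "norm_sq D (\<lambda>z. f z - (\<Sum>j<Suc n. ?c j * F j z)) < \<epsilon>\<^sup>2" using nc by simp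
    then have "bergman_norm D (\<lambda>z. f z - (\<Sum>j<Suc n. ?c j * F j z)) < \<epsilon>"
      using \<epsilon> unfolding bergman_norm_eq by (intro real_less_lsqrt norm_sq_nonneg) auto
    then show ?thesis by (intro exI[of _ "Suc n"] exI[of _ ?c])
  qed
  ultimately have "bergman_basis D F" using eH by (auto simp: bergman_basis_def F_def)
  then show ?thesis by (rule exI[of "bergman_basis D" F])
qed

text \<open>Literally the choice made inside \<open>bergman_kernel_diag\<close>, so that the kernel
  unfolds to a series in \<open>onb\<close>.\<close>

definition onb :: "nat \<Rightarrow> complex^'n \<Rightarrow> complex" where
  "onb = (SOME F. bergman_basis D F)"

lemma onb_basis: "bergman_basis D onb"
  unfolding onb_def using bergman_basis_exists by (rule someI_ex)

lemma onb_bergman: "onb j \<in> bergman_space D"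
  and onb_orthonormal: "bergman_inner D (onb j) (onb k) = (if j = k then 1 else 0)"
  using onb_basis by (auto simp: bergman_basis_def)

text \<open>Density in the shape of the premise \<open>approx\<close> of
  \<open>annihilator_closure\<close> with \<open>J = UNIV\<close>.\<close>

lemma onb_dense:
  assumes "f \<in> bergman_space D" "\<epsilon> > 0"
  shows "\<exists>N c. N \<subseteq> UNIV \<and> norm_sq D (\<lambda>z. f z - (\<Sum>j\<in>N. c j * onb j z)) < \<epsilon>"
proof -
  have "\<forall>f\<in>bergman_space D. \<forall>\<epsilon>>0. \<exists>N c. bergman_norm D (\<lambda>z. f z - (\<Sum>j<N. c j * onb j z)) < \<epsilon>"
    using onb_basis unfolding bergman_basis_def by (elim conjE)
  from this[rule_format, OF assms(1), of "sqrt \<epsilon>"] assms(2)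
  obtain N :: nat and c where "bergman_norm D (\<lambda>z. f z - (\<Sum>j<N. c j * onb j z)) < sqrt \<epsilon>" by auto
  then have "norm_sq D (\<lambda>z. f z - (\<Sum>j<N. c j * onb j z)) < \<epsilon>" by (simp add: bergman_norm_eq)
  then show ?thesis by (intro exI[of _ "{..<N}"] exI[of _ c] conjI subset_UNIV)
qed

section \<open>The polarized Bergman kernel and its series\<close>

lemma F_sum_bound:
  assumes "\<And>f. f \<in> bergman_space D \<Longrightarrow> (cmod (f w))\<^sup>2 \<le> C * norm_sq D f" "C > 0"
  shows "(\<Sum>j<N. (cmod (onb j w))\<^sup>2) \<le> C"
  by (rule orthonormal_sum_bound) (use assms in \<open>auto simp: onb_bergman onb_orthonormal\<close>)

lemma onb_summable:
  assumes "w \<in> D" shows "summable (\<lambda>j. (cmod (onb j w))\<^sup>2)"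
proof -
  obtain r C where rC: "r > 0" "C > 0"
    "\<And>v f. v \<in> ball w r \<Longrightarrow> f \<in> bergman_space D \<Longrightarrow> (cmod (f v))\<^sup>2 \<le> C * norm_sq D f"
    using evaluation_bound_uniform[OF assms] by metis
  show ?thesis
    by (rule summableI_nonneg_bounded[where x = C]) (use F_sum_bound[of w C] rC in auto)
qed

lemma norm_onb_product: "norm (onb j v * cnj (onb j w)) \<le> (cmod (onb j v))\<^sup>2 + (cmod (onb j w))\<^sup>2"
  using sum_squares_bound[of "cmod (onb j v)" "cmod (onb j w)"]
    mult_nonneg_nonneg[OF norm_ge_zero[of "onb j v"] norm_ge_zero[of "onb j w"]]
  unfolding norm_mult complex_mod_cnj by linarith

definition polarized_kernel :: "complex^('n + 'n) \<Rightarrow> complex" where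
  "polarized_kernel p = (\<Sum>j. onb j (left_part p) * cnj (onb j (vcnj (right_part p))))"

text \<open>The product of \<open>D\<close> with its complex conjugate domain.\<close>

definition polarized_dom :: "(complex^('n + 'n)) set" where
  "polarized_dom = {p. left_part p \<in> D \<and> vcnj (right_part p) \<in> D}"

lemma kernel_sums:
  assumes "v \<in> D" "w \<in> D"
  shows "(\<lambda>j. onb j v * cnj (onb j w)) sums polarized_kernel (join v (vcnj w))"
proof -
  have "summable (\<lambda>j. onb j v * cnj (onb j w))"
    by (rule summable_comparison_test'[OF summable_add[OF onb_summable[OF assms(1)] onb_summable[OF assms(2)]]])
      (rule norm_onb_product)
  then show ?thesis by (simp add: polarized_kernel_def summable_sums)
qed

lemma kernel_summand_holomorphic:
  "holomorphic_function_on polarized_dom (\<lambda>p. onb j (left_part p) * cnj (onb j (vcnj (right_part p))))"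
proof (rule holomorphic_function_on_mult)
  note hol = bergman_holomorphic[OF onb_bergman[of j]]
  show "holomorphic_function_on polarized_dom (\<lambda>p. onb j (left_part p))"
    by (rule holomorphic_function_on_compose_map[OF hol, where g' = "\<lambda>_. left_part"])
      (auto simp: polarized_dom_def has_derivative_linear_vec linear_left_part vec_eq_iff)
  have lin: "linear (\<lambda>p :: complex^('n + 'n). vcnj (right_part p))"
    using linear_compose[OF linear_right_part linear_vcnj] by (simp add: o_def)
  show "holomorphic_function_on polarized_dom (\<lambda>p. cnj (onb j (vcnj (right_part p))))"
  proof (rule holomorphic_function_onI)
    fix p assume "p \<in> polarized_dom"
    then have p: "vcnj (right_part p) \<in> D" by (simp add: polarized_dom_def)
    show "((\<lambda>p. cnj (onb j (vcnj (right_part p)))) has_derivative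
        (\<lambda>v. cnj (fder (onb j) (vcnj (right_part p)) (vcnj (right_part v))))) (at p)"
      by (rule bounded_linear.has_derivative[OF bounded_linear_cnj
            has_derivative_compose[OF has_derivative_linear_vec[OF lin]
              holomorphic_function_on_has_derivative[OF hol p]]])
    have "vcnj (right_part (c *s v)) = cnj c *s vcnj (right_part v)" for c and v :: "complex^('n + 'n)"
      by (simp add: vec_eq_iff)
    then show "cnj (fder (onb j) (vcnj (right_part p)) (vcnj (right_part (c *s v)))) =
        c * cnj (fder (onb j) (vcnj (right_part p)) (vcnj (right_part v)))" for c and v :: "complex^('n + 'n)"
      by (simp add: fder_smult[OF hol p])
  qed
qed

lemma norm_part_le: "norm (left_part p) \<le> norm p" "norm (vcnj (right_part p)) \<le> norm p"
  for p :: "complex^('n + 'n)"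
proof -
  have n: "norm x = sqrt (\<Sum>i\<in>UNIV. (cmod (x $ i))\<^sup>2)" for x :: "complex^'k::finite"
    by (simp add: norm_vec_def L2_set_def)
  have "(\<Sum>i\<in>UNIV. (cmod (p $ i))\<^sup>2) = (\<Sum>i\<in>UNIV. (cmod (p $ Inl i))\<^sup>2) + (\<Sum>i\<in>UNIV. (cmod (p $ Inr i))\<^sup>2)"
    by (simp add: UNIV_Plus_UNIV[symmetric] sum.Plus del: UNIV_Plus_UNIV)
  moreover have "(\<Sum>i\<in>UNIV. (cmod (p $ Inl i))\<^sup>2) \<ge> 0" "(\<Sum>i\<in>UNIV. (cmod (p $ Inr i))\<^sup>2) \<ge> 0"
    by (intro sum_nonneg; simp)+
  ultimately show "norm (left_part p) \<le> norm p" "norm (vcnj (right_part p)) \<le> norm p"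
    unfolding n by (auto intro!: real_sqrt_le_mono)
qed

lemma open_kernel_dom: "open polarized_dom"
proof -
  have lin: "linear (\<lambda>p :: complex^('n + 'n). vcnj (right_part p))"
    using linear_compose[OF linear_right_part linear_vcnj] by (simp add: o_def)
  have "continuous_on UNIV (left_part :: complex^('n + 'n) \<Rightarrow> _)"
    "continuous_on UNIV (\<lambda>p :: complex^('n + 'n). vcnj (right_part p))"
    using linear_left_part lin by (auto intro!: linear_continuous_on simp: linear_conv_bounded_linear)
  then have "open ((left_part :: complex^('n + 'n) \<Rightarrow> _) -` D \<inter> (\<lambda>p. vcnj (right_part p)) -` D)"
    using openD by (intro open_Int open_vimage)
  then show ?thesis by (simp add: polarized_dom_def vimage_def Collect_conj_eq)
qed

text \<open>Near a point the partial sums are holomorphic and bounded by C1 + C2, the evaluation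
  constants of the two slots, so \<open>holomorphic_pointwise_limit\<close> applies to them.\<close>

lemma kernel_holomorphic: "holomorphic_function_on polarized_dom polarized_kernel"
proof -
  let ?g = "\<lambda>j p. onb j (left_part p) * cnj (onb j (vcnj (right_part p)))"
  let ?S = "\<lambda>N p. \<Sum>j<N. ?g j p"
  have "(polarized_kernel has_derivative fder polarized_kernel p) (at p) \<and> (\<forall>c v. fder polarized_kernel p (c *s v) = c * fder polarized_kernel p v)"
    if p: "p \<in> polarized_dom" for p
  proof -
    from p have z: "left_part p \<in> D" and w: "vcnj (right_part p) \<in> D" by (auto simp: polarized_dom_def)
    obtain r1 C1 where 1: "r1 > 0" "C1 > 0" "ball (left_part p) r1 \<subseteq> D"
      "\<And>v f. v \<in> ball (left_part p) r1 \<Longrightarrow> f \<in> bergman_space D \<Longrightarrow> (cmod (f v))\<^sup>2 \<le> C1 * norm_sq D f"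
      using evaluation_bound_uniform[OF z] by metis
    obtain r2 C2 where 2: "r2 > 0" "C2 > 0" "ball (vcnj (right_part p)) r2 \<subseteq> D"
      "\<And>v f. v \<in> ball (vcnj (right_part p)) r2 \<Longrightarrow> f \<in> bergman_space D \<Longrightarrow> (cmod (f v))\<^sup>2 \<le> C2 * norm_sq D f"
      using evaluation_bound_uniform[OF w] by metis
    define R where "R = min r1 r2"
    have R: "R > 0" using 1 2 by (simp add: R_def)
    have in1: "left_part q \<in> ball (left_part p) r1" and in2: "vcnj (right_part q) \<in> ball (vcnj (right_part p)) r2"
      if "q \<in> ball p R" for q
    proof -
      have "norm (p - q) < r1" "norm (p - q) < r2" using that by (auto simp: R_def dist_norm)
      moreover have "left_part p - left_part q = left_part (p - q)"
        "vcnj (right_part p) - vcnj (right_part q) = vcnj (right_part (p - q))" by (simp_all add: vec_eq_iff)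
      ultimately show "left_part q \<in> ball (left_part p) r1" "vcnj (right_part q) \<in> ball (vcnj (right_part p)) r2"
        using norm_part_le[of "p - q"] by (auto simp: dist_norm)
    qed
    have sub: "ball p R \<subseteq> polarized_dom" using in1 in2 1(3) 2(3) unfolding polarized_dom_def by blast
    have hol: "holomorphic_function_on (ball p R) (?S N)" for N
      by (intro holomorphic_function_on_sum holomorphic_function_on_subset[OF kernel_summand_holomorphic sub])
    have bd: "cmod (?S N q) \<le> C1 + C2" if q: "q \<in> ball p R" for N q
    proof -
      have "cmod (?S N q) \<le> (\<Sum>j<N. (cmod (onb j (left_part q)))\<^sup>2 + (cmod (onb j (vcnj (right_part q))))\<^sup>2)"
        by (intro sum_norm_le norm_onb_product)
      also have "\<dots> \<le> C1 + C2"
        unfolding sum.distrib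
        by (intro add_mono F_sum_bound 1 2 in1[OF q] in2[OF q])
      finally show ?thesis .
    qed
    have lim: "(\<lambda>N. ?S N q) \<longlonglongrightarrow> polarized_kernel q" if q: "q \<in> ball p R" for q
      using kernel_sums[of "left_part q" "vcnj (right_part q)"] sub q
      by (auto simp: sums_def polarized_dom_def)
    show ?thesis using holomorphic_pointwise_limit(1,2)[OF hol bd lim R] by blast
  qed
  then show ?thesis unfolding holomorphic_function_on_def by blast
qed

text \<open>Positivity: if every basis element vanished at \<open>z\<close>, evaluation at
  \<open>z\<close> would kill the whole Bergman space, including the constant 1.\<close>

lemma kernel_diag:
  assumes "z \<in> D"
  shows "polarized_kernel (join z (vcnj z)) = complex_of_real (bergman_kernel_diag D z)" "bergman_kernel_diag D z > 0"
proof -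
  have K: "bergman_kernel_diag D z = (\<Sum>j. (cmod (onb j z))\<^sup>2)" by (simp add: bergman_kernel_diag_def onb_def)
  have "(\<lambda>j. complex_of_real ((cmod (onb j z))\<^sup>2)) sums complex_of_real (bergman_kernel_diag D z)"
    unfolding K by (intro sums_of_real summable_sums onb_summable assms)
  then have "(\<lambda>j. onb j z * cnj (onb j z)) sums complex_of_real (bergman_kernel_diag D z)"
    by (simp only: complex_norm_square)
  then show "polarized_kernel (join z (vcnj z)) = complex_of_real (bergman_kernel_diag D z)"
    using kernel_sums[OF assms assms] sums_unique2 by blast
  have "bergman_kernel_diag D z \<noteq> 0"
  proof
    assume "bergman_kernel_diag D z = 0"
    then have "\<forall>j. (cmod (onb j z))\<^sup>2 = 0"
      unfolding K using suminf_eq_zero_iff[OF onb_summable[OF assms]] by simp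
    then have F0: "onb j z = 0" for j by simp
    have one: "(\<lambda>z. 1) \<in> bergman_space D"
      by (rule bergman_bounded[of _ 1]) (auto simp: holomorphic_function_on_const)
    have "(\<Sum>t\<in>{z}. 1 * (1 :: complex)) = 0"
      by (rule annihilator_closure[where x = "\<lambda>t. t" and a = "\<lambda>_. 1" and f = "\<lambda>_. 1" and G = onb and J = UNIV])
        (use assms one onb_bergman onb_dense[OF one] F0 in auto)
    then show False by simp
  qed
  moreover have "bergman_kernel_diag D z \<ge> 0"
    unfolding K by (intro suminf_nonneg onb_summable assms) auto
  ultimately show "bergman_kernel_diag D z > 0" by simp
qed

lemma bergman_hermitian_kernel: "hermitian_kernel D polarized_dom polarized_kernel (bergman_kernel_diag D)"
proof -
  have "flip p \<in> polarized_dom \<and> polarized_kernel (flip p) = cnj (polarized_kernel p)" if p: "p \<in> polarized_dom" for p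
  proof -
    let ?z = "left_part p" and ?w = "vcnj (right_part p)"
    have zw: "?z \<in> D" "?w \<in> D" using p by (auto simp: polarized_dom_def)
    have "(\<lambda>j. cnj (onb j ?z * cnj (onb j ?w))) sums cnj (polarized_kernel (join ?z (vcnj ?w)))"
      using kernel_sums[OF zw] by (simp only: sums_cnj)
    then have "(\<lambda>j. onb j ?w * cnj (onb j ?z)) sums cnj (polarized_kernel p)" by (simp add: mult.commute)
    moreover have "(\<lambda>j. onb j ?w * cnj (onb j ?z)) sums polarized_kernel (flip p)"
      using kernel_sums[OF zw(2,1)] by (simp add: flip_def)
    ultimately have "polarized_kernel (flip p) = cnj (polarized_kernel p)" using sums_unique2 by blast
    then show ?thesis using zw by (simp add: polarized_dom_def flip_def)
  qed
  moreover have "join z (vcnj z) \<in> polarized_dom" if "z \<in> D" for z using that by (simp add: polarized_dom_def)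
  ultimately show ?thesis
    unfolding hermitian_kernel_def using openD open_kernel_dom kernel_holomorphic kernel_diag by blast
qed

end

section \<open>The common submanifold\<close>

text \<open>A polynomial with m + 1 product terms; this number is the rank bound on the projective
  side.\<close>

lemma fubini_study_hermitian_kernel:
  "hermitian_kernel UNIV UNIV (\<lambda>p. 1 + (\<Sum>j\<in>UNIV. p $ Inl j * p $ Inr j))
    (\<lambda>w :: complex^'m::finite. 1 + (\<Sum>j\<in>UNIV. (cmod (w $ j))\<^sup>2))"
proof -
  have "1 + (\<Sum>j\<in>UNIV. (cmod (z $ j))\<^sup>2) > 0" for z :: "complex^'m"
    by (intro add_pos_nonneg sum_nonneg) auto
  moreover have "holomorphic_function_on UNIV (\<lambda>p :: complex^('m + 'm). 1 + (\<Sum>j\<in>UNIV. p $ Inl j * p $ Inr j))"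
    by (intro holomorphic_function_on_add holomorphic_function_on_sum holomorphic_function_on_mult
        holomorphic_function_on_const holomorphic_function_on_nth)
  ultimately show ?thesis
    by (simp add: hermitian_kernel_def flip_def mult.commute complex_norm_square del: of_real_power)
qed

text \<open>Nonzero velocity makes some coordinate of \<open>f\<close> nonconstant, so it takes
  infinitely many values. The points chosen on the curve differ in this coordinate, which is what
  \<open>bergman_separates_points\<close> asks for.\<close>

lemma (in bounded_dom) no_isometric_curves:
  fixes g :: "complex \<Rightarrow> complex^'m::finite" and f :: "complex \<Rightarrow> complex^'n"
  assumes r: "r > 0" and f: "curve_deriv r f f'" "\<And>t. cmod t < r \<Longrightarrow> f t \<in> D" and f0: "f' 0 \<noteq> 0"
    and g: "curve_deriv r g g'"
    and eq: "\<And>t. cmod t < r \<Longrightarrow> potential_metric (\<lambda>z. ln (bergman_kernel_diag D z)) (f t) (f' t) (f' t)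
      = potential_metric (\<lambda>w. ln (1 + (\<Sum>j\<in>UNIV. (cmod (w $ j))\<^sup>2))) (g t) (g' t) (g' t)"
  shows False
proof -
  obtain \<rho> \<alpha> \<beta> where \<rho>: "0 < \<rho>" "\<rho> \<le> r" and k: "\<And>t s. cmod t < \<rho> \<Longrightarrow> cmod s < \<rho> \<Longrightarrow>
      polarized_kernel (join (f t) (vcnj (f s))) = \<alpha> t * \<beta> s * (1 + (\<Sum>j\<in>UNIV. g t $ j * cnj (g s $ j)))"
    using equal_metrics_kernels_proportional[OF bergman_hermitian_kernel f fubini_study_hermitian_kernel g UNIV_I r eq]
    by (auto simp only: join_nth vcnj_nth)
  obtain i where i: "f' 0 $ i \<noteq> 0" using f0 by (auto simp: vec_eq_iff)
  define h where "h t = f t $ i" for t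
  have der: "(h has_field_derivative f' t $ i) (at t)" if "cmod t < \<rho>" for t
  proof -
    have "(f has_derivative (\<lambda>c. c *s f' t)) (at t)" using f(1) that \<rho> by (simp add: curve_deriv_def)
    from bounded_linear.has_derivative[OF bounded_linear_vec_nth this, of i]
    show ?thesis by (simp add: h_def[abs_def] has_field_derivative_def mult_commute_abs)
  qed
  have "infinite (h ` ball 0 \<rho>)"
  proof
    assume "finite (h ` ball 0 \<rho>)"
    moreover have "continuous_on (ball 0 \<rho>) h"
      by (intro continuous_at_imp_continuous_on ballI DERIV_isCont[OF der]) simp
    ultimately have "h constant_on ball 0 \<rho>"
      by (intro continuous_finite_range_constant) auto
    then obtain c where c: "\<And>t. t \<in> ball 0 \<rho> \<Longrightarrow> h t = c" by (auto simp: constant_on_def)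
    have "((\<lambda>_. c) has_field_derivative f' 0 $ i) (at 0)"
      by (rule has_field_derivative_transform_within_open[OF der[of 0] open_ball[of 0 \<rho>]]) (use \<rho> c in auto)
    then show False using i DERIV_unique DERIV_const by blast
  qed
  \<comment> \<open>\<open>'m option\<close> indexes the m + 1 terms of the Fubini-Study kernel,
    \<open>None\<close> standing for the summand 1; one point more than terms is taken.\<close>
  then obtain T where T: "T \<subseteq> ball 0 \<rho>" "finite T" "card T = card (UNIV :: 'm option set) + 1" "inj_on h T"
    using ex_inj_on_card by metis
  have t\<rho>: "cmod t < \<rho>" if "t \<in> T" for t using T(1) that by auto
  have fD: "f t \<in> D" if "t \<in> T" for t using t\<rho>[OF that] \<rho> f(2) by auto
  \<comment> \<open>\<alpha>(t) varies with the summation index, so it is built into the functions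
    to be annihilated; \<beta>(s) factors out of the sum over t.\<close>
  define \<phi> where "\<phi> j t = \<alpha> t * (case j of None \<Rightarrow> 1 | Some j \<Rightarrow> g t $ j)" for j :: "'m option" and t
  obtain a where a: "\<exists>t\<in>T. a t \<noteq> 0" "\<forall>j\<in>UNIV. (\<Sum>t\<in>T. a t * \<phi> j t) = 0"
    using common_annihilator[OF finite_class.finite_UNIV T(2), of \<phi>] T(3) by auto
  have k\<phi>: "polarized_kernel (join (f t) (vcnj (f s))) = \<beta> s * (\<Sum>j\<in>UNIV. \<phi> j t * (case j of None \<Rightarrow> 1 | Some j \<Rightarrow> cnj (g s $ j)))"
    if "t \<in> T" "s \<in> T" for t s
    using k[OF t\<rho>[OF that(1)] t\<rho>[OF that(2)]]
    by (simp add: UNIV_option_conv sum.reindex \<phi>_def algebra_simps sum_distrib_left)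
  have zero: "(\<Sum>t\<in>T. a t * polarized_kernel (join (f t) (vcnj (f s)))) = 0" if s: "s \<in> T" for s
  proof -
    let ?c = "\<lambda>j. case j of None \<Rightarrow> 1 | Some j \<Rightarrow> cnj (g s $ j)"
    have "(\<Sum>t\<in>T. a t * polarized_kernel (join (f t) (vcnj (f s)))) = (\<Sum>t\<in>T. a t * (\<beta> s * (\<Sum>j\<in>UNIV. \<phi> j t * ?c j)))"
      by (intro sum.cong refl) (simp only: k\<phi> s)
    also have "\<dots> = (\<Sum>t\<in>T. \<Sum>j\<in>UNIV. \<beta> s * ?c j * (a t * \<phi> j t))"
      by (simp only: sum_distrib_left mult_ac)
    also have "\<dots> = (\<Sum>j\<in>UNIV. \<beta> s * ?c j * (\<Sum>t\<in>T. a t * \<phi> j t))"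
      by (subst sum.swap) (simp only: sum_distrib_left)
    also have "\<dots> = 0" using a(2) by simp
    finally show ?thesis .
  qed
  \<comment> \<open>The functional applied to the basis. The quadratic form of the kernel matrix
    with coefficients \<open>a\<close> is the series of the squares |G j|^2, and it is 0.\<close>
  define G where "G j = (\<Sum>t\<in>T. a t * onb j (f t))" for j
  have "(\<lambda>j. \<Sum>s\<in>T. cnj (a s) * (\<Sum>t\<in>T. a t * (onb j (f t) * cnj (onb j (f s))))) sums
      (\<Sum>s\<in>T. cnj (a s) * (\<Sum>t\<in>T. a t * polarized_kernel (join (f t) (vcnj (f s)))))"
    by (intro sums_sum sums_mult kernel_sums fD)
  then have "(\<lambda>j. \<Sum>s\<in>T. cnj (a s) * (\<Sum>t\<in>T. a t * (onb j (f t) * cnj (onb j (f s))))) sums 0"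
    by (simp add: zero)
  moreover have "(\<Sum>s\<in>T. cnj (a s) * (\<Sum>t\<in>T. a t * (onb j (f t) * cnj (onb j (f s))))) = complex_of_real ((cmod (G j))\<^sup>2)" for j
  proof -
    have "complex_of_real ((cmod (G j))\<^sup>2) = G j * cnj (G j)" by (rule complex_norm_square)
    also have "\<dots> = (\<Sum>s\<in>T. cnj (a s) * (\<Sum>t\<in>T. a t * (onb j (f t) * cnj (onb j (f s)))))"
      unfolding G_def cnj_sum sum_distrib_left sum_distrib_right
      by (simp add: mult_ac)
    finally show ?thesis by simp
  qed
  ultimately have "(\<lambda>j. complex_of_real ((cmod (G j))\<^sup>2)) sums complex_of_real 0" by simp
  then have s: "(\<lambda>j. (cmod (G j))\<^sup>2) sums 0" by (simp only: sums_of_real_iff)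
  then have "\<forall>j. (cmod (G j))\<^sup>2 = 0"
    using suminf_eq_zero_iff[OF sums_summable[OF s]] sums_unique[OF s] by simp
  then have G0: "(\<Sum>t\<in>T. a t * onb j (f t)) = 0" for j by (simp add: G_def)
  obtain t0 where t0: "t0 \<in> T" "a t0 \<noteq> 0" using a(1) by blast
  have inj: "inj_on (\<lambda>t. f t $ i) T" using T(4) by (simp add: h_def[abs_def])
  obtain q where q: "q \<in> bergman_space D" "(\<Sum>t\<in>T. a t * q (f t)) \<noteq> 0"
    using bergman_separates_points[where x = f and a = a, OF T(2) fD inj t0] by blast
  have "(\<Sum>t\<in>T. a t * q (f t)) = 0"
    by (rule annihilator_closure[where x = f and a = a and G = onb and J = UNIV, OF T(2) fD onb_bergman G0 q(1) onb_dense[OF q(1)]])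
  with q(2) show False by simp
qed

section \<open>From immersions of manifolds to holomorphic curves\<close>

lemma holomorphic_map_on_has_derivative:
  assumes "holomorphic_map_on S f" "z \<in> S"
  shows "(f has_derivative fder f z) (at z)"
  using assms unfolding holomorphic_map_on_def
  by (meson differentiable_def frechet_derivative_works)

lemma holomorphic_map_on_smult:
  assumes "holomorphic_map_on S f" "z \<in> S"
  shows "fder f z (c *s v) = c *s fder f z v"
  using assms unfolding holomorphic_map_on_def by (metis fder_eq)

lemma complex_line_curve:
  assumes "\<And>t. cmod t < r \<Longrightarrow> (f has_derivative f' (x + t *s e)) (at (x + t *s e))"
    and "\<And>t c v. cmod t < r \<Longrightarrow> f' (x + t *s e) (c *s v) = c *s f' (x + t *s e) v"
  shows "curve_deriv r (\<lambda>t. f (x + t *s e)) (\<lambda>t. f' (x + t *s e) e)"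
  unfolding curve_deriv_def
proof (intro allI impI)
  fix t assume t: "cmod t < r"
  have "((\<lambda>t. x + t *s e) has_derivative (\<lambda>c. 0 + c *s e)) (at t)"
    by (rule has_derivative_add[OF has_derivative_const
          bounded_linear_imp_has_derivative[OF bounded_linear_smult_left]])
  from has_derivative_compose[OF this assms(1)[OF t]] assms(2)[OF t]
  show "((\<lambda>t. f (x + t *s e)) has_derivative (\<lambda>c. c *s f' (x + t *s e) e)) (at t)" by simp
qed

lemma fst_aff_chart: "fst (aff_chart a) = proj_point ` {Z. Z $ a \<noteq> 0}"
  by (simp add: aff_chart_def)

lemma openin_aff_chart: "openin proj_topology (fst (aff_chart a))"
  for a :: "'m::finite option"
  unfolding openin_proj_topology
proof
  have nz: "{Z :: complex^'m option. Z $ a \<noteq> 0} \<subseteq> - {0}" by force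
  then show "fst (aff_chart a) \<subseteq> proj_point ` (- {0})" unfolding fst_aff_chart by (rule image_mono)
  \<comment> \<open>Homogeneous coordinate vectors of a point differ by nonzero scalars, so whether
    the entry at \<open>a\<close> vanishes depends on the point only.\<close>
  have "proj_point Z \<in> fst (aff_chart a) \<longleftrightarrow> Z $ a \<noteq> 0" for Z
  proof
    assume "proj_point Z \<in> fst (aff_chart a)"
    then obtain Y where Y: "proj_point Z = proj_point Y" "Y $ a \<noteq> 0" unfolding fst_aff_chart by blast
    have "Z \<in> proj_point Z" unfolding proj_point_def by (intro CollectI exI[of _ 1]) simp
    then have "Z \<in> proj_point Y" by (simp only: Y(1))
    then obtain c where "Z = c *s Y" "c \<noteq> 0" unfolding proj_point_def by blast
    then show "Z $ a \<noteq> 0" using Y(2) by simp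
  next
    assume "Z $ a \<noteq> 0"
    then show "proj_point Z \<in> fst (aff_chart a)" unfolding fst_aff_chart by blast
  qed
  then have "{Z. Z \<noteq> 0 \<and> proj_point Z \<in> fst (aff_chart a)} = {Z. Z $ a \<noteq> 0}" using nz by blast
  moreover have "open {Z :: complex^'m option. Z $ a \<noteq> 0}"
    by (intro open_Collect_neq continuous_intros)
  ultimately show "open {Z. Z \<noteq> 0 \<and> proj_point Z \<in> fst (aff_chart a)}" by simp
qed

lemma topspace_proj_subset: "topspace (proj_topology :: (complex^('m::finite option)) set topology) \<subseteq> (\<Union>a. fst (aff_chart a))"
proof
  fix q assume "q \<in> topspace (proj_topology :: (complex^('m option)) set topology)"
  then obtain U where "openin proj_topology U" "q \<in> U" by (auto simp: topspace_def)
  then obtain Z where "Z \<noteq> 0" "q = proj_point Z" unfolding openin_proj_topology by blast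
  moreover from this obtain a where "Z $ a \<noteq> 0" by (auto simp: vec_eq_iff)
  ultimately show "q \<in> (\<Union>a. fst (aff_chart a))" unfolding fst_aff_chart by blast
qed

lemma complex_manifold_chartE:
  assumes "complex_manifold M" "p \<in> topspace (mtop M)"
  obtains c where "c \<in> atlas M" "p \<in> fst c" "openin (mtop M) (fst c)"
proof -
  have "\<Union> (fst ` atlas M) = topspace (mtop M)" and o: "\<And>c. c \<in> atlas M \<Longrightarrow> openin (mtop M) (fst c)"
    using assms(1) by (simp_all add: complex_manifold_def)
  then have "p \<in> \<Union> (fst ` atlas M)" using assms(2) by simp
  then show ?thesis using that o by blast
qed

lemma chart_image_open:
  assumes M: "complex_manifold M" and c: "c \<in> atlas M" and O: "openin (mtop M) W" "W \<subseteq> fst c"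
  shows "open (snd c ` W)"
proof -
  have *: "open (snd c ` fst c)" "homeomorphic_map (subtopology (mtop M) (fst c)) (top_of_set (snd c ` fst c)) (snd c)"
    using M c by (auto simp: complex_manifold_def)
  have "openin (subtopology (mtop M) (fst c)) W"
    using O by (auto simp: openin_subtopology intro: exI[of _ W])
  then have "openin (top_of_set (snd c ` fst c)) (snd c ` W)"
    using homeomorphic_imp_open_map[OF *(2)] by (simp add: open_map_def)
  then show ?thesis using *(1) openin_open_eq by blast
qed

lemma chart_inj_on:
  assumes M: "complex_manifold M" and c: "c \<in> atlas M" shows "inj_on (snd c) (fst c)"
proof -
  have o: "openin (mtop M) (fst c)"
    and h: "homeomorphic_map (subtopology (mtop M) (fst c)) (top_of_set (snd c ` fst c)) (snd c)"
    using M c by (auto simp: complex_manifold_def)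
  show ?thesis
    using homeomorphic_imp_injective_map[OF h] openin_subset[OF o]
    by (simp add: Int_absorb1)
qed

theorem theorem1p2:
  fixes D :: "(complex^'n::finite) set"
    and V :: "((complex^('m::finite option)) set, 'd::finite) hermitian_mfd"
  assumes "bounded_domain D"
    and "kahler_submanifold V fubini_study"
  shows "\<not> r_relatives TYPE(('s, 'r::finite) hermitian_mfd) (bergman_mfd D) V"
proof
  assume "r_relatives TYPE(('s, 'r) hermitian_mfd) (bergman_mfd D) V"
  then obtain S :: "('s, 'r) hermitian_mfd" and h1 h2 where S: "kahler_manifold S" "topspace (mtop S) \<noteq> {}"
    and h1: "kahler_immersion S (bergman_mfd D) h1" and h2: "kahler_immersion S V h2"
    unfolding r_relatives_def by blast
  interpret bounded_dom D by unfold_locales (rule assms(1))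
  have mS: "complex_manifold S" using S(1) by (simp add: kahler_manifold_def)
  have V: "complex_manifold V" and V_top: "mtop V = subtopology proj_topology (topspace (mtop V))"
    and V_sub: "topspace (mtop V) \<subseteq> topspace proj_topology"
    and V_imm: "kahler_immersion V fubini_study (\<lambda>p. p)"
    using assms(2) by (auto simp: kahler_submanifold_def kahler_manifold_def fubini_study_def)
  obtain p where p: "p \<in> topspace (mtop S)" using S(2) by blast
  then obtain c where c: "c \<in> atlas S" "p \<in> fst c" and copen: "openin (mtop S) (fst c)"
    using complex_manifold_chartE[OF mS] by blast
  have cont1: "continuous_map (mtop S) (top_of_set D) h1" and cont2: "continuous_map (mtop S) (mtop V) h2"
    using h1 h2 by (auto simp: kahler_immersion_def holomorphic_mfd_map_def bergman_mfd_def)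
  have h2p: "h2 p \<in> topspace (mtop V)" using cont2 p by (auto simp: continuous_map_def)
  then obtain d where d: "d \<in> atlas V" "h2 p \<in> fst d" and dopen: "openin (mtop V) (fst d)"
    using complex_manifold_chartE[OF V] by blast
  obtain a where a: "h2 p \<in> fst (aff_chart a)" using h2p V_sub topspace_proj_subset by blast
  let ?d1 = "(D, \<lambda>z. z) :: (complex^'n, 'n) chart"
  have d1: "?d1 \<in> atlas (bergman_mfd D)" by (simp add: bergman_mfd_def)
  have da: "aff_chart a \<in> atlas fubini_study" by (simp add: fubini_study_def)
  define A where "A = topspace (mtop V) \<inter> fst (aff_chart a)"
  \<comment> \<open>The comparison takes place in a single chart of each manifold, so
    \<open>S\<close> is shrunk to the points that \<open>h2\<close> sends into the chart
    \<open>d\<close> of \<open>V\<close> and into one affine chart.\<close>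
  define W where "W = {q \<in> topspace (mtop S). h2 q \<in> fst d \<inter> A} \<inter> fst c"
  have "openin (mtop V) A"
    unfolding A_def using openin_aff_chart[of a] V_top by (metis inf_commute openin_subtopology)
  then have Wopen: "openin (mtop S) W"
    unfolding W_def using dopen copen by (intro openin_Int openin_continuous_map_preimage[OF cont2])
  have pW: "p \<in> W" using p c d a h2p by (simp add: W_def A_def)
  have "open (snd c ` W)" by (rule chart_image_open[OF mS c(1) Wopen]) (simp add: W_def)
  then obtain \<rho> where \<rho>: "\<rho> > 0" "ball (snd c p) \<rho> \<subseteq> snd c ` W"
    using pW open_contains_ball by blast
  define f where "f = local_expr c ?d1 h1"
  define g1 where "g1 = local_expr c d h2"
  define g2 where "g2 = local_expr d (aff_chart a) (\<lambda>p. p)"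
  define x where "x = snd c p"
  have inv: "coord_inv c (snd c q) = q" if "q \<in> fst c" for q
    unfolding coord_inv_def by (rule inv_into_f_f[OF chart_inj_on[OF mS c(1)] that])
  have dom1: "y \<in> local_dom c ?d1 h1" and fD: "f y \<in> D" and dom2: "y \<in> local_dom c d h2"
    and dom3: "g1 y \<in> local_dom d (aff_chart a) (\<lambda>p. p)" if y: "y \<in> ball x \<rho>" for y
  proof -
    obtain q where q: "q \<in> W" "y = snd c q" using \<rho>(2) y by (auto simp: x_def)
    have qS: "q \<in> topspace (mtop S)" "q \<in> fst c" "h2 q \<in> fst d" "h2 q \<in> fst (aff_chart a)"
      using q(1) by (auto simp: W_def A_def)
    have "h1 q \<in> D" using cont1 qS(1) by (auto simp: continuous_map_def)
    then show "y \<in> local_dom c ?d1 h1" "f y \<in> D"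
      using q(2) qS inv[of q] by (auto simp: local_dom_def f_def local_expr_def)
    show "y \<in> local_dom c d h2" using q(2) qS by (auto simp: local_dom_def)
    show "g1 y \<in> local_dom d (aff_chart a) (\<lambda>p. p)"
      using q(2) qS inv[of q] by (auto simp: local_dom_def g1_def local_expr_def)
  qed
  have hol1: "holomorphic_map_on (local_dom c ?d1 h1) f"
    and hol2: "holomorphic_map_on (local_dom c d h2) g1"
    and hol3: "holomorphic_map_on (local_dom d (aff_chart a) (\<lambda>p. p)) g2"
    using h1 h2 V_imm c(1) d(1) d1 da
    unfolding kahler_immersion_def holomorphic_mfd_map_def f_def g1_def g2_def by blast+
  let ?B = "potential_metric (\<lambda>z. ln (bergman_kernel_diag D z))"
  let ?FS = "potential_metric (\<lambda>w :: complex^'m. ln (1 + (\<Sum>j\<in>UNIV. (cmod (w $ j))\<^sup>2)))"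
  have met1: "metric S c y u v = ?B (f y) (fder f y u) (fder f y v)" "inj (fder f y)"
    if "y \<in> ball x \<rho>" for y u v
    using h1 c(1) d1 dom1[OF that] unfolding kahler_immersion_def f_def
    by (auto simp: bergman_mfd_def)
  \<comment> \<open>The immersion into \<open>V\<close> is followed by the inclusion into projective
    space; the metric of \<open>V\<close> is only an intermediate term and disappears.\<close>
  have met2: "metric S c y u v = ?FS (g2 (g1 y)) (fder g2 (g1 y) (fder g1 y u)) (fder g2 (g1 y) (fder g1 y v))"
    if y: "y \<in> ball x \<rho>" for y u v
  proof -
    have "metric S c y u v = metric V d (g1 y) (fder g1 y u) (fder g1 y v)"
      using h2 c(1) d(1) dom2[OF y] unfolding kahler_immersion_def g1_def by blast
    also have "\<dots> = metric fubini_study (aff_chart a) (g2 (g1 y)) (fder g2 (g1 y) (fder g1 y u)) (fder g2 (g1 y) (fder g1 y v))"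
      using V_imm d(1) da dom3[OF y] unfolding kahler_immersion_def g2_def by blast
    finally show ?thesis by (simp add: fubini_study_def)
  qed
  \<comment> \<open>Index types are inhabited, so \<open>S\<close> has positive dimension and a
    coordinate direction exists.\<close>
  fix i :: 'r
  define e where "e = axis i (1 :: complex)"
  have e: "norm e = 1" by (simp add: e_def norm_eq_sqrt_inner inner_axis_axis)
  have line: "x + t *s e \<in> ball x \<rho>" if "cmod t < \<rho>" for t
    using that by (simp add: dist_norm norm_vector_smult e)
  let ?f = "\<lambda>t. f (x + t *s e)" and ?f' = "\<lambda>t. fder f (x + t *s e) e"
  let ?g = "\<lambda>t. g2 (g1 (x + t *s e))" and ?g' = "\<lambda>t. fder g2 (g1 (x + t *s e)) (fder g1 (x + t *s e) e)"
  show False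
  proof (rule no_isometric_curves[where f = ?f and f' = ?f' and g = ?g and g' = ?g', OF \<rho>(1)])
    show "curve_deriv \<rho> ?f ?f'"
      by (rule complex_line_curve)
        (use holomorphic_map_on_has_derivative[OF hol1] holomorphic_map_on_smult[OF hol1] dom1 line in auto)
    show "?f t \<in> D" if "cmod t < \<rho>" for t using fD line that by blast
    show "curve_deriv \<rho> ?g ?g'"
    proof (rule complex_line_curve[where f = "\<lambda>y. g2 (g1 y)" and f' = "\<lambda>y v. fder g2 (g1 y) (fder g1 y v)"])
      fix t assume "cmod t < \<rho>"
      note y = line[OF this]
      show "((\<lambda>y. g2 (g1 y)) has_derivative (\<lambda>v. fder g2 (g1 (x + t *s e)) (fder g1 (x + t *s e) v))) (at (x + t *s e))"
        by (rule has_derivative_compose[OF holomorphic_map_on_has_derivative[OF hol2 dom2[OF y]]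
              holomorphic_map_on_has_derivative[OF hol3 dom3[OF y]]])
      show "fder g2 (g1 (x + t *s e)) (fder g1 (x + t *s e) (c *s v)) =
          c *s fder g2 (g1 (x + t *s e)) (fder g1 (x + t *s e) v)" for c v
        by (simp add: holomorphic_map_on_smult[OF hol2 dom2[OF y]] holomorphic_map_on_smult[OF hol3 dom3[OF y]])
    qed
    have xb: "x \<in> ball x \<rho>" using \<rho> by simp
    have "linear (fder f x)"
      using holomorphic_map_on_has_derivative[OF hol1 dom1[OF xb]] by (rule has_derivative_linear)
    \<comment> \<open>The differential of an immersion is injective, so the unit vector
      \<open>e\<close> yields a curve with nonzero velocity at 0.\<close>
    then have "fder f x e \<noteq> 0"
      using met1(2)[OF xb] e linear_injective_0 by (metis norm_zero zero_neq_one)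
    then show "?f' 0 \<noteq> 0" by simp
    show "?B (?f t) (?f' t) (?f' t) = ?FS (?g t) (?g' t) (?g' t)" if "cmod t < \<rho>" for t
      using met1(1)[OF line[OF that], of e e] met2[OF line[OF that], of e e] by simp
  qed
qed

end
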